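(* Let $G$ be a polycyclic group and let $\varphi:G\to G$ be an endomorphism with $R(\varphi)<\infty$. Then TBFT$_{ff}$ is true for $\varphi$, i.e. $R(\varphi)$ is equal to the number of $\widehat\varphi$-f-points in $\widehat G_{ff}$.
   Context: For an endomorphism $\varphi$ of a (discrete) group $G$, the Reidemeister ($\varphi$-conjugacy) classes are the equivalence classes of the relation $g\sim xg\varphi(x^{-1})$, $x\in G$, and $R(\varphi)$ is the number of these classes. The unitary dual $\widehat G$ is the set of (unitary) equivalence classes of irreducible unitary representations of $G$; $\widehat G_f\subset\widehat G$ is the part formed by finite-dimensional representations; $\widehat G_{ff}\subset \widehat G_f$ is the part formed by finite representations, i.e. those that factor through a finite group. A class $[\rho]\in\widehat G$ is called a $\widehat\varphi$-f-point if $\rho$ is equivalent to $\rho\circ\varphi$. One says that TBFT$_{ff}$ is true for $\varphi$ if $R(\varphi)<\infty$ and $R(\varphi)$ coincides with the number of $\widehat\varphi$-f-points in $\widehat G_{ff}$. *)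

theory Defs
  imports
    "HOL-Algebra.Algebra"
    "HOL-Library.Extended_Nat"
    "Jordan_Normal_Form.Schur_Decomposition"
begin

definition ecard :: "'a set \<Rightarrow> enat"
  where "ecard A = (if finite A then enat (card A) else \<infinity>)"


subsection \<open>Polycyclic groups\<close>

definition polycyclic :: "('a, 'b) monoid_scheme \<Rightarrow> bool"
  where "polycyclic G \<longleftrightarrow>
    (\<exists>(n::nat) H. H 0 = {\<one>\<^bsub>G\<^esub>} \<and> H n = carrier G \<and>
      (\<forall>i\<le>n. subgroup (H i) G) \<and>
      (\<forall>i<n. H i \<lhd> (G \<lparr>carrier := H (Suc i)\<rparr>) \<and>
             cyclic_group ((G \<lparr>carrier := H (Suc i)\<rparr>) Mod H i)))"


subsection \<open>Reidemeister classes\<close>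

definition reidemeister_rel :: "('a, 'b) monoid_scheme \<Rightarrow> ('a \<Rightarrow> 'a) \<Rightarrow> ('a \<times> 'a) set"
  where "reidemeister_rel G \<phi> =
    {(g, h). g \<in> carrier G \<and> h \<in> carrier G \<and>
             (\<exists>x\<in>carrier G. h = x \<otimes>\<^bsub>G\<^esub> g \<otimes>\<^bsub>G\<^esub> \<phi> (inv\<^bsub>G\<^esub> x))}"

definition reidemeister_classes :: "('a, 'b) monoid_scheme \<Rightarrow> ('a \<Rightarrow> 'a) \<Rightarrow> 'a set set"
  where "reidemeister_classes G \<phi> = carrier G // reidemeister_rel G \<phi>"

definition reidemeister_number :: "('a, 'b) monoid_scheme \<Rightarrow> ('a \<Rightarrow> 'a) \<Rightarrow> enat"
  where "reidemeister_number G \<phi> = ecard (reidemeister_classes G \<phi>)"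


subsection \<open>Finite-dimensional unitary representations\<close>

text \<open>
  After the choice of an orthonormal basis, a unitary representation on an n-dimensional Hilbert
  space is a homomorphism into the group of unitary n by n matrices.  Representations are total
  functions on the ambient type; everything below depends only on their values on the carrier.
\<close>

definition unitary_group :: "nat \<Rightarrow> complex mat monoid"
  where "unitary_group n =
    \<lparr>carrier = {U \<in> carrier_mat n n. U * mat_adjoint U = 1\<^sub>m n \<and> mat_adjoint U * U = 1\<^sub>m n},
     monoid.mult = (*), one = 1\<^sub>m n\<rparr>"

definition unitary_rep :: "('a, 'b) monoid_scheme \<Rightarrow> nat \<Rightarrow> ('a \<Rightarrow> complex mat) \<Rightarrow> bool"
  where "unitary_rep G n \<rho> \<longleftrightarrow> \<rho> \<in> hom G (unitary_group n)"

text \<open>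
  The constant \<open>VectorSpace.subspace\<close> is the carrier-based notion used by the matrix library,
  not the type class notion of the same base name.
\<close>

definition irreducible_rep :: "('a, 'b) monoid_scheme \<Rightarrow> nat \<Rightarrow> ('a \<Rightarrow> complex mat) \<Rightarrow> bool"
  where "irreducible_rep G n \<rho> \<longleftrightarrow>
    unitary_rep G n \<rho> \<and> n > 0 \<and>
    (\<forall>W. VectorSpace.subspace class_ring W (module_vec TYPE(complex) n) \<and>
         (\<forall>g\<in>carrier G. \<forall>w\<in>W. \<rho> g *\<^sub>v w \<in> W)
       \<longrightarrow> W = {0\<^sub>v n} \<or> W = carrier_vec n)"

definition rep_equiv ::
    "('a, 'b) monoid_scheme \<Rightarrow> ('a \<Rightarrow> complex mat) \<Rightarrow> ('a \<Rightarrow> complex mat) \<Rightarrow> bool"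
  where "rep_equiv G \<rho> \<sigma> \<longleftrightarrow>
    (\<exists>n. unitary_rep G n \<rho> \<and> unitary_rep G n \<sigma> \<and>
         (\<exists>U\<in>carrier (unitary_group n). \<forall>g\<in>carrier G. U * \<rho> g = \<sigma> g * U))"

text \<open>Every finite group has an isomorphic copy with carrier in \<open>nat\<close>.\<close>

definition finite_rep :: "('a, 'b) monoid_scheme \<Rightarrow> ('a \<Rightarrow> complex mat) \<Rightarrow> bool"
  where "finite_rep G \<rho> \<longleftrightarrow>
    (\<exists>(F::nat monoid) p n \<sigma>. group F \<and> finite (carrier F) \<and> p \<in> hom G F \<and>
       unitary_rep F n \<sigma> \<and> (\<forall>g\<in>carrier G. \<rho> g = \<sigma> (p g)))"


subsection \<open>The finite-dimensional and finite parts of the unitary dual\<close>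

definition irreps_f :: "('a, 'b) monoid_scheme \<Rightarrow> ('a \<Rightarrow> complex mat) set"
  where "irreps_f G = {\<rho>. \<exists>n. irreducible_rep G n \<rho>}"

definition unitary_dual_f :: "('a, 'b) monoid_scheme \<Rightarrow> ('a \<Rightarrow> complex mat) set set"
  where "unitary_dual_f G =
    irreps_f G // {(\<rho>, \<sigma>). \<rho> \<in> irreps_f G \<and> \<sigma> \<in> irreps_f G \<and> rep_equiv G \<rho> \<sigma>}"

definition unitary_dual_ff :: "('a, 'b) monoid_scheme \<Rightarrow> ('a \<Rightarrow> complex mat) set set"
  where "unitary_dual_ff G = {c \<in> unitary_dual_f G. \<exists>\<rho>\<in>c. finite_rep G \<rho>}"

text \<open>
  If \<open>\<phi>\<close> is not surjective, \<open>\<rho> \<circ> \<phi>\<close> may be reducible, so the condition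
  is stated for representatives: \<open>\<phi>\<close> need not induce a map on classes.
\<close>

definition f_point ::
    "('a, 'b) monoid_scheme \<Rightarrow> ('a \<Rightarrow> 'a) \<Rightarrow> ('a \<Rightarrow> complex mat) set \<Rightarrow> bool"
  where "f_point G \<phi> c \<longleftrightarrow> (\<exists>\<rho>\<in>c. rep_equiv G \<rho> (\<rho> \<circ> \<phi>))"

definition TBFT_ff :: "('a, 'b) monoid_scheme \<Rightarrow> ('a \<Rightarrow> 'a) \<Rightarrow> bool"
  where "TBFT_ff G \<phi> \<longleftrightarrow>
    reidemeister_number G \<phi> < \<infinity> \<and>
    reidemeister_number G \<phi> = ecard {c \<in> unitary_dual_ff G. f_point G \<phi> c}"

end

theory Submission
  imports Defs "HOL-Computational_Algebra.Fundamental_Theorem_Algebra" "HOL-Library.Function_Algebras"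
begin

text \<open>
  Call a representation \<open>\<rho>\<close> with finite image an f-point if it is equivalent to \<open>\<rho> \<circ> \<phi>\<close>.  The theorem
  compares two bases of the space of class functions, that is of the complex functions on \<open>G\<close> that
  are constant on Reidemeister classes.  One basis consists of the indicator functions of the
  classes.  The other one consists of the twisted trace functions \<open>g \<mapsto> tr (U \<rho>(g))\<close>, where \<open>\<rho>\<close> runs
  through the irreducible f-points and \<open>U\<close> intertwines \<open>\<rho>\<close> with \<open>\<rho> \<circ> \<phi>\<close>; the intertwiner is unique
  up to a scalar by Schur's lemma, so every f-point counts once.

  The twisted traces are class functions, and they are linearly independent because matrix
  coefficients of inequivalent irreducible representations are
  (\<open>coefficients_independent\<close>).  They span because of two facts.  First, the classes are
  unions of cosets of one normal subgroup of finite index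
  (\<open>finite_twisted_imp_open_classes\<close>), so that an indicator function lives on a finite
  quotient and is a sum of coefficients of irreducible representations of that quotient
  (\<open>coefficients_complete\<close>).  Second, the twisted action \<open>g \<mapsto> x g \<phi>(x)\<^sup>-\<^sup>1\<close> maps the
  coefficients of \<open>\<rho>\<close> to coefficients of \<open>\<rho>\<close>, so an invariant sum has invariant summands
  \<open>g \<mapsto> tr (B \<rho>(g))\<close>, and invariance means that \<open>B\<close> intertwines \<open>\<rho>\<close> with \<open>\<rho> \<circ> \<phi>\<close>
  (\<open>class_function_coefficients_intertwine\<close>).

  That the classes are unions of cosets of a subgroup of finite index is where \<open>G\<close> has to be
  polycyclic.  It is enough to find such a subgroup inside the class \<open>{x \<phi>(x)\<^sup>-\<^sup>1}\<close> of the identity,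
  for every endomorphism with finitely many classes.  The proof is an induction on the derived
  length.  Let \<open>A\<close> be the last nontrivial derived subgroup.  By induction the fixed points of \<open>\<phi>\<close> on
  \<open>G/A\<close> are finite in number, and then finiteness of the number of classes forces \<open>a \<mapsto> a \<phi>(a)\<^sup>-\<^sup>1\<close>
  to have an image of finite index in \<open>A\<close> (\<open>abelian_layer\<close>).  This image contains all \<open>e\<close>-th
  powers of \<open>A\<close> for some \<open>e\<close>, and they may be factored out.  What remains is a finite normal
  subgroup; by residual finiteness some invariant subgroup of finite index avoids it and has smaller
  derived length (\<open>finite_twisted_imp_open_class\<close>).
\<close>

section \<open>Subgroups of finite index and power subgroups\<close>

context group
begin

lemma cancel_inv_left [simp]:
  "x \<in> carrier G \<Longrightarrow> y \<in> carrier G \<Longrightarrow> x \<otimes> (inv x \<otimes> y) = y"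
  "x \<in> carrier G \<Longrightarrow> y \<in> carrier G \<Longrightarrow> inv x \<otimes> (x \<otimes> y) = y"
  by (simp_all add: m_assoc[symmetric])

lemmas word_simps = m_assoc inv_mult_group

text \<open>Sections \<open>H/K\<close> are described by subgroups of one fixed group.  The inductions below pass to
  subgroups and quotients again and again, and forming the quotients would change the type of the
  elements each time.\<close>

definition normal_in :: "'a set \<Rightarrow> 'a set \<Rightarrow> bool" where
  "normal_in K H \<longleftrightarrow> subgroup K G \<and> subgroup H G \<and> K \<subseteq> H \<and>
     (\<forall>h\<in>H. \<forall>k\<in>K. h \<otimes> k \<otimes> inv h \<in> K)"

definition fin_index :: "'a set \<Rightarrow> 'a set \<Rightarrow> bool" where
  "fin_index K H \<longleftrightarrow> (\<exists>F. finite F \<and> F \<subseteq> H \<and> (\<forall>h\<in>H. \<exists>f\<in>F. \<exists>k\<in>K. h = f \<otimes> k))"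

lemma normal_inD:
  assumes "normal_in K H"
  shows "subgroup K G" "subgroup H G" "K \<subseteq> H"
    "\<And>h k. h \<in> H \<Longrightarrow> k \<in> K \<Longrightarrow> h \<otimes> k \<otimes> inv h \<in> K"
    "\<And>h k. h \<in> H \<Longrightarrow> k \<in> K \<Longrightarrow> inv h \<otimes> k \<otimes> h \<in> K"
proof -
  show 1: "subgroup K G" "subgroup H G" "K \<subseteq> H"
    and 2: "\<And>h k. h \<in> H \<Longrightarrow> k \<in> K \<Longrightarrow> h \<otimes> k \<otimes> inv h \<in> K"
    using assms unfolding normal_in_def by auto
  fix h k assume "h \<in> H" "k \<in> K"
  then show "inv h \<otimes> k \<otimes> h \<in> K"
    using 2[of "inv h" k] subgroup.m_inv_closed[OF 1(2)] subgroup.mem_carrier[OF 1(2)] by auto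
qed

lemma normal_in_restrict:
  assumes "normal_in K H" "subgroup M G" "K \<subseteq> M" "M \<subseteq> H"
  shows "normal_in K M"
  using assms unfolding normal_in_def by auto

lemma normal_in_inter:
  assumes "normal_in K H" "subgroup A G" "A \<subseteq> H"
  shows "normal_in (A \<inter> K) A"
  using assms unfolding normal_in_def
  by (auto simp: subgroups_Inter_pair subgroup.m_closed subgroup.m_inv_closed)

lemma set_mult_iff: "x \<in> A <#> B \<longleftrightarrow> (\<exists>a\<in>A. \<exists>b\<in>B. x = a \<otimes> b)"
  unfolding set_mult_def by auto

lemma fin_index_mono:
  assumes "fin_index K H" "K \<subseteq> K'"
  shows "fin_index K' H"
  using assms unfolding fin_index_def by (meson subsetD)

lemma fin_index_refl:
  assumes "subgroup H G" shows "fin_index H H"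
  unfolding fin_index_def
proof (intro exI[of _ "{\<one>}"] conjI ballI)
  show "{\<one>} \<subseteq> H" using subgroup.one_closed[OF assms] by simp
  fix h assume "h \<in> H"
  then show "\<exists>f\<in>{\<one>}. \<exists>k\<in>H. h = f \<otimes> k"
    using subgroup.mem_carrier[OF assms] by auto
qed auto

lemma fin_index_trans:
  assumes "fin_index K L" "fin_index L H" "subgroup H G" "L \<subseteq> H" "K \<subseteq> L"
  shows "fin_index K H"
proof -
  obtain E where E: "finite E" "E \<subseteq> L" "\<forall>h\<in>L. \<exists>f\<in>E. \<exists>k\<in>K. h = f \<otimes> k"
    using assms(1) unfolding fin_index_def by blast
  obtain F where F: "finite F" "F \<subseteq> H" "\<forall>h\<in>H. \<exists>f\<in>F. \<exists>k\<in>L. h = f \<otimes> k"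
    using assms(2) unfolding fin_index_def by blast
  have "\<exists>g\<in>F <#> E. \<exists>k\<in>K. h = g \<otimes> k" if hH: "h \<in> H" for h
  proof -
    obtain f l where fl: "f \<in> F" "l \<in> L" "h = f \<otimes> l" using bspec[OF F(3) hH] by blast
    obtain e k where ek: "e \<in> E" "k \<in> K" "l = e \<otimes> k" using E(3) fl(2) by blast
    have "f \<in> H" "e \<in> H" "k \<in> H" using fl(1) ek(1,2) assms(4,5) E(2) F(2) by blast+
    then have "f \<in> carrier G" "e \<in> carrier G" "k \<in> carrier G"
      using subgroup.mem_carrier[OF assms(3)] by blast+
    then have "h = (f \<otimes> e) \<otimes> k" using fl ek by (simp add: m_assoc)
    moreover have "f \<otimes> e \<in> F <#> E" using fl(1) ek(1) unfolding set_mult_iff by blast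
    ultimately show ?thesis using ek(2) by blast
  qed
  moreover have "finite (F <#> E)" using E F unfolding set_mult_def by auto
  moreover have "F <#> E \<subseteq> H"
    using E(2) F(2) assms(4) subgroup.m_closed[OF assms(3)] unfolding set_mult_def by blast
  ultimately show ?thesis unfolding fin_index_def by meson
qed

lemma pow_mem:
  assumes "subgroup H G" "x \<in> H"
  shows "x [^] (k::int) \<in> H" "x [^] (m::nat) \<in> H"
proof -
  show m: "x [^] (m::nat) \<in> H" for m
    by (induction m) (use assms subgroup.one_closed subgroup.m_closed in auto)
  show "x [^] (k::int) \<in> H"
    unfolding int_pow_def2 using m[of "nat k"] subgroup.m_inv_closed[OF assms(1) m[of "nat (- k)"]]
    by (simp only: split: if_split) blast
qed

text \<open>Two of the powers with exponents \<open>0, \<dots>, j\<close> of an element share one of the \<open>j\<close> cosets, so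
  some power with a positive exponent at most \<open>j\<close> lies in the subgroup; the factorial of \<open>j\<close> serves
  all elements at once.\<close>

lemma fin_index_imp_exponent:
  assumes "fin_index M H" "subgroup M G" "subgroup H G" "M \<subseteq> H"
  obtains m :: nat where "m > 0" "\<And>x. x \<in> H \<Longrightarrow> x [^] m \<in> M"
proof -
  obtain F where F: "finite F" "F \<subseteq> H" "\<forall>h\<in>H. \<exists>f\<in>F. \<exists>k\<in>M. h = f \<otimes> k"
    using assms(1) unfolding fin_index_def by blast
  have "x [^] (fact (card F) :: nat) \<in> M" if x: "x \<in> H" for x
  proof -
    have xc: "x \<in> carrier G" using x subgroup.mem_carrier[OF assms(3)] by auto
    have "\<forall>i::nat. \<exists>f. f \<in> F \<and> (\<exists>k\<in>M. x [^] i = f \<otimes> k)"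
      using F(3) pow_mem(2)[OF assms(3) x] by blast
    then obtain c where c: "\<And>i::nat. c i \<in> F" "\<And>i. \<exists>k\<in>M. x [^] i = c i \<otimes> k" by metis
    have "\<not> inj_on c {0..card F}"
    proof
      assume "inj_on c {0..card F}"
      then have "card {0..card F} \<le> card F"
        using c(1) F(1) by (intro card_inj_on_le) auto
      then show False by simp
    qed
    then obtain i j where ij: "i < j" "j \<le> card F" "c i = c j"
      unfolding inj_on_def by (metis atLeastAtMost_iff linorder_neqE_nat)
    obtain k where k: "k \<in> M" "x [^] i = c i \<otimes> k" using c(2) by blast
    obtain l where l: "l \<in> M" "x [^] j = c i \<otimes> l" using c(2) ij(3) by metis
    have cc: "c i \<in> carrier G" "k \<in> carrier G" "l \<in> carrier G"
      using c(1) F(2) k l subgroup.mem_carrier[OF assms(3)] subgroup.mem_carrier[OF assms(2)] by auto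
    have "x [^] i \<otimes> x [^] (j - i) = x [^] j" using ij(1) xc by (simp add: nat_pow_mult)
    then have "(c i \<otimes> k) \<otimes> x [^] (j - i) = c i \<otimes> l" using k l by simp
    then have "x [^] (j - i) = inv k \<otimes> l"
      using cc xc by (metis cancel_inv_left(2) inv_mult_group m_assoc m_closed nat_pow_closed inv_closed)
    then have d: "x [^] (j - i) \<in> M"
      using k l by (simp add: assms(2) subgroup.m_closed subgroup.m_inv_closed)
    have "j - i dvd fact (card F)" using ij by (intro dvd_fact) auto
    then obtain q where "fact (card F) = (j - i) * q" by (metis dvdE)
    then have "x [^] (fact (card F) :: nat) = (x [^] (j - i)) [^] q"
      using xc by (simp add: nat_pow_pow)
    then show ?thesis using pow_mem(2)[OF assms(2) d] by simp
  qed
  then show ?thesis using that[of "fact (card F)"] by simp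
qed

lemma set_mult_normal:
  assumes N: "normal_in N H" and A: "subgroup A G" "A \<subseteq> H"
  shows "subgroup (A <#> N) G" "A \<subseteq> A <#> N" "N \<subseteq> A <#> N" "A <#> N \<subseteq> H"
proof -
  note n = normal_inD[OF N]
  have Ac: "\<And>x. x \<in> A \<Longrightarrow> x \<in> carrier G" and Nc: "\<And>x. x \<in> N \<Longrightarrow> x \<in> carrier G"
    using subgroup.mem_carrier[OF A(1)] subgroup.mem_carrier[OF n(1)] by blast+
  show sub: "A \<subseteq> A <#> N" using Ac subgroup.one_closed[OF n(1)] unfolding set_mult_iff subset_iff
    by (metis r_one)
  show "N \<subseteq> A <#> N" using Nc subgroup.one_closed[OF A(1)] unfolding set_mult_iff subset_iff
    by (metis l_one)
  show "A <#> N \<subseteq> H" using A(2) n(3) subgroup.m_closed[OF n(2)] unfolding set_mult_def by blast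
  show "subgroup (A <#> N) G"
  proof (rule subgroupI)
    show "A <#> N \<subseteq> carrier G" using Ac Nc unfolding set_mult_def by auto
    show "A <#> N \<noteq> {}" using sub subgroup.one_closed[OF A(1)] by auto
  next
    fix x assume "x \<in> A <#> N"
    then obtain a m where x: "a \<in> A" "m \<in> N" "x = a \<otimes> m" unfolding set_mult_iff by blast
    have "inv x = inv a \<otimes> (a \<otimes> inv m \<otimes> inv a)"
      using x Ac Nc by (simp add: word_simps)
    moreover have "a \<otimes> inv m \<otimes> inv a \<in> N"
      using x A(2) n(4) subgroup.m_inv_closed[OF n(1)] by blast
    moreover have "inv a \<in> A" using x subgroup.m_inv_closed[OF A(1)] by auto
    ultimately show "inv x \<in> A <#> N" unfolding set_mult_iff by blast
  next
    fix x y assume "x \<in> A <#> N" "y \<in> A <#> N"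
    then obtain a m b l where x: "a \<in> A" "m \<in> N" "x = a \<otimes> m" "b \<in> A" "l \<in> N" "y = b \<otimes> l"
      unfolding set_mult_iff by blast
    have "x \<otimes> y = (a \<otimes> b) \<otimes> ((inv b \<otimes> m \<otimes> b) \<otimes> l)"
      using x Ac Nc by (simp add: word_simps)
    moreover have "(inv b \<otimes> m \<otimes> b) \<otimes> l \<in> N"
      using x A(2) n(5) subgroup.m_closed[OF n(1)] by blast
    moreover have "a \<otimes> b \<in> A" using x subgroup.m_closed[OF A(1)] by auto
    ultimately show "x \<otimes> y \<in> A <#> N" unfolding set_mult_iff by blast
  qed
qed

lemma normal_in_set_mult:
  assumes "normal_in N H" "normal_in A H"
  shows "normal_in (A <#> N) H"
  unfolding normal_in_def
proof (intro conjI ballI)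
  note n = normal_inD[OF assms(1)] and a = normal_inD[OF assms(2)]
  show "subgroup (A <#> N) G" "A <#> N \<subseteq> H"
    using set_mult_normal[OF assms(1) a(1,3)] by auto
  show "subgroup H G" using n by simp
  fix h k assume h: "h \<in> H" and "k \<in> A <#> N"
  then obtain x y where k: "x \<in> A" "y \<in> N" "k = x \<otimes> y" unfolding set_mult_iff by blast
  have "h \<otimes> k \<otimes> inv h = (h \<otimes> x \<otimes> inv h) \<otimes> (h \<otimes> y \<otimes> inv h)"
    using h k subgroup.mem_carrier[OF n(2)] subgroup.mem_carrier[OF n(1)] subgroup.mem_carrier[OF a(1)]
    by (simp add: word_simps)
  then show "h \<otimes> k \<otimes> inv h \<in> A <#> N"
    using h k n(4) a(4) unfolding set_mult_iff by blast
qed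

text \<open>The subgroup generated by \<open>K\<close> and the \<open>m\<close>-th powers of \<open>A\<close>.  Being defined by words in
  elements, it is invariant under every endomorphism that preserves \<open>K\<close> and \<open>A\<close>; all invariant
  subgroups of finite index below arise in this way.\<close>

definition power_subgroup :: "'a set \<Rightarrow> 'a set \<Rightarrow> nat \<Rightarrow> 'a set" where
  "power_subgroup K A m = generate G (K \<union> {x [^] m | x. x \<in> A})"

lemma power_subgroup_props:
  assumes K: "subgroup K G" and A: "subgroup A G"
  shows "subgroup (power_subgroup K A m) G" "K \<subseteq> power_subgroup K A m"
    "\<And>x. x \<in> A \<Longrightarrow> x [^] m \<in> power_subgroup K A m"
    "\<And>M. subgroup M G \<Longrightarrow> K \<subseteq> M \<Longrightarrow> (\<And>x. x \<in> A \<Longrightarrow> x [^] m \<in> M) \<Longrightarrow> power_subgroup K A m \<subseteq> M"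
proof -
  have "K \<union> {x [^] m | x. x \<in> A} \<subseteq> carrier G"
    using subgroup.subset[OF K] subgroup.mem_carrier[OF A] by auto
  then show "subgroup (power_subgroup K A m) G"
    unfolding power_subgroup_def by (rule generate_is_subgroup)
  show "K \<subseteq> power_subgroup K A m" "\<And>x. x \<in> A \<Longrightarrow> x [^] m \<in> power_subgroup K A m"
    unfolding power_subgroup_def by (auto intro: generate.incl)
  show "\<And>M. subgroup M G \<Longrightarrow> K \<subseteq> M \<Longrightarrow> (\<And>x. x \<in> A \<Longrightarrow> x [^] m \<in> M) \<Longrightarrow> power_subgroup K A m \<subseteq> M"
    unfolding power_subgroup_def by (rule generate_subgroup_incl) auto
qed

lemma subgroup_vimage_hom:
  assumes f: "f \<in> hom (G\<lparr>carrier := H\<rparr>) G" and H: "subgroup H G" and M: "subgroup M G"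
  shows "subgroup {x\<in>H. f x \<in> M} G"
proof -
  interpret gh: group_hom "G\<lparr>carrier := H\<rparr>" G f
    using f subgroup.subgroup_is_group[OF H is_group] by (simp add: group_hom_def group_hom_axioms_def)
  note hc = subgroup.mem_carrier[OF H]
  show ?thesis
  proof (rule subgroupI)
    show "{x \<in> H. f x \<in> M} \<subseteq> carrier G" using hc by auto
    have "\<one> \<in> {x \<in> H. f x \<in> M}"
      using gh.hom_one subgroup.one_closed[OF H] subgroup.one_closed[OF M] by simp
    then show "{x \<in> H. f x \<in> M} \<noteq> {}" by blast
  next
    fix x assume "x \<in> {x \<in> H. f x \<in> M}"
    then show "inv x \<in> {x \<in> H. f x \<in> M}"
      using gh.hom_inv[of x] subgroup.m_inv_closed[OF H] subgroup.m_inv_closed[OF M]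
      by (simp add: m_inv_consistent[OF H])
  next
    fix x y assume "x \<in> {x \<in> H. f x \<in> M}" "y \<in> {x \<in> H. f x \<in> M}"
    then show "x \<otimes> y \<in> {x \<in> H. f x \<in> M}"
      using gh.hom_mult[of x y] subgroup.m_closed[OF H] subgroup.m_closed[OF M] by simp
  qed
qed

text \<open>Stated for arbitrary endomorphisms of \<open>G\<close>, in order to apply to conjugations as well as to \<open>\<phi>\<close>.\<close>

lemma power_subgroup_hom:
  assumes f: "f \<in> hom G G" and K: "subgroup K G" and A: "subgroup A G"
    and fK: "f ` K \<subseteq> K" and fA: "f ` A \<subseteq> A"
  shows "f ` power_subgroup K A m \<subseteq> power_subgroup K A m"
proof -
  note p = power_subgroup_props[OF K A, where m=m]
  interpret gh: group_hom G G f using f by (simp add: group_hom_def group_hom_axioms_def is_group)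
  have "subgroup {x \<in> carrier G. f x \<in> power_subgroup K A m} G"
    using subgroup_vimage_hom[of f "carrier G"] f subgroup_self p(1) by simp
  then have "power_subgroup K A m \<subseteq> {x \<in> carrier G. f x \<in> power_subgroup K A m}"
  proof (rule p(4))
    show "K \<subseteq> {x \<in> carrier G. f x \<in> power_subgroup K A m}"
      using p(2) fK subgroup.mem_carrier[OF K] by auto
    fix x assume x: "x \<in> A"
    then have "f (x [^] m) = f x [^] m" using subgroup.mem_carrier[OF A] gh.hom_nat_pow by auto
    then show "x [^] m \<in> {x \<in> carrier G. f x \<in> power_subgroup K A m}"
      using p(3)[of "f x"] fA x subgroup.mem_carrier[OF A] by auto
  qed
  then show ?thesis by auto
qed

lemma conjugation_hom: "h \<in> carrier G \<Longrightarrow> (\<lambda>x. h \<otimes> x \<otimes> inv h) \<in> hom G G"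
  unfolding hom_def by (auto simp: word_simps)

lemma power_subgroup_normal:
  assumes "normal_in K H" "normal_in A H"
  shows "normal_in (power_subgroup K A m) H"
proof -
  note k = normal_inD[OF assms(1)] and a = normal_inD[OF assms(2)]
  note p = power_subgroup_props[OF k(1) a(1), where m=m]
  have "h \<otimes> x \<otimes> inv h \<in> power_subgroup K A m" if "h \<in> H" "x \<in> power_subgroup K A m" for h x
    using power_subgroup_hom[OF conjugation_hom, of h K A m] that k a subgroup.mem_carrier[OF k(2)]
    by blast
  moreover have "power_subgroup K A m \<subseteq> H"
    using p(4)[OF k(2) k(3)] pow_mem(2)[OF k(2)] a(3) by blast
  ultimately show ?thesis using p(1) k(2) unfolding normal_in_def by blast
qed

text \<open>Each coset of \<open>M\<close> that meets \<open>A\<close> contributes one representative chosen in \<open>A\<close>.\<close>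

lemma fin_index_inter:
  assumes "fin_index M H" "subgroup M G" "subgroup H G"
    and "subgroup A G" "A \<subseteq> H"
  shows "fin_index (A \<inter> M) A"
proof -
  obtain F where F: "finite F" "F \<subseteq> H" "\<forall>h\<in>H. \<exists>f\<in>F. \<exists>k\<in>M. h = f \<otimes> k"
    using assms(1) unfolding fin_index_def by blast
  define r where "r f = (SOME a. a \<in> A \<and> (\<exists>k\<in>M. a = f \<otimes> k))" for f
  let ?F = "{r f | f. f \<in> F \<and> (\<exists>a\<in>A. \<exists>k\<in>M. a = f \<otimes> k)}"
  have r: "r f \<in> A \<and> (\<exists>k\<in>M. r f = f \<otimes> k)" if "\<exists>a\<in>A. \<exists>k\<in>M. a = f \<otimes> k" for f
    unfolding r_def by (rule someI_ex) (use that in blast)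
  have "\<exists>f\<in>?F. \<exists>k\<in>A \<inter> M. a = f \<otimes> k" if a: "a \<in> A" for a
  proof -
    obtain f k where fk: "f \<in> F" "k \<in> M" "a = f \<otimes> k" using F(3) a assms(5) by blast
    then obtain l where l: "l \<in> M" "r f = f \<otimes> l" and rA: "r f \<in> A" using r a by blast
    have c: "f \<in> carrier G" "k \<in> carrier G" "l \<in> carrier G"
      using fk l F(2) subgroup.mem_carrier[OF assms(3)] subgroup.mem_carrier[OF assms(2)] by auto
    then have e: "inv (r f) \<otimes> a = inv l \<otimes> k" using fk l by (simp add: word_simps)
    have "inv (r f) \<otimes> a \<in> A" using rA a assms(4) by (simp add: subgroup.m_closed subgroup.m_inv_closed)
    moreover have "inv (r f) \<otimes> a \<in> M"
      unfolding e using fk l assms(2) by (simp add: subgroup.m_closed subgroup.m_inv_closed)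
    moreover have "a = r f \<otimes> (inv (r f) \<otimes> a)"
      using rA a subgroup.mem_carrier[OF assms(4)] by simp
    ultimately show ?thesis using fk a by blast
  qed
  moreover have "finite ?F" using F(1) by simp
  moreover have "?F \<subseteq> A" using r by auto
  ultimately show ?thesis unfolding fin_index_def by meson
qed

end

section \<open>Polycyclic series\<close>

text \<open>A series with cyclic factors.  Cyclicity is expressed by a generator in the group itself instead
  of a generator of the factor group.\<close>

locale polycyclic_series = group +
  fixes C :: "nat \<Rightarrow> 'a set" and n :: nat
  assumes C_bot: "C 0 = {\<one>}" and C_top: "C n = carrier G"
    and C_normal: "i < n \<Longrightarrow> normal_in (C i) (C (Suc i))"
    and C_cyclic: "i < n \<Longrightarrow> \<exists>t\<in>C (Suc i). \<forall>x\<in>C (Suc i). \<exists>k::int. \<exists>c\<in>C i. x = t [^] k \<otimes> c"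
begin

lemma C_subgroup: "i \<le> n \<Longrightarrow> subgroup (C i) G"
proof (cases "i = n")
  case True
  then show ?thesis using C_top subgroup_self by simp
next
  case False
  moreover assume "i \<le> n"
  ultimately show ?thesis using normal_inD(1)[OF C_normal[of i]] by simp
qed

lemma (in group) coset_powers:
  assumes "normal_in N H" "t \<in> H" "x \<in> carrier G" "c \<in> N" "x = t [^] (a::int) \<otimes> c"
  shows "\<exists>c\<in>N. x [^] (j::int) = t [^] (a * j) \<otimes> c"
proof -
  note n = normal_inD[OF assms(1)]
  have tc: "t \<in> carrier G" using assms(2) subgroup.mem_carrier[OF n(2)] by auto
  have Nc: "\<And>y. y \<in> N \<Longrightarrow> y \<in> carrier G" using subgroup.mem_carrier[OF n(1)] by auto
  have pos: "\<exists>c\<in>N. x [^] (j::nat) = t [^] (a * int j) \<otimes> c" for j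
  proof (induction j)
    case 0
    have "x [^] (0::nat) = t [^] (a * int 0) \<otimes> \<one>" by simp
    then show ?case using subgroup.one_closed[OF n(1)] by blast
  next
    case (Suc j)
    then obtain d where d: "d \<in> N" "x [^] j = t [^] (a * int j) \<otimes> d" by blast
    let ?s = "t [^] a"
    have s: "?s \<in> H" "?s \<in> carrier G" using pow_mem(1)[OF n(2) assms(2)] tc by auto
    have "x [^] Suc j = (t [^] (a * int j) \<otimes> d) \<otimes> (?s \<otimes> c)" using d assms(3,5) by simp
    also have "\<dots> = (t [^] (a * int j) \<otimes> ?s) \<otimes> ((inv ?s \<otimes> d \<otimes> ?s) \<otimes> c)"
      using d(1) assms(4) Nc tc s(2) by (simp add: word_simps)
    also have "t [^] (a * int j) \<otimes> ?s = t [^] (a * int (Suc j))"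
      using tc by (simp add: int_pow_mult[symmetric] distrib_left add.commute)
    finally have e: "x [^] Suc j = t [^] (a * int (Suc j)) \<otimes> ((inv ?s \<otimes> d \<otimes> ?s) \<otimes> c)" .
    have "(inv ?s \<otimes> d \<otimes> ?s) \<otimes> c \<in> N"
      using n(5)[OF s(1) d(1)] assms(4) subgroup.m_closed[OF n(1)] by blast
    then show ?case using e by blast
  qed
  show ?thesis
  proof (cases "j \<ge> 0")
    case True
    then have "int (nat j) = j" by simp
    then show ?thesis using pos[of "nat j"] by (metis int_pow_int)
  next
    case False
    obtain d where d: "d \<in> N" "x [^] nat (- j) = t [^] (a * int (nat (- j))) \<otimes> d" using pos by blast
    let ?s = "t [^] (a * - j)"
    have s: "?s \<in> H" "?s \<in> carrier G" using pow_mem(1)[OF n(2) assms(2)] tc by auto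
    have nj: "int (nat (- j)) = - j" using False by simp
    have "x [^] j = inv (x [^] nat (- j))" unfolding int_pow_def2 using False by simp
    also have "\<dots> = inv (?s \<otimes> d)" unfolding d(2) nj ..
    also have "\<dots> = inv ?s \<otimes> (?s \<otimes> inv d \<otimes> inv ?s)"
      using d(1) Nc s by (simp add: word_simps)
    also have "inv ?s = t [^] (a * j)" using tc by (simp add: int_pow_neg[symmetric])
    finally have "x [^] j = t [^] (a * j) \<otimes> (?s \<otimes> inv d \<otimes> t [^] (a * j))"
      using tc int_pow_neg[of t "a * - j"] by simp
    moreover have "?s \<otimes> inv d \<otimes> inv ?s \<in> N"
      using n(4)[OF s(1)] d(1) subgroup.m_inv_closed[OF n(1)] by blast
    ultimately show ?thesis using tc int_pow_neg[of t "a * - j"] by auto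
  qed
qed

text \<open>A subgroup meets each step of the series again in a cyclic extension.  A generator is an
  element of the subgroup whose exponent with respect to the generator of the whole step is
  positive and minimal: division with remainder shows that it divides all other exponents.\<close>

lemma subgroup_cyclic_step:
  assumes H: "subgroup H G" and i: "i < n"
  shows "\<exists>t\<in>H \<inter> C (Suc i). \<forall>x\<in>H \<inter> C (Suc i). \<exists>k::int. \<exists>c\<in>H \<inter> C i. x = t [^] k \<otimes> c"
proof -
  note N = C_normal[OF i] note nn = normal_inD[OF N]
  obtain t where t: "t \<in> C (Suc i)" "\<forall>x\<in>C (Suc i). \<exists>k::int. \<exists>c\<in>C i. x = t [^] k \<otimes> c"
    using C_cyclic[OF i] by blast
  have tc: "t \<in> carrier G" using t subgroup.mem_carrier[OF nn(2)] by auto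
  define P where "P p \<longleftrightarrow> p > 0 \<and> (\<exists>x\<in>H. \<exists>c\<in>C i. x = t [^] int p \<otimes> c)" for p :: nat
  show ?thesis
  proof (cases "\<exists>p. P p")
    case False
    have "\<exists>k::int. \<exists>c\<in>H \<inter> C i. x = \<one> [^] k \<otimes> c" if x: "x \<in> H \<inter> C (Suc i)" for x
    proof -
      obtain k :: int and c where k: "c \<in> C i" "x = t [^] k \<otimes> c" using t x by blast
      have xc: "x \<in> carrier G" using x subgroup.mem_carrier[OF H] by auto
      have "k = 0"
      proof (rule ccontr)
        assume "k \<noteq> 0"
        then have "nat (\<bar>k\<bar>) > 0" by simp
        moreover have "k * sgn k = int (nat \<bar>k\<bar>)" by (simp add: abs_sgn[symmetric])
        then have "\<exists>x\<in>H. \<exists>c\<in>C i. x = t [^] int (nat \<bar>k\<bar>) \<otimes> c"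
          using coset_powers[OF N t(1) xc k, of "sgn k"] pow_mem(1)[OF H, of x "sgn k"] x
          by (metis IntD1)
        ultimately show False using False unfolding P_def by blast
      qed
      then have "x = c" using k xc subgroup.mem_carrier[OF nn(1)] by simp
      then have "x = \<one> [^] (0::int) \<otimes> x" "x \<in> H \<inter> C i" using k x xc by auto
      then show ?thesis by blast
    qed
    then show ?thesis using subgroup.one_closed[OF H] subgroup.one_closed[OF nn(2)] by blast
  next
    case True
    define p where "p = (LEAST p. P p)"
    have Pp: "P p" unfolding p_def using True by (metis LeastI)
    then obtain s c where s: "s \<in> H" "c \<in> C i" "s = t [^] int p \<otimes> c" and p0: "p > 0"
      unfolding P_def by blast
    have sc: "s \<in> carrier G" using s subgroup.mem_carrier[OF H] by auto
    have "t [^] int p \<in> C (Suc i)" using pow_mem(1)[OF nn(2) t(1)] by blast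
    then have sC: "s \<in> C (Suc i)" using s nn(3) subgroup.m_closed[OF nn(2)] by auto
    have "\<exists>k::int. \<exists>c\<in>H \<inter> C i. x = s [^] k \<otimes> c" if x: "x \<in> H \<inter> C (Suc i)" for x
    proof -
      have xc: "x \<in> carrier G" using x subgroup.mem_carrier[OF H] by auto
      obtain k :: int and d where k: "d \<in> C i" "x = t [^] k \<otimes> d" using t x by blast
      let ?q = "k div int p"
      obtain e where e: "e \<in> C i" "s [^] (- ?q) = t [^] (int p * (- ?q)) \<otimes> e"
        using coset_powers[OF N t(1) sc s(2,3)] by blast
      define y where "y = x \<otimes> s [^] (- ?q)"
      have dc: "d \<in> carrier G" "e \<in> carrier G" using k e subgroup.mem_carrier[OF nn(1)] by auto
      let ?u = "t [^] (int p * (- ?q))"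
      have u: "?u \<in> C (Suc i)" "?u \<in> carrier G" using pow_mem(1)[OF nn(2) t(1)] tc by auto
      have "y = (t [^] k \<otimes> ?u) \<otimes> ((inv ?u \<otimes> d \<otimes> ?u) \<otimes> e)"
        unfolding y_def k(2) e(2) using dc u tc by (simp add: word_simps)
      also have "t [^] k \<otimes> ?u = t [^] (k mod int p)"
        using tc by (simp add: int_pow_mult[symmetric] minus_mult_div_eq_mod)
      finally have y: "y = t [^] (k mod int p) \<otimes> ((inv ?u \<otimes> d \<otimes> ?u) \<otimes> e)" .
      have dd: "(inv ?u \<otimes> d \<otimes> ?u) \<otimes> e \<in> C i"
        using nn(5)[OF u(1) k(1)] e(1) subgroup.m_closed[OF nn(1)] by blast
      have yH: "y \<in> H" unfolding y_def
        using x pow_mem(1)[OF H s(1)] subgroup.m_closed[OF H] by blast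
      have "k mod int p = 0"
      proof (rule ccontr)
        assume ne: "k mod int p \<noteq> 0"
        have "0 \<le> k mod int p" "k mod int p < int p" using p0 by auto
        then have r: "nat (k mod int p) < p" "int (nat (k mod int p)) = k mod int p"
          "nat (k mod int p) > 0" using ne by linarith+
        then have "P (nat (k mod int p))" unfolding P_def using y dd yH by auto
        then show False using r(1) not_less_Least unfolding p_def by blast
      qed
      then have "y \<in> C i" using y dd subgroup.mem_carrier[OF nn(1)] by simp
      then have yy: "y \<in> H \<inter> C i" using yH by blast
      let ?v = "s [^] ?q"
      have v: "?v \<in> H" "?v \<in> C (Suc i)" "?v \<in> carrier G"
        using pow_mem(1)[OF H s(1)] pow_mem(1)[OF nn(2) sC] sc by auto
      have yc: "y \<in> carrier G" using yH subgroup.mem_carrier[OF H] by auto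
      have "x = y \<otimes> ?v" unfolding y_def using xc sc by (simp add: m_assoc int_pow_neg)
      also have "\<dots> = ?v \<otimes> (inv ?v \<otimes> y \<otimes> ?v)" using yc v by (simp add: word_simps)
      finally have "x = ?v \<otimes> (inv ?v \<otimes> y \<otimes> ?v)" .
      moreover have "inv ?v \<otimes> y \<otimes> ?v \<in> H"
        using yH v(1) subgroup.m_closed[OF H] subgroup.m_inv_closed[OF H] by blast
      moreover have "inv ?v \<otimes> y \<otimes> ?v \<in> C i" using nn(5)[OF v(2)] yy by blast
      ultimately show ?thesis by blast
    qed
    then show ?thesis using s(1) sC by blast
  qed
qed

text \<open>Climbing up the series, each step multiplies the number of coset representatives by at most
  \<open>m\<close>, as the \<open>m\<close>-th power of the generator of the step lies in \<open>V\<close>.\<close>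

lemma finite_exponent_imp_fin_index:
  assumes V: "normal_in V H" and m: "m > 0" "\<And>x. x \<in> H \<Longrightarrow> x [^] (m::nat) \<in> V"
  shows "fin_index V H"
proof -
  note v = normal_inD[OF V]
  have Hc: "\<And>x. x \<in> H \<Longrightarrow> x \<in> carrier G" using subgroup.mem_carrier[OF v(2)] by auto
  have "i \<le> n \<Longrightarrow> \<exists>F. finite F \<and> F \<subseteq> H \<and> (\<forall>h\<in>H \<inter> C i. \<exists>f\<in>F. \<exists>k\<in>V. h = f \<otimes> k)" for i
  proof (induction i)
    case 0
    have "\<forall>h\<in>H \<inter> C 0. \<exists>f\<in>{\<one>}. \<exists>k\<in>V. h = f \<otimes> k"
      using subgroup.one_closed[OF v(1)] C_bot by (auto intro!: bexI[of _ \<one>])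
    then show ?case using subgroup.one_closed[OF v(2)] by (intro exI[of _ "{\<one>}"]) auto
  next
    case (Suc i)
    then obtain F where F: "finite F" "F \<subseteq> H" "\<forall>h\<in>H \<inter> C i. \<exists>f\<in>F. \<exists>k\<in>V. h = f \<otimes> k" by auto
    obtain t where t: "t \<in> H \<inter> C (Suc i)"
      "\<forall>x\<in>H \<inter> C (Suc i). \<exists>k::int. \<exists>c\<in>H \<inter> C i. x = t [^] k \<otimes> c"
      using subgroup_cyclic_step[OF v(2), of i] Suc.prems by (meson Suc_le_lessD)
    have tc: "t \<in> carrier G" using t Hc by auto
    let ?F = "(\<lambda>(r, f). t [^] r \<otimes> f) ` ({0..<int m} \<times> F)"
    have "\<exists>f\<in>?F. \<exists>k\<in>V. h = f \<otimes> k" if h: "h \<in> H \<inter> C (Suc i)" for h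
    proof -
      obtain k :: int and c where k: "c \<in> H \<inter> C i" "h = t [^] k \<otimes> c" using t h by blast
      obtain f w where f: "f \<in> F" "w \<in> V" "c = f \<otimes> w" using F k by blast
      let ?q = "k div int m" and ?r = "k mod int m"
      let ?u = "(t [^] m) [^] ?q"
      have u: "?u \<in> V" using pow_mem(1)[OF v(1)] m t by blast
      have tu: "t [^] (int m * ?q) = ?u" using int_pow_pow[OF tc, of "int m" ?q] by (simp add: int_pow_int)
      have "t [^] k = t [^] ?r \<otimes> t [^] (int m * ?q)"
        using int_pow_mult[OF tc, of ?r "int m * ?q"] by simp
      then have tk: "t [^] k = t [^] ?r \<otimes> ?u" unfolding tu .
      have fH: "f \<in> H" using f F by auto
      have cc: "f \<in> carrier G" "w \<in> carrier G" "?u \<in> carrier G"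
        using fH f v(3) Hc u by blast+
      have "h = (t [^] ?r \<otimes> f) \<otimes> ((inv f \<otimes> ?u \<otimes> f) \<otimes> w)"
        unfolding k(2) tk f(3) using cc tc by (simp add: word_simps)
      moreover have "(inv f \<otimes> ?u \<otimes> f) \<otimes> w \<in> V"
        using v(5)[OF fH u] f(2) subgroup.m_closed[OF v(1)] by blast
      moreover have "t [^] ?r \<otimes> f \<in> ?F" using f(1) m(1) by force
      ultimately show ?thesis by blast
    qed
    moreover have "finite ?F" using F(1) by simp
    moreover have "?F \<subseteq> H" using F(2) t subgroup.m_closed[OF v(2)] pow_mem(1)[OF v(2)] by auto
    ultimately show ?case by meson
  qed
  then show ?thesis unfolding fin_index_def using C_top Hc by (metis Int_absorb2 le_refl subsetI)
qed

text \<open>Ascending chains of subgroups become stationary, because on each step of the series the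
  union of the chain is exhausted as soon as the chain contains its cyclic generator.\<close>

lemma ascending_chain_stationary:
  fixes S :: "nat \<Rightarrow> 'a set"
  assumes S: "\<And>j. subgroup (S j) G" and inc: "\<And>j. S j \<subseteq> S (Suc j)"
  obtains j where "S (Suc j) = S j"
proof -
  have mono: "i \<le> j \<Longrightarrow> S i \<subseteq> S j" for i j using inc by (rule lift_Suc_mono_le)
  define U where "U = (\<Union>j. S j)"
  have U: "subgroup U G"
  proof (rule subgroupI)
    show "U \<subseteq> carrier G" unfolding U_def using subgroup.subset[OF S] by blast
    show "U \<noteq> {}" unfolding U_def using subgroup.one_closed[OF S] by blast
    show "inv a \<in> U" if "a \<in> U" for a
      using that subgroup.m_inv_closed[OF S] unfolding U_def by blast
    show "a \<otimes> b \<in> U" if ab: "a \<in> U" "b \<in> U" for a b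
    proof -
      obtain i j where "a \<in> S i" "b \<in> S j" using ab unfolding U_def by blast
      then have "a \<in> S (max i j)" "b \<in> S (max i j)" using mono[of i "max i j"] mono[of j "max i j"] by auto
      then show ?thesis using subgroup.m_closed[OF S] unfolding U_def by blast
    qed
  qed
  have "i \<le> n \<Longrightarrow> \<exists>j. U \<inter> C i \<subseteq> S j" for i
  proof (induction i)
    case 0
    then show ?case using C_bot subgroup.one_closed[OF S] by auto
  next
    case (Suc i)
    then obtain j where j: "U \<inter> C i \<subseteq> S j" by auto
    obtain t where t: "t \<in> U \<inter> C (Suc i)"
      "\<forall>x\<in>U \<inter> C (Suc i). \<exists>k::int. \<exists>c\<in>U \<inter> C i. x = t [^] k \<otimes> c"
      using subgroup_cyclic_step[OF U, of i] Suc.prems by (meson Suc_le_lessD)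
    then obtain l where l: "t \<in> S l" unfolding U_def by blast
    have "x \<in> S (max j l)" if x: "x \<in> U \<inter> C (Suc i)" for x
    proof -
      obtain k :: int and c where k: "c \<in> U \<inter> C i" "x = t [^] k \<otimes> c" using t x by blast
      have "t \<in> S (max j l)" "c \<in> S (max j l)"
        using l k j mono[of j "max j l"] mono[of l "max j l"] by auto
      then show ?thesis using pow_mem(1)[OF S] k subgroup.m_closed[OF S] by blast
    qed
    then show ?case by blast
  qed
  then obtain j where "U \<inter> C n \<subseteq> S j" by blast
  then have "U \<subseteq> S j" using C_top subgroup.subset[OF U] by auto
  then have "S (Suc j) = S j" using inc[of j] unfolding U_def by blast
  then show ?thesis using that by blast
qed

end

section \<open>Residual finiteness of sections\<close>

context polycyclic_series
begin

lemma (in group) power_range_subgroup: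
  assumes "t \<in> carrier G" shows "subgroup (range (\<lambda>j::int. t [^] j)) G"
proof (rule subgroupI)
  show "range (\<lambda>j::int. t [^] j) \<subseteq> carrier G" using assms by auto
  fix a assume "a \<in> range (\<lambda>j::int. t [^] j)"
  then obtain i :: int where a: "a = t [^] i" by blast
  then have "inv a = t [^] (- i)" using assms by (simp add: int_pow_neg)
  then show "inv a \<in> range (\<lambda>j::int. t [^] j)" by blast
  fix b assume "b \<in> range (\<lambda>j::int. t [^] j)"
  then obtain j :: int where b: "b = t [^] j" by blast
  have "a \<otimes> b = t [^] (i + j)" using a b assms by (simp add: int_pow_mult)
  then show "a \<otimes> b \<in> range (\<lambda>j::int. t [^] j)" by blast
qed auto

text \<open>Residual finiteness of \<open>H/K\<close>, by induction along the series.  In the last step \<open>H\<close> is generated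
  by a normal subgroup \<open>H'\<close> and a further element \<open>t\<close>.  An element outside \<open>H'K\<close> is separated
  in a finite quotient of the cyclic group \<open>H/H'K\<close>.  An element of \<open>H'K\<close> outside \<open>K\<close> is separated
  from \<open>K\<close> by a subgroup \<open>W\<close> of finite index in \<open>H'K\<close> which is normal in \<open>H\<close>, as it is built from
  powers; if \<open>H/H'K\<close> is infinite then \<open>W\<langle>t\<rangle>\<close> has finite index in \<open>H\<close> and meets \<open>H'K\<close> only in \<open>W\<close>.\<close>

lemma separate_element:
  assumes "normal_in K H" "g \<in> H" "g \<notin> K"
  shows "\<exists>M. subgroup M G \<and> K \<subseteq> M \<and> M \<subseteq> H \<and> fin_index M H \<and> g \<notin> M"
proof -
  have "i \<le> n \<Longrightarrow> normal_in K H \<Longrightarrow> H \<subseteq> C i \<Longrightarrow> g \<in> H \<Longrightarrow> g \<notin> K \<Longrightarrow>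
      \<exists>M. subgroup M G \<and> K \<subseteq> M \<and> M \<subseteq> H \<and> fin_index M H \<and> g \<notin> M" for i K H g
  proof (induction i arbitrary: K H g)
    case 0
    then have "g = \<one>" using C_bot by auto
    then show ?case using 0 subgroup.one_closed[OF normal_inD(1)[OF \<open>normal_in K H\<close>]] by simp
  next
    case (Suc i)
    note N = \<open>normal_in K H\<close> note nn = normal_inD[OF N]
    have i: "i < n" using Suc.prems by simp
    have Hc: "\<And>x. x \<in> H \<Longrightarrow> x \<in> carrier G" using subgroup.mem_carrier[OF nn(2)] by auto
    define H' where "H' = H \<inter> C i"
    have H'sub: "subgroup H' G" "H' \<subseteq> H" unfolding H'_def
      using subgroups_Inter_pair[OF nn(2) C_subgroup[of i]] i by auto
    have H'N: "normal_in H' H"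
      unfolding normal_in_def
    proof (intro conjI ballI)
      fix h k assume h: "h \<in> H" "k \<in> H'"
      have "h \<otimes> k \<otimes> inv h \<in> C i"
        using normal_inD(4)[OF C_normal[OF i], of h k] h Suc.prems(3) unfolding H'_def by blast
      moreover have "h \<otimes> k \<otimes> inv h \<in> H"
        using h H'sub(2) subgroup.m_closed[OF nn(2)] subgroup.m_inv_closed[OF nn(2)] by blast
      ultimately show "h \<otimes> k \<otimes> inv h \<in> H'" unfolding H'_def by blast
    qed (use H'sub nn in auto)
    have "H \<inter> C (Suc i) = H" using Suc.prems(3) by auto
    then obtain t where t: "t \<in> H" "\<And>x. x \<in> H \<Longrightarrow> \<exists>k::int. \<exists>c\<in>H'. x = t [^] k \<otimes> c"
      using subgroup_cyclic_step[OF nn(2) i] unfolding H'_def by auto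
    have tc: "t \<in> carrier G" using t Hc by auto
    define L where "L = H' <#> K"
    have LN: "normal_in L H" unfolding L_def by (rule normal_in_set_mult[OF N H'N])
    note l = normal_inD[OF LN]
    have LL: "H' \<subseteq> L" "K \<subseteq> L" unfolding L_def using set_mult_normal[OF N H'sub] by auto
    have Lc: "\<And>x. x \<in> L \<Longrightarrow> x \<in> carrier G" using subgroup.mem_carrier[OF l(1)] by auto
    have tp: "t [^] (j::int) \<in> H" for j using pow_mem(1)[OF nn(2) t(1)] .
    \<comment> \<open>the powers of \<open>t\<close> fall into at most \<open>q\<close> cosets of \<open>\<langle>t\<^sup>q\<rangle>L\<close>\<close>
    have cyc: "fin_index (range (\<lambda>j::int. (t [^] q) [^] j) <#> L) H"
      if q0: "q > 0" for q :: nat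
    proof -
      let ?F = "(\<lambda>r::int. t [^] r) ` {0..<int q}"
      have "\<exists>f\<in>?F. \<exists>k\<in>range (\<lambda>j::int. (t [^] q) [^] j) <#> L. h = f \<otimes> k" if h: "h \<in> H" for h
      proof -
        obtain k :: int and c where k: "c \<in> H'" "h = t [^] k \<otimes> c" using t(2)[OF h] by blast
        let ?u = "(t [^] q) [^] (k div int q)"
        have u: "t [^] (int q * (k div int q)) = ?u"
          using int_pow_pow[OF tc, of "int q" "k div int q"] by (simp add: int_pow_int)
        have "t [^] k = t [^] (k mod int q) \<otimes> ?u"
          using int_pow_mult[OF tc, of "k mod int q" "int q * (k div int q)"] u by simp
        then have "h = t [^] (k mod int q) \<otimes> (?u \<otimes> c)"
          using k tc Lc LL(1) by (simp add: m_assoc subset_iff)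
        moreover have "?u \<otimes> c \<in> range (\<lambda>j::int. (t [^] q) [^] j) <#> L"
          using k(1) LL(1) unfolding set_mult_iff by blast
        moreover have "t [^] (k mod int q) \<in> ?F" using q0 by auto
        ultimately show ?thesis by blast
      qed
      moreover have "?F \<subseteq> H" using tp by auto
      moreover have "finite ?F" by simp
      ultimately show ?thesis unfolding fin_index_def by meson
    qed
    have cycsub: "subgroup (range (\<lambda>j::int. s [^] j)) G \<and> range (\<lambda>j::int. s [^] j) \<subseteq> H"
      if s: "s \<in> H" for s
      using power_range_subgroup[OF Hc[OF s]] pow_mem(1)[OF nn(2) s] by blast
    \<comment> \<open>the dichotomy whether \<open>H/L\<close> is finite or infinite cyclic\<close>
    have torsion: "fin_index L H" if p: "p > 0" "t [^] p \<in> L" for p :: nat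
    proof -
      have "range (\<lambda>j::int. (t [^] p) [^] j) <#> L \<subseteq> L"
        using pow_mem(1)[OF l(1) p(2)] subgroup.m_closed[OF l(1)] unfolding set_mult_def by blast
      then show ?thesis using fin_index_mono[OF cyc[OF p(1)]] by blast
    qed
    have free: "j = 0" if nt: "\<not> (\<exists>p::nat. p > 0 \<and> t [^] p \<in> L)" and j: "t [^] (j::int) \<in> L" for j
    proof (rule ccontr)
      assume "j \<noteq> 0"
      then have "nat \<bar>j\<bar> > 0" by simp
      moreover have "t [^] (nat \<bar>j\<bar>) \<in> L"
      proof -
        have "t [^] (nat \<bar>j\<bar>) = t [^] (j * sgn j)"
          by (simp add: int_pow_int[symmetric] abs_sgn[symmetric])
        also have "\<dots> = (t [^] j) [^] sgn j" using tc by (simp add: int_pow_pow)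
        finally show ?thesis using pow_mem(1)[OF l(1) j] by metis
      qed
      ultimately show False using nt by blast
    qed
    show ?case
    proof (cases "g \<in> L")
      case False
      show ?thesis
      proof (cases "\<exists>p::nat. p > 0 \<and> t [^] p \<in> L")
        case True
        then show ?thesis using torsion l(1,3) LL(2) False by blast
      next
        case nt: False
        obtain k :: int and c where k: "c \<in> H'" "g = t [^] k \<otimes> c" using t(2)[OF Suc.prems(4)] by blast
        \<comment> \<open>\<open>t\<^sup>k\<close> with \<open>0 < \<bar>k\<bar> < q\<close> is not congruent to a power of \<open>t\<^sup>q\<close>\<close>
        define q where "q = nat \<bar>k\<bar> + 1"
        let ?Z = "range (\<lambda>j::int. (t [^] q) [^] j)"
        let ?M = "?Z <#> L"
        have Z: "subgroup ?Z G" "?Z \<subseteq> H" using cycsub[OF pow_mem(2)[OF nn(2) t(1)]] by auto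
        note M = set_mult_normal[OF LN Z]
        have "g \<notin> ?M"
        proof
          assume "g \<in> ?M"
          then obtain j :: int and y where y: "y \<in> L" "g = (t [^] q) [^] j \<otimes> y"
            unfolding set_mult_iff by blast
          have e: "(t [^] q) [^] j = t [^] (int q * j)"
            using int_pow_pow[OF tc, of "int q" j] by (simp add: int_pow_int)
          have cc: "c \<in> carrier G" "y \<in> carrier G" using Lc LL(1) k(1) y(1) by auto
          have "t [^] k \<otimes> c = t [^] (int q * j) \<otimes> y" using k(2) y(2) e by simp
          then have "t [^] k = t [^] (int q * j) \<otimes> y \<otimes> inv c"
            using cc tc by (metis inv_solve_right m_closed int_pow_closed)
          then have "inv (t [^] (int q * j)) \<otimes> t [^] k = y \<otimes> inv c"
            using cc tc by (simp add: m_assoc)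
          moreover have "inv (t [^] (int q * j)) \<otimes> t [^] k = t [^] (k - int q * j)"
            using tc int_pow_mult[OF tc, of "- (int q * j)" k] by (simp add: int_pow_neg)
          moreover have "y \<otimes> inv c \<in> L"
            using y(1) k(1) LL(1) subgroup.m_closed[OF l(1)] subgroup.m_inv_closed[OF l(1)] by blast
          ultimately have "k = int q * j" using free[OF nt, of "k - int q * j"] by simp
          moreover have "\<bar>k\<bar> < int q" unfolding q_def by simp
          ultimately have "int q * \<bar>j\<bar> < int q * 1" by (simp add: abs_mult)
          then have "j = 0" by (simp only: mult_less_cancel_left) (auto simp: q_def)
          then have "k = 0" using \<open>k = int q * j\<close> by simp
          then have "g \<in> H'" using k cc by simp
          then show False using False LL(1) by blast
        qed
        moreover have "fin_index ?M H" using cyc[of q] unfolding q_def by simp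
        moreover have "K \<subseteq> ?M" using LL(2) M(3) by (rule order_trans)
        ultimately show ?thesis using M(1,4) by blast
      qed
    next
      case True
      then obtain h k where hk: "h \<in> H'" "k \<in> K" "g = h \<otimes> k" unfolding L_def set_mult_iff by blast
      have hK: "h \<notin> K" using hk Suc.prems(5) subgroup.m_closed[OF nn(1)] by blast
      have R: "normal_in (H' \<inter> K) H'" using normal_in_inter[OF N H'sub] .
      obtain M where M: "subgroup M G" "H' \<inter> K \<subseteq> M" "M \<subseteq> H'" "fin_index M H'" "h \<notin> M"
        using Suc.IH[OF _ R _ hk(1)] i hK unfolding H'_def by auto
      obtain m where m: "m > 0" "\<And>x. x \<in> H' \<Longrightarrow> x [^] (m::nat) \<in> M"
        using fin_index_imp_exponent[OF M(4,1) H'sub(1) M(3)] by blast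
      \<comment> \<open>\<open>M\<close> need not be normalised by \<open>t\<close>, but the power subgroup inside it is\<close>
      define V where "V = power_subgroup (H' \<inter> K) H' m"
      have RH: "normal_in (H' \<inter> K) H"
        using nn(4) normal_inD(4)[OF H'N] nn(2,3) H'sub(2) normal_inD(1)[OF R]
        unfolding normal_in_def by blast
      have VH: "normal_in V H" unfolding V_def by (rule power_subgroup_normal[OF RH H'N])
      note P = power_subgroup_props[OF normal_inD(1)[OF R] H'sub(1), where m = m, folded V_def]
      have VM: "V \<subseteq> M" using P(4)[OF M(1,2) m(2)] .
      have VH': "normal_in V H'" using normal_in_restrict[OF VH H'sub(1)] VM M(3) H'sub(2) by blast
      have Vfin: "fin_index V H'" using finite_exponent_imp_fin_index[OF VH' m(1) P(3)] .
      define W where "W = V <#> K"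
      have WH: "normal_in W H" unfolding W_def by (rule normal_in_set_mult[OF N VH])
      note w = normal_inD[OF WH]
      have VW: "V \<subseteq> W" "K \<subseteq> W" using set_mult_normal[OF N normal_inD(1,3)[OF VH]] unfolding W_def by auto
      have hW: "h \<notin> W"
      proof
        assume "h \<in> W"
        then obtain v x where v: "v \<in> V" "x \<in> K" "h = v \<otimes> x" unfolding W_def set_mult_iff by blast
        have vH: "v \<in> H'" using v(1) VM M(3) by blast
        have "x = inv v \<otimes> h" using v Hc nn(3) vH H'sub(2) by (simp add: subset_iff)
        then have "x \<in> H'" using vH hk(1) subgroup.m_closed[OF H'sub(1)] subgroup.m_inv_closed[OF H'sub(1)] by blast
        then have "x \<in> M" "v \<in> M" using v M(2) VM by blast+
        then show False using v(3) M(5) subgroup.m_closed[OF M(1)] by blast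
      qed
      have gW: "g \<notin> W"
      proof
        assume "g \<in> W"
        moreover have "h = g \<otimes> inv k" using hk Hc nn(3) H'sub(2) by (simp add: subset_iff m_assoc)
        ultimately have "h \<in> W"
          using hk(2) VW(2) subgroup.m_closed[OF w(1)] subgroup.m_inv_closed[OF w(1)] by blast
        then show False using hW by blast
      qed
      have WL: "W \<subseteq> L" unfolding W_def L_def using VM M(3) unfolding set_mult_def by blast
      obtain F where F: "finite F" "F \<subseteq> H'" "\<forall>x\<in>H'. \<exists>f\<in>F. \<exists>v\<in>V. x = f \<otimes> v"
        using Vfin unfolding fin_index_def by blast
      have FL: "\<exists>f\<in>F. \<exists>v\<in>W. x = f \<otimes> v" if x: "x \<in> L" for x
      proof -
        obtain a b where ab: "a \<in> H'" "b \<in> K" "x = a \<otimes> b" using x unfolding L_def set_mult_iff by blast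
        obtain f v where f: "f \<in> F" "v \<in> V" "a = f \<otimes> v" using F(3) ab(1) by blast
        have "f \<in> H" "v \<in> H" "b \<in> H"
          using f F(2) H'sub(2) normal_inD(3)[OF VH] ab(2) nn(3) by blast+
        then have "x = f \<otimes> (v \<otimes> b)" using ab(3) f(3) Hc by (simp add: m_assoc)
        moreover have "v \<otimes> b \<in> W" using f(2) ab(2) unfolding W_def set_mult_iff by blast
        ultimately show ?thesis using f(1) by blast
      qed
      show ?thesis
      proof (cases "\<exists>p::nat. p > 0 \<and> t [^] p \<in> L")
        case True
        then have "fin_index L H" using torsion by blast
        moreover have "fin_index W L" unfolding fin_index_def using F FL LL(1) by (meson order_trans)
        ultimately have "fin_index W H" using fin_index_trans[OF _ _ nn(2) l(3) WL] by blast
        then show ?thesis using w VW(2) gW by blast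
      next
        case nt: False
        let ?Z = "range (\<lambda>j::int. t [^] j)"
        let ?M = "?Z <#> W"
        have Z: "subgroup ?Z G" "?Z \<subseteq> H" using cycsub[OF t(1)] by auto
        note M' = set_mult_normal[OF WH Z]
        have "g \<notin> ?M"
        proof
          assume "g \<in> ?M"
          then obtain j :: int and y where y: "y \<in> W" "g = t [^] j \<otimes> y" unfolding set_mult_iff by blast
          have yc: "y \<in> carrier G" using y(1) WL Lc by blast
          have "t [^] j = g \<otimes> inv y" using y yc tc by (simp add: m_assoc)
          then have "t [^] j \<in> L"
            using True y(1) WL subgroup.m_closed[OF l(1)] subgroup.m_inv_closed[OF l(1)] by (simp add: subset_iff)
          then have "j = 0" by (rule free[OF nt])
          then show False using gW y yc by simp
        qed
        moreover have "fin_index ?M H"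
        proof -
          have "\<exists>f\<in>F. \<exists>v\<in>?M. x = f \<otimes> v" if x: "x \<in> H" for x
          proof -
            obtain a :: int and c where a: "c \<in> H'" "x = t [^] a \<otimes> c" using t(2)[OF x] by blast
            let ?s = "t [^] a"
            have "c \<in> H" using a(1) H'sub(2) by blast
            then have cc: "c \<in> carrier G" "?s \<in> carrier G" using Hc tc by auto
            have "?s \<otimes> c \<otimes> inv ?s \<in> L" using l(4)[OF tp] a(1) LL(1) by blast
            then obtain f v where f: "f \<in> F" "v \<in> W" "?s \<otimes> c \<otimes> inv ?s = f \<otimes> v" using FL by blast
            have fv: "f \<in> H" "v \<in> H" using f F(2) H'sub(2) w(3) by blast+
            have "x = (?s \<otimes> c \<otimes> inv ?s) \<otimes> ?s" using a(2) cc by (simp add: word_simps)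
            also have "\<dots> = f \<otimes> (?s \<otimes> (inv ?s \<otimes> v \<otimes> ?s))"
              unfolding f(3) using Hc[OF fv(1)] Hc[OF fv(2)] cc by (simp add: word_simps)
            finally have "x = f \<otimes> (?s \<otimes> (inv ?s \<otimes> v \<otimes> ?s))" .
            moreover have "?s \<otimes> (inv ?s \<otimes> v \<otimes> ?s) \<in> ?M"
              using w(5)[OF tp f(2)] unfolding set_mult_iff by blast
            ultimately show ?thesis using f(1) by blast
          qed
          moreover have "F \<subseteq> H" using F(2) H'sub(2) by blast
          ultimately show ?thesis unfolding fin_index_def using F(1) by meson
        qed
        ultimately show ?thesis using M' VW(2) by blast
      qed
    qed
  qed
  then show ?thesis using assms C_top subgroup.subset[OF normal_inD(2)[OF assms(1)]] by blast
qed

text \<open>The finitely many cosets of \<open>K\<close> in \<open>A\<close> other than \<open>K\<close> are separated from \<open>K\<close> one at a time; the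
  product of the exponents of the separating subgroups works for all of them.\<close>

lemma separate_finite_extension:
  assumes N: "normal_in K H" and A: "subgroup A G" "K \<subseteq> A" "A \<subseteq> H" and fin: "fin_index K A"
  obtains m where "m > 0" "power_subgroup K H m \<inter> A = K"
proof -
  note nn = normal_inD[OF N]
  obtain F where F: "finite F" "F \<subseteq> A" "\<forall>h\<in>A. \<exists>f\<in>F. \<exists>k\<in>K. h = f \<otimes> k"
    using fin unfolding fin_index_def by blast
  have "\<exists>M m. subgroup M G \<and> K \<subseteq> M \<and> f \<notin> M \<and> m > 0 \<and> (\<forall>x\<in>H. x [^] (m::nat) \<in> M)"
    if f: "f \<in> F - K" for f
  proof -
    have "f \<in> H" "f \<notin> K" using f F(2) A(3) by auto
    then obtain M where M: "subgroup M G" "K \<subseteq> M" "M \<subseteq> H" "fin_index M H" "f \<notin> M"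
      using separate_element[OF N] by blast
    then show ?thesis using fin_index_imp_exponent[OF M(4,1) nn(2) M(3)] by metis
  qed
  then obtain M m where Mm: "\<And>f. f \<in> F - K \<Longrightarrow> subgroup (M f) G" "\<And>f. f \<in> F - K \<Longrightarrow> K \<subseteq> M f"
    "\<And>f. f \<in> F - K \<Longrightarrow> f \<notin> M f" "\<And>f. f \<in> F - K \<Longrightarrow> m f > 0"
    "\<And>f x. f \<in> F - K \<Longrightarrow> x \<in> H \<Longrightarrow> x [^] (m f :: nat) \<in> M f"
    by metis
  define e where "e = (\<Prod>f\<in>F - K. m f)"
  have e0: "e > 0" unfolding e_def by (rule prod_pos) (rule Mm(4))
  note P = power_subgroup_props[OF nn(1,2), where m = e]
  have sub: "power_subgroup K H e \<subseteq> M f" if f: "f \<in> F - K" for f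
  proof (rule P(4)[OF Mm(1)[OF f] Mm(2)[OF f]])
    fix x assume x: "x \<in> H"
    obtain q where q: "e = m f * q" unfolding e_def using f F(1) by (metis dvdE dvd_prodI finite_Diff)
    have "x [^] e = (x [^] m f) [^] q"
      unfolding q using x subgroup.mem_carrier[OF nn(2)] by (simp add: nat_pow_pow)
    then show "x [^] e \<in> M f" using pow_mem(2)[OF Mm(1)[OF f] Mm(5)[OF f x]] by simp
  qed
  have "a \<in> K" if a: "a \<in> power_subgroup K H e" "a \<in> A" for a
  proof (rule ccontr)
    assume aK: "a \<notin> K"
    obtain f k where f: "f \<in> F" "k \<in> K" "a = f \<otimes> k" using F(3) a(2) by blast
    then have fK: "f \<in> F - K" using aK subgroup.m_closed[OF nn(1)] by blast
    have "f \<in> carrier G" "k \<in> carrier G"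
      using f F(2) subgroup.mem_carrier[OF A(1)] subgroup.mem_carrier[OF nn(1)] by auto
    then have "f = a \<otimes> inv k" using f by (simp add: m_assoc)
    moreover have "a \<in> M f" "k \<in> M f" using sub[OF fK] a(1) f(2) Mm(2)[OF fK] by auto
    ultimately have "f \<in> M f"
      using subgroup.m_closed[OF Mm(1)[OF fK]] subgroup.m_inv_closed[OF Mm(1)[OF fK]] by metis
    then show False using Mm(3)[OF fK] by blast
  qed
  then have "power_subgroup K H e \<inter> A = K" using P(2) A(2) by blast
  then show ?thesis using that e0 by blast
qed

end

section \<open>Derived series and abelian sections\<close>

context group
begin

lemma commutator_subgroup_images:
  assumes "f \<in> hom G G" "H \<subseteq> carrier G" "f ` H \<subseteq> H"
  shows "f ` (derived G ^^ d) H \<subseteq> (derived G ^^ d) H"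
proof -
  interpret f: group_hom G G f using assms(1) by (simp add: group_hom_def group_hom_axioms_def is_group)
  show ?thesis using f.exp_of_derived_img[OF assms(2), of d] mono_exp_of_derived[OF assms(3), of d] by simp
qed

lemma commutator_subgroup_normal:
  assumes H: "subgroup H G"
  shows "normal_in ((derived G ^^ d) H) H"
  unfolding normal_in_def
proof (intro conjI ballI)
  show "subgroup ((derived G ^^ d) H) G" by (rule exp_of_derived_is_subgroup[OF H])
  show "(derived G ^^ d) H \<subseteq> H"
    by (induction d) (use derived_incl[OF _ H] in auto)
  fix h k assume h: "h \<in> H" and k: "k \<in> (derived G ^^ d) H"
  have "(\<lambda>x. h \<otimes> x \<otimes> inv h) ` H \<subseteq> H"
    using h subgroup.m_closed[OF H] subgroup.m_inv_closed[OF H] by blast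
  then show "h \<otimes> k \<otimes> inv h \<in> (derived G ^^ d) H"
    using commutator_subgroup_images[OF conjugation_hom[OF subgroup.mem_carrier[OF H h]] subgroup.subset[OF H]] k
    by blast
qed (rule H)

lemma commutator_in_derived:
  "a \<in> D \<Longrightarrow> b \<in> D \<Longrightarrow> a \<otimes> b \<otimes> inv a \<otimes> inv b \<in> derived G D"
  unfolding derived_def by (rule generate.incl) blast

definition abelian_mod :: "'a set \<Rightarrow> 'a set \<Rightarrow> bool" where
  "abelian_mod K A \<longleftrightarrow> (\<forall>a\<in>A. \<forall>b\<in>A. a \<otimes> b \<otimes> inv a \<otimes> inv b \<in> K)"

text \<open>Elements of \<open>K\<close> can be collected on one side, so that a commutator of elements of \<open>DK\<close> differs from
  a commutator of elements of \<open>D\<close> by a conjugate of an element of \<open>K\<close>.\<close>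

lemma abelian_mod_set_mult:
  assumes N: "normal_in K H" and D: "D \<subseteq> H" and ab: "abelian_mod K D"
  shows "abelian_mod K (D <#> K)"
  unfolding abelian_mod_def
proof (intro ballI)
  note n = normal_inD[OF N]
  fix a b assume "a \<in> D <#> K" "b \<in> D <#> K"
  then obtain x k y l where x: "x \<in> D" "k \<in> K" "a = x \<otimes> k" and y: "y \<in> D" "l \<in> K" "b = y \<otimes> l"
    unfolding set_mult_iff by metis
  have H: "x \<in> H" "y \<in> H" using x y D by auto
  have c: "x \<in> carrier G" "y \<in> carrier G" "k \<in> carrier G" "l \<in> carrier G"
    using H x y subgroup.mem_carrier[OF n(2)] subgroup.mem_carrier[OF n(1)] by auto
  let ?u = "(inv y \<otimes> k \<otimes> y) \<otimes> l" and ?v = "(inv x \<otimes> l \<otimes> x) \<otimes> k"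
  have "?u \<in> K" "?v \<in> K" using n(5) H x y subgroup.m_closed[OF n(1)] by blast+
  then have uv: "?u \<otimes> inv ?v \<in> K" using subgroup.m_closed[OF n(1)] subgroup.m_inv_closed[OF n(1)] by blast
  have yx: "y \<otimes> x \<in> H" using H subgroup.m_closed[OF n(2)] by blast
  have "a \<otimes> b \<otimes> inv a \<otimes> inv b =
      (x \<otimes> y \<otimes> inv x \<otimes> inv y) \<otimes> ((y \<otimes> x) \<otimes> (?u \<otimes> inv ?v) \<otimes> inv (y \<otimes> x))"
    unfolding x(3) y(3) using c by (simp add: word_simps)
  then show "a \<otimes> b \<otimes> inv a \<otimes> inv b \<in> K"
    using ab x(1) y(1) n(4)[OF yx uv] subgroup.m_closed[OF n(1)] unfolding abelian_mod_def by metis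
qed

text \<open>An endomorphism of the quotient \<open>A/K\<close>, given by a map on representatives which is
  multiplicative up to elements of \<open>K\<close>.\<close>

definition hom_mod :: "'a set \<Rightarrow> 'a set \<Rightarrow> ('a \<Rightarrow> 'a) \<Rightarrow> bool" where
  "hom_mod K A f \<longleftrightarrow> f ` A \<subseteq> A \<and> f ` K \<subseteq> K \<and> (\<forall>a\<in>A. \<forall>b\<in>A. \<exists>k\<in>K. f (a \<otimes> b) = f a \<otimes> f b \<otimes> k)"

lemma hom_modD:
  assumes "hom_mod K A f"
  shows "a \<in> A \<Longrightarrow> f a \<in> A" "k \<in> K \<Longrightarrow> f k \<in> K"
    "a \<in> A \<Longrightarrow> b \<in> A \<Longrightarrow> \<exists>k\<in>K. f (a \<otimes> b) = f a \<otimes> f b \<otimes> k"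
  using assms unfolding hom_mod_def by (simp_all add: image_subset_iff)

lemma hom_mod_funpow:
  assumes N: "normal_in K A" and f: "hom_mod K A f"
  shows "hom_mod K A (f ^^ j)"
proof (induction j)
  case 0
  note n = normal_inD[OF N]
  have "\<exists>k\<in>K. a \<otimes> b = a \<otimes> b \<otimes> k" if "a \<in> A" "b \<in> A" for a b
    using that subgroup.mem_carrier[OF n(2)] subgroup.one_closed[OF n(1)]
    by (intro bexI[of _ \<one>]) auto
  then show ?case unfolding hom_mod_def by simp
next
  case (Suc j)
  note n = normal_inD[OF N]
  let ?g = "f ^^ j"
  have "\<exists>k\<in>K. f (?g (a \<otimes> b)) = f (?g a) \<otimes> f (?g b) \<otimes> k" if ab: "a \<in> A" "b \<in> A" for a b
  proof -
    obtain k where k: "k \<in> K" "?g (a \<otimes> b) = ?g a \<otimes> ?g b \<otimes> k"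
      using hom_modD(3)[OF Suc ab] by blast
    have g: "?g a \<in> A" "?g b \<in> A" "k \<in> A" using hom_modD(1)[OF Suc] ab k(1) n(3) by auto
    then have gg: "?g a \<otimes> ?g b \<in> A" using subgroup.m_closed[OF n(2)] by blast
    obtain l where l: "l \<in> K" "f (?g a \<otimes> ?g b \<otimes> k) = f (?g a \<otimes> ?g b) \<otimes> f k \<otimes> l"
      using hom_modD(3)[OF f gg g(3)] by blast
    obtain m where m: "m \<in> K" "f (?g a \<otimes> ?g b) = f (?g a) \<otimes> f (?g b) \<otimes> m"
      using hom_modD(3)[OF f g(1,2)] by blast
    have fk: "f k \<in> K" "f (?g a) \<in> A" "f (?g b) \<in> A" using hom_modD(1,2)[OF f] k(1) g by auto
    have "f (?g (a \<otimes> b)) = f (?g a) \<otimes> f (?g b) \<otimes> (m \<otimes> f k \<otimes> l)"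
      using k(2) l m fk subgroup.mem_carrier[OF n(1)] subgroup.mem_carrier[OF n(2)] by (simp add: word_simps)
    moreover have "m \<otimes> f k \<otimes> l \<in> K" using m(1) l(1) fk(1) subgroup.m_closed[OF n(1)] by blast
    ultimately show ?thesis by blast
  qed
  moreover have "f (?g a) \<in> A" if "a \<in> A" for a using hom_modD(1)[OF f hom_modD(1)[OF Suc that]] .
  moreover have "f (?g a) \<in> K" if "a \<in> K" for a using hom_modD(2)[OF f hom_modD(2)[OF Suc that]] .
  ultimately show ?case unfolding hom_mod_def by (simp add: image_subset_iff)
qed

lemma hom_mod_diff:
  assumes N: "normal_in K A" and f: "hom_mod K A f" and a: "a \<in> A" and b: "b \<in> A"
  shows "\<exists>k\<in>K. inv (f a) \<otimes> f b = f (inv a \<otimes> b) \<otimes> k"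
proof -
  note n = normal_inD[OF N]
  have ab: "inv a \<otimes> b \<in> A" using a b subgroup.m_closed[OF n(2)] subgroup.m_inv_closed[OF n(2)] by blast
  obtain k where k: "k \<in> K" "f (a \<otimes> (inv a \<otimes> b)) = f a \<otimes> f (inv a \<otimes> b) \<otimes> k"
    using f a ab unfolding hom_mod_def by blast
  have "a \<otimes> (inv a \<otimes> b) = b" using a b subgroup.mem_carrier[OF n(2)] by simp
  then have e: "f b = f a \<otimes> f (inv a \<otimes> b) \<otimes> k" using k(2) by simp
  have "f a \<in> A" "f (inv a \<otimes> b) \<in> A" using f a ab unfolding hom_mod_def by blast+
  then have "inv (f a) \<otimes> f b = f (inv a \<otimes> b) \<otimes> k"
    unfolding e using k(1) subgroup.mem_carrier[OF n(2)] subgroup.mem_carrier[OF n(1)]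
    by (simp add: word_simps)
  then show ?thesis using k(1) by blast
qed

lemma hom_mod_kernel:
  assumes N: "normal_in K A" and f: "hom_mod K A f"
  shows "subgroup {a\<in>A. f a \<in> K} G"
proof -
  note n = normal_inD[OF N]
  have sub: "K \<subseteq> {a\<in>A. f a \<in> K}" using f n(3) unfolding hom_mod_def by blast
  have d: "inv a \<otimes> b \<in> {a\<in>A. f a \<in> K}" if a: "a \<in> {a\<in>A. f a \<in> K}" and b: "b \<in> {a\<in>A. f a \<in> K}" for a b
  proof -
    have ab: "inv a \<otimes> b \<in> A" using a b subgroup.m_closed[OF n(2)] subgroup.m_inv_closed[OF n(2)] by blast
    obtain k where k: "k \<in> K" "inv (f a) \<otimes> f b = f (inv a \<otimes> b) \<otimes> k"
      using hom_mod_diff[OF N f] a b by blast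
    have "inv (f a) \<otimes> f b \<in> K"
      using a b subgroup.m_closed[OF n(1)] subgroup.m_inv_closed[OF n(1)] by blast
    moreover have "f (inv a \<otimes> b) \<in> carrier G"
      using f ab subgroup.mem_carrier[OF n(2)] unfolding hom_mod_def by blast
    then have "f (inv a \<otimes> b) = (inv (f a) \<otimes> f b) \<otimes> inv k"
      unfolding k(2) using k(1) subgroup.mem_carrier[OF n(1)] by (simp add: m_assoc)
    ultimately have "f (inv a \<otimes> b) \<in> K"
      using k(1) subgroup.m_closed[OF n(1)] subgroup.m_inv_closed[OF n(1)] by metis
    then show ?thesis using ab by blast
  qed
  have one: "\<one> \<in> {a\<in>A. f a \<in> K}" using sub subgroup.one_closed[OF n(1)] by blast
  have inv: "inv a \<in> {a\<in>A. f a \<in> K}" if a: "a \<in> {a\<in>A. f a \<in> K}" for a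
  proof -
    have "a \<in> carrier G" using a subgroup.mem_carrier[OF n(2)] by blast
    then show ?thesis using d[OF a one] by simp
  qed
  show ?thesis
  proof (rule subgroupI)
    show "{a\<in>A. f a \<in> K} \<subseteq> carrier G" using subgroup.mem_carrier[OF n(2)] by blast
    show "{a\<in>A. f a \<in> K} \<noteq> {}" using one by blast
    fix a b assume a: "a \<in> {a\<in>A. f a \<in> K}" and b: "b \<in> {a\<in>A. f a \<in> K}"
    then have "a \<in> carrier G" using subgroup.mem_carrier[OF n(2)] by blast
    then show "a \<otimes> b \<in> {a\<in>A. f a \<in> K}" using d[OF inv[OF a] b] by simp
  qed (rule inv)
qed

lemma hom_mod_image:
  assumes N: "normal_in K A" and f: "hom_mod K A f"
  shows "subgroup (f ` A <#> K) G" "f ` A <#> K \<subseteq> A" "K \<subseteq> f ` A <#> K"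
proof -
  note n = normal_inD[OF N]
  let ?I = "f ` A <#> K"
  have fA: "f a \<in> A" "f a \<in> carrier G" if "a \<in> A" for a
    using f that subgroup.mem_carrier[OF n(2)] unfolding hom_mod_def by blast+
  have Kc: "k \<in> K \<Longrightarrow> k \<in> carrier G" for k using subgroup.mem_carrier[OF n(1)] by blast
  show IA: "?I \<subseteq> A" using fA(1) n(3) subgroup.m_closed[OF n(2)] unfolding set_mult_def by blast
  have one: "\<one> \<in> A" "f \<one> \<in> K" using subgroup.one_closed[OF n(1)] n(3) f unfolding hom_mod_def by blast+
  show KI: "K \<subseteq> ?I"
  proof
    fix k assume k: "k \<in> K"
    have "k = f \<one> \<otimes> (inv (f \<one>) \<otimes> k)" using k one(2) Kc by simp
    moreover have "inv (f \<one>) \<otimes> k \<in> K"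
      using k one(2) subgroup.m_closed[OF n(1)] subgroup.m_inv_closed[OF n(1)] by blast
    ultimately show "k \<in> ?I" using one(1) unfolding set_mult_iff by blast
  qed
  have d: "inv x \<otimes> y \<in> ?I" if "x \<in> ?I" "y \<in> ?I" for x y
  proof -
    obtain a k where x: "a \<in> A" "k \<in> K" "x = f a \<otimes> k" using \<open>x \<in> ?I\<close> unfolding set_mult_iff by blast
    obtain b l where y: "b \<in> A" "l \<in> K" "y = f b \<otimes> l" using \<open>y \<in> ?I\<close> unfolding set_mult_iff by blast
    let ?c = "inv a \<otimes> b"
    have c: "?c \<in> A" using x y subgroup.m_closed[OF n(2)] subgroup.m_inv_closed[OF n(2)] by blast
    obtain m where m: "m \<in> K" "inv (f a) \<otimes> f b = f ?c \<otimes> m" using hom_mod_diff[OF N f x(1) y(1)] by blast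
    let ?w = "f ?c \<otimes> m"
    have wA: "?w \<in> A" using fA(1)[OF c] m(1) n(3) subgroup.m_closed[OF n(2)] by blast
    have "inv x \<otimes> y = inv k \<otimes> (inv (f a) \<otimes> f b) \<otimes> l"
      unfolding x(3) y(3) using x y fA Kc by (simp add: word_simps)
    also have "\<dots> = f ?c \<otimes> (m \<otimes> (inv ?w \<otimes> inv k \<otimes> ?w) \<otimes> l)"
      unfolding m(2) using x y fA(2)[OF c] Kc m(1) by (simp add: word_simps)
    finally have e: "inv x \<otimes> y = f ?c \<otimes> (m \<otimes> (inv ?w \<otimes> inv k \<otimes> ?w) \<otimes> l)" .
    have "inv ?w \<otimes> inv k \<otimes> ?w \<in> K" using n(5)[OF wA] x(2) subgroup.m_inv_closed[OF n(1)] by blast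
    then have "m \<otimes> (inv ?w \<otimes> inv k \<otimes> ?w) \<otimes> l \<in> K" using m(1) y(2) subgroup.m_closed[OF n(1)] by blast
    then show ?thesis using e c unfolding set_mult_iff by blast
  qed
  have o: "\<one> \<in> ?I" using KI subgroup.one_closed[OF n(1)] by blast
  have Ic: "x \<in> carrier G" if "x \<in> ?I" for x using that IA subgroup.mem_carrier[OF n(2)] by blast
  have inv: "inv x \<in> ?I" if x: "x \<in> ?I" for x using d[OF x o] Ic[OF x] by simp
  show "subgroup ?I G"
  proof (rule subgroupI)
    show "?I \<subseteq> carrier G" using Ic by blast
    show "?I \<noteq> {}" using o by blast
    fix x y assume x: "x \<in> ?I" and y: "y \<in> ?I"
    show "x \<otimes> y \<in> ?I" using d[OF inv[OF x] y] Ic[OF x] by simp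
  qed (rule inv)
qed

end

text \<open>The kernels of the iterates \<open>f\<^sup>j\<close> on \<open>A/K\<close> become stationary, and from then on the kernel of \<open>f\<close>
  meets the image of \<open>f\<^sup>j\<close> trivially.  All iterates have an image of finite index, hence the kernel
  of \<open>f\<close> injects into a finite set of cosets.\<close>

lemma (in polycyclic_series) finite_cokernel_imp_finite_kernel:
  assumes N: "normal_in K A" and f: "hom_mod K A f" and fin: "fin_index (f ` A <#> K) A"
  shows "fin_index K {a\<in>A. f a \<in> K}"
proof -
  note n = normal_inD[OF N]
  have Kc: "k \<in> K \<Longrightarrow> k \<in> carrier G" for k using subgroup.mem_carrier[OF n(1)] by blast
  have Ac: "k \<in> A \<Longrightarrow> k \<in> carrier G" for k using subgroup.mem_carrier[OF n(2)] by blast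
  note fj = hom_mod_funpow[OF N f]
  define Z where "Z j = {a\<in>A. (f ^^ j) a \<in> K}" for j
  have Zsub: "subgroup (Z j) G" for j unfolding Z_def by (rule hom_mod_kernel[OF N fj])
  have "Z j \<subseteq> Z (Suc j)" for j using f unfolding Z_def hom_mod_def by auto
  then obtain j where j: "Z (Suc j) = Z j" using ascending_chain_stationary[of Z] Zsub by blast
  have I: "fin_index ((f ^^ i) ` A <#> K) A" for i
  proof (induction i)
    case 0
    show ?case
      using fin_index_mono[OF fin_index_refl[OF n(2)], of "(f ^^ 0) ` A <#> K"] Ac subgroup.one_closed[OF n(1)]
      unfolding set_mult_def by force
  next
    case (Suc i)
    let ?g = "f ^^ i"
    obtain E where E: "finite E" "E \<subseteq> A" "\<forall>h\<in>A. \<exists>e\<in>E. \<exists>k\<in>f ` A <#> K. h = e \<otimes> k"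
      using fin unfolding fin_index_def by blast
    obtain F where F: "finite F" "F \<subseteq> A" "\<forall>h\<in>A. \<exists>e\<in>F. \<exists>k\<in>?g ` A <#> K. h = e \<otimes> k"
      using Suc unfolding fin_index_def by blast
    have "\<exists>e\<in>E <#> f ` F. \<exists>k\<in>(f ^^ Suc i) ` A <#> K. a = e \<otimes> k" if a: "a \<in> A" for a
    proof -
      obtain e y where e: "e \<in> E" "y \<in> f ` A <#> K" "a = e \<otimes> y" using E(3) a by blast
      obtain b k where b: "b \<in> A" "k \<in> K" "y = f b \<otimes> k" using e(2) unfolding set_mult_iff by blast
      obtain h z where h: "h \<in> F" "z \<in> ?g ` A <#> K" "b = h \<otimes> z" using F(3) b(1) by blast
      obtain c l where c: "c \<in> A" "l \<in> K" "z = ?g c \<otimes> l" using h(2) unfolding set_mult_iff by blast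
      have A: "h \<in> A" "?g c \<in> A" "l \<in> A" "?g c \<otimes> l \<in> A" "e \<in> A"
        using h(1) F(2) c(1,2) fj[of i] n(3) subgroup.m_closed[OF n(2)] e(1) E(2) unfolding hom_mod_def by blast+
      obtain m where m: "m \<in> K" "f (h \<otimes> (?g c \<otimes> l)) = f h \<otimes> f (?g c \<otimes> l) \<otimes> m"
        using f A unfolding hom_mod_def by blast
      obtain p where p: "p \<in> K" "f (?g c \<otimes> l) = f (?g c) \<otimes> f l \<otimes> p"
        using f A unfolding hom_mod_def by blast
      have fA: "f h \<in> A" "f (?g c) \<in> A" "f l \<in> K" using f A c(2) unfolding hom_mod_def by blast+
      have "a = e \<otimes> f h \<otimes> (f (?g c) \<otimes> (f l \<otimes> p \<otimes> m \<otimes> k))"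
        unfolding e(3) b(3) h(3) c(3) m(2) p(2)
        using Kc[OF m(1)] Kc[OF p(1)] Kc[OF b(2)] Kc[OF fA(3)] Ac[OF fA(1)] Ac[OF fA(2)] Ac[OF A(5)]
        by (simp add: word_simps)
      moreover have "f l \<otimes> p \<otimes> m \<otimes> k \<in> K" using fA(3) p(1) m(1) b(2) subgroup.m_closed[OF n(1)] by blast
      then have "f (?g c) \<otimes> (f l \<otimes> p \<otimes> m \<otimes> k) \<in> (f ^^ Suc i) ` A <#> K"
        using c(1) unfolding set_mult_iff by auto
      moreover have "e \<otimes> f h \<in> E <#> f ` F" using e(1) h(1) unfolding set_mult_iff by blast
      ultimately show ?thesis by blast
    qed
    moreover have "E <#> f ` F \<subseteq> A"
      using E(2) F(2) f subgroup.m_closed[OF n(2)] unfolding set_mult_def hom_mod_def by blast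
    moreover have "finite (E <#> f ` F)" using E(1) F(1) unfolding set_mult_def by simp
    ultimately show ?case unfolding fin_index_def by meson
  qed
  let ?I = "(f ^^ j) ` A <#> K"
  have Z1: "Z 1 = {a\<in>A. f a \<in> K}" unfolding Z_def by simp
  have sub: "Z 1 \<inter> ?I \<subseteq> K"
  proof
    fix z assume z: "z \<in> Z 1 \<inter> ?I"
    obtain b k where b: "b \<in> A" "k \<in> K" "z = (f ^^ j) b \<otimes> k"
      using IntD2[OF z] unfolding set_mult_iff by blast
    have bA: "(f ^^ j) b \<in> A" "k \<in> A" using fj[of j] b(1,2) n(3) unfolding hom_mod_def by blast+
    obtain m where m: "m \<in> K" "f ((f ^^ j) b \<otimes> k) = f ((f ^^ j) b) \<otimes> f k \<otimes> m"
      using f bA unfolding hom_mod_def by blast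
    have fb: "f ((f ^^ j) b) \<in> carrier G" "f k \<in> K" using f bA b(2) Ac unfolding hom_mod_def by blast+
    have "f z \<in> K" using z Z1 by blast
    then have "f z \<otimes> inv m \<otimes> inv (f k) \<in> K"
      using m(1) fb(2) subgroup.m_closed[OF n(1)] subgroup.m_inv_closed[OF n(1)] by blast
    moreover have "f z \<otimes> inv m \<otimes> inv (f k) = f ((f ^^ j) b)"
      unfolding b(3) m(2) using Kc[OF m(1)] Kc[OF fb(2)] fb(1) by (simp add: word_simps)
    ultimately have "b \<in> Z (Suc j)" using b(1) unfolding Z_def by simp
    then have "(f ^^ j) b \<in> K" using j unfolding Z_def by blast
    then show "z \<in> K" using b subgroup.m_closed[OF n(1)] by blast
  qed
  have "Z 1 \<subseteq> A" unfolding Z_def by blast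
  then have "fin_index (Z 1 \<inter> ?I) (Z 1)"
    using fin_index_inter[OF I[of j] hom_mod_image(1)[OF N fj] n(2) Zsub[of 1]] by blast
  then have "fin_index K (Z 1)" using sub by (rule fin_index_mono)
  then show ?thesis unfolding Z1 .
qed

section \<open>Twisted conjugacy in sections\<close>

context group
begin

text \<open>The stabiliser of the trivial coset under the action of \<open>H\<close> on \<open>H/K\<close> by \<open>x \<cdot> h = x h \<phi>(x)\<^sup>-\<^sup>1\<close>; for
  \<open>\<phi>\<close>-invariant \<open>K\<close> it is the preimage of the group of fixed points of \<open>\<phi>\<close> on \<open>H/K\<close>.\<close>

definition twisted_fixed :: "('a \<Rightarrow> 'a) \<Rightarrow> 'a set \<Rightarrow> 'a set \<Rightarrow> 'a set" where
  "twisted_fixed \<phi> K H = {x\<in>H. x \<otimes> inv (\<phi> x) \<in> K}"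

text \<open>The same action has finitely many orbits; the factor \<open>k\<close> stands for equality in \<open>H/K\<close>.\<close>

definition finite_twisted :: "('a \<Rightarrow> 'a) \<Rightarrow> 'a set \<Rightarrow> 'a set \<Rightarrow> bool" where
  "finite_twisted \<phi> K H \<longleftrightarrow> (\<exists>S. finite S \<and> S \<subseteq> H \<and>
     (\<forall>h\<in>H. \<exists>s\<in>S. \<exists>x\<in>H. \<exists>k\<in>K. h = x \<otimes> s \<otimes> inv (\<phi> x) \<otimes> k))"

lemma finite_twisted_mono: "finite_twisted \<phi> K H \<Longrightarrow> K \<subseteq> K' \<Longrightarrow> finite_twisted \<phi> K' H"
  unfolding finite_twisted_def by (meson subsetD)

end

text \<open>A section \<open>H/K\<close> of \<open>G\<close> which inherits an endomorphism from \<open>\<phi>\<close>.\<close>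

locale invariant_section = group +
  fixes \<phi> :: "'a \<Rightarrow> 'a" and K H :: "'a set"
  assumes hom: "\<phi> \<in> hom G G" and normal: "normal_in K H"
    and H_inv: "\<And>x. x \<in> H \<Longrightarrow> \<phi> x \<in> H" and K_inv: "\<And>x. x \<in> K \<Longrightarrow> \<phi> x \<in> K"
begin

sublocale f: group_hom G G \<phi>
  using hom by (simp add: group_hom_def group_hom_axioms_def is_group)

lemmas K_sub = normal_inD(1)[OF normal] and H_sub = normal_inD(2)[OF normal]
  and KH = normal_inD(3)[OF normal] and K_conj = normal_inD(4,5)[OF normal]

lemma Hc [simp]: "x \<in> H \<Longrightarrow> x \<in> carrier G" and Kc [simp]: "x \<in> K \<Longrightarrow> x \<in> carrier G"
  using subgroup.mem_carrier[OF H_sub] subgroup.mem_carrier[OF K_sub] by auto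

lemma H_closed: "x \<in> H \<Longrightarrow> y \<in> H \<Longrightarrow> x \<otimes> y \<in> H" "x \<in> H \<Longrightarrow> inv x \<in> H"
  using subgroup.m_closed[OF H_sub] subgroup.m_inv_closed[OF H_sub] by auto

lemma K_closed: "x \<in> K \<Longrightarrow> y \<in> K \<Longrightarrow> x \<otimes> y \<in> K" "x \<in> K \<Longrightarrow> inv x \<in> K"
  using subgroup.m_closed[OF K_sub] subgroup.m_inv_closed[OF K_sub] by auto

lemma twisted_fixed_subgroup: "subgroup (twisted_fixed \<phi> K H) G"
proof (rule subgroupI)
  show "twisted_fixed \<phi> K H \<subseteq> carrier G" unfolding twisted_fixed_def by auto
  have "\<one> \<in> twisted_fixed \<phi> K H"
    unfolding twisted_fixed_def using subgroup.one_closed[OF H_sub] subgroup.one_closed[OF K_sub] by simp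
  then show "twisted_fixed \<phi> K H \<noteq> {}" by blast
next
  fix x assume "x \<in> twisted_fixed \<phi> K H"
  then have x: "x \<in> H" "x \<otimes> inv (\<phi> x) \<in> K" unfolding twisted_fixed_def by auto
  have "inv x \<otimes> inv (\<phi> (inv x)) = inv x \<otimes> inv (x \<otimes> inv (\<phi> x)) \<otimes> x"
    using x(1) by (simp add: word_simps f.hom_inv)
  moreover have "inv x \<otimes> inv (x \<otimes> inv (\<phi> x)) \<otimes> x \<in> K"
    using K_conj(2)[OF x(1)] K_closed(2)[OF x(2)] by blast
  ultimately show "inv x \<in> twisted_fixed \<phi> K H" using x H_closed unfolding twisted_fixed_def by simp
next
  fix x y assume "x \<in> twisted_fixed \<phi> K H" "y \<in> twisted_fixed \<phi> K H"
  then have x: "x \<in> H" "x \<otimes> inv (\<phi> x) \<in> K" and y: "y \<in> H" "y \<otimes> inv (\<phi> y) \<in> K"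
    unfolding twisted_fixed_def by auto
  have "(x \<otimes> y) \<otimes> inv (\<phi> (x \<otimes> y)) = (x \<otimes> (y \<otimes> inv (\<phi> y)) \<otimes> inv x) \<otimes> (x \<otimes> inv (\<phi> x))"
    using x(1) y(1) by (simp add: word_simps)
  moreover have "x \<otimes> (y \<otimes> inv (\<phi> y)) \<otimes> inv x \<in> K" by (rule K_conj(1)[OF x(1) y(2)])
  ultimately show "x \<otimes> y \<in> twisted_fixed \<phi> K H"
    using x y H_closed K_closed unfolding twisted_fixed_def by simp
qed

text \<open>Each twisted class that meets \<open>A\<close> has a representative in \<open>A\<close>, although the conjugating elements
  still range over all of \<open>H\<close>.\<close>

lemma representatives_in_subset:
  assumes fin: "finite_twisted \<phi> K H" and A: "A \<subseteq> H"
  shows "\<exists>S. finite S \<and> S \<subseteq> A \<and> (\<forall>a\<in>A. \<exists>s\<in>S. \<exists>y\<in>H. \<exists>k\<in>K. a = y \<otimes> s \<otimes> inv (\<phi> y) \<otimes> k)"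
proof -
  obtain S where S: "finite S" "S \<subseteq> H" "\<forall>h\<in>H. \<exists>s\<in>S. \<exists>x\<in>H. \<exists>k\<in>K. h = x \<otimes> s \<otimes> inv (\<phi> x) \<otimes> k"
    using fin unfolding finite_twisted_def by blast
  define P where "P s a \<longleftrightarrow> a \<in> A \<and> (\<exists>x\<in>H. \<exists>k\<in>K. a = x \<otimes> s \<otimes> inv (\<phi> x) \<otimes> k)" for s a
  define r where "r s = (SOME a. P s a)" for s
  have r: "P s (r s)" if "P s a" for s a unfolding r_def using that by (rule someI)
  let ?S = "r ` {s\<in>S. \<exists>a. P s a}"
  have "\<exists>s\<in>?S. \<exists>y\<in>H. \<exists>k\<in>K. a = y \<otimes> s \<otimes> inv (\<phi> y) \<otimes> k" if a: "a \<in> A" for a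
  proof -
    have aH: "a \<in> H" using a A by blast
    obtain s x k where s: "s \<in> S" "x \<in> H" "k \<in> K" "a = x \<otimes> s \<otimes> inv (\<phi> x) \<otimes> k" using bspec[OF S(3) aH] by blast
    have Psa: "P s a" unfolding P_def using a s by blast
    obtain z l where z: "z \<in> H" "l \<in> K" "r s = z \<otimes> s \<otimes> inv (\<phi> z) \<otimes> l"
      using r[OF Psa] unfolding P_def by blast
    have sH: "s \<in> H" using s(1) S(2) by blast
    let ?y = "x \<otimes> inv z"
    let ?w = "inv (\<phi> ?y)"
    have y: "?y \<in> H" "?w \<in> H" using s(2) z(1) H_closed H_inv by auto
    have m: "(inv ?w \<otimes> inv l \<otimes> ?w) \<otimes> k \<in> K" using K_conj(2)[OF y(2) K_closed(2)[OF z(2)]] s(3) K_closed(1) by blast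
    have "a = ?y \<otimes> r s \<otimes> ?w \<otimes> ((inv ?w \<otimes> inv l \<otimes> ?w) \<otimes> k)"
      unfolding s(4) z(3) using s(2,3) z(1,2) sH by (simp add: word_simps f.hom_inv)
    then show ?thesis using m y(1) s(1) Psa by blast
  qed
  moreover have "finite ?S" using S(1) by simp
  moreover have "?S \<subseteq> A" using r unfolding P_def by blast
  ultimately show ?thesis by meson
qed

text \<open>Writing \<open>H = MT\<close> with a finite set \<open>T\<close>, the \<open>H\<close>-orbit of \<open>s\<close> is the union of the \<open>M\<close>-orbits of
  the elements \<open>t s \<phi>(t)\<^sup>-\<^sup>1\<close>.  In the proof \<open>t\<close> is the inverse of a representative of a left coset.\<close>

lemma finite_twisted_subgroup:
  assumes fin: "finite_twisted \<phi> K H" and M: "subgroup M G" "K \<subseteq> M" "M \<subseteq> H" "fin_index M H"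
    and M_inv: "\<And>x. x \<in> M \<Longrightarrow> \<phi> x \<in> M"
  shows "finite_twisted \<phi> K M"
proof -
  obtain S where S: "finite S" "S \<subseteq> H" "\<forall>h\<in>H. \<exists>s\<in>S. \<exists>x\<in>H. \<exists>k\<in>K. h = x \<otimes> s \<otimes> inv (\<phi> x) \<otimes> k"
    using fin unfolding finite_twisted_def by blast
  obtain F where F: "finite F" "F \<subseteq> H" "\<forall>h\<in>H. \<exists>f\<in>F. \<exists>m\<in>M. h = f \<otimes> m"
    using M(4) unfolding fin_index_def by blast
  let ?T = "(\<lambda>(f, s). inv f \<otimes> s \<otimes> \<phi> f) ` (F \<times> S) \<inter> M"
  have "\<exists>s\<in>?T. \<exists>x\<in>M. \<exists>k\<in>K. h = x \<otimes> s \<otimes> inv (\<phi> x) \<otimes> k" if h: "h \<in> M" for h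
  proof -
    have hH: "h \<in> H" using h M(3) by blast
    obtain s x k where s: "s \<in> S" "x \<in> H" "k \<in> K" "h = x \<otimes> s \<otimes> inv (\<phi> x) \<otimes> k" using bspec[OF S(3) hH] by blast
    obtain f m where f: "f \<in> F" "m \<in> M" "inv x = f \<otimes> m" using F(3) H_closed(2)[OF s(2)] by blast
    have c: "f \<in> carrier G" "m \<in> carrier G" "s \<in> carrier G" "x \<in> carrier G"
      using f F(2) M(3) s S(2) by auto
    have "x = inv (inv x)" using c by simp
    also have "\<dots> = inv m \<otimes> inv f" unfolding f(3) using c by (simp add: inv_mult_group)
    finally have x: "x = inv m \<otimes> inv f" .
    let ?t = "inv f \<otimes> s \<otimes> \<phi> f"
    have e: "h = inv m \<otimes> ?t \<otimes> inv (\<phi> (inv m)) \<otimes> k"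
      unfolding s(4) x using c s(3) by (simp add: word_simps f.hom_inv)
    have "?t = m \<otimes> h \<otimes> inv k \<otimes> inv (\<phi> m)"
      unfolding e using c s(3) by (simp add: word_simps f.hom_inv)
    moreover have "m \<otimes> h \<otimes> inv k \<otimes> inv (\<phi> m) \<in> M"
      using f(2) h s(3) M(2) M_inv subgroup.m_closed[OF M(1)] subgroup.m_inv_closed[OF M(1)] by auto
    ultimately have "?t \<in> M" by simp
    moreover have "?t \<in> (\<lambda>(f, s). inv f \<otimes> s \<otimes> \<phi> f) ` (F \<times> S)"
      by (rule image_eqI[of _ _ "(f, s)"]) (use f(1) s(1) in auto)
    ultimately have "?t \<in> ?T" by blast
    moreover have "inv m \<in> M" using f(2) subgroup.m_inv_closed[OF M(1)] by blast
    ultimately show ?thesis using e s(3) by blast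
  qed
  moreover have "finite ?T" using F(1) S(1) by simp
  moreover have "?T \<subseteq> M" by blast
  ultimately show ?thesis unfolding finite_twisted_def by meson
qed

text \<open>The map \<open>\<psi> a = a \<phi>(a)\<^sup>-\<^sup>1\<close> is multiplicative up to a commutator, so it is an endomorphism of an
  abelian quotient.\<close>

lemma hom_mod_difference:
  assumes ab: "abelian_mod K H"
  shows "hom_mod K H (\<lambda>x. x \<otimes> inv (\<phi> x))"
proof -
  have "\<exists>k\<in>K. (a \<otimes> b) \<otimes> inv (\<phi> (a \<otimes> b)) = (a \<otimes> inv (\<phi> a)) \<otimes> (b \<otimes> inv (\<phi> b)) \<otimes> k"
    if a: "a \<in> H" and b: "b \<in> H" for a b
  proof -
    let ?p = "inv (\<phi> a)" and ?q = "b \<otimes> inv (\<phi> b)"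
    have p: "?p \<in> H" "?q \<in> H" using a b H_closed H_inv by auto
    have c: "inv ?q \<otimes> inv ?p \<otimes> inv (inv ?q) \<otimes> inv (inv ?p) \<in> K"
      using ab p H_closed(2) unfolding abelian_mod_def by blast
    have "?q \<otimes> ?p \<in> H" using p H_closed by blast
    then have "inv (?q \<otimes> ?p) \<in> H" using H_closed by blast
    have "inv ?p \<in> H" using p H_closed by blast
    then have k: "inv ?q \<otimes> inv ?p \<otimes> ?q \<otimes> ?p \<in> K" using c p by simp
    have "(a \<otimes> b) \<otimes> inv (\<phi> (a \<otimes> b)) = (a \<otimes> ?p) \<otimes> ?q \<otimes> (inv ?q \<otimes> inv ?p \<otimes> ?q \<otimes> ?p)"
      using a b by (simp add: word_simps)
    then show ?thesis using k by blast
  qed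
  then show ?thesis unfolding hom_mod_def using H_closed H_inv K_closed K_inv by auto
qed

end

locale polycyclic_section = polycyclic_series G C n + invariant_section G \<phi> K H
  for G (structure) and C n \<phi> K H
begin

text \<open>An element of \<open>A\<close> is twisted conjugate to one of finitely many elements \<open>s\<close> of \<open>A\<close>, by some
  \<open>y\<close> in \<open>H\<close>.  As both lie in \<open>A\<close>, this \<open>y\<close> is a fixed point modulo \<open>A\<close>.  There are finitely many
  such \<open>y\<close> modulo \<open>A\<close>, and the remaining factor in \<open>A\<close> changes the element by \<open>\<psi>(A)K\<close> only.  So the
  image of \<open>\<psi>\<close> on \<open>A/K\<close> has finite index, and its kernel, the group of fixed points in \<open>A/K\<close>, is
  finite.\<close>

lemma abelian_layer:
  assumes A: "polycyclic_section G C n \<phi> A H" and KA: "K \<subseteq> A" and ab: "abelian_mod K A"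
    and fin: "finite_twisted \<phi> K H" and fixA: "fin_index A (twisted_fixed \<phi> A H)"
  shows "fin_index ((\<lambda>x. x \<otimes> inv (\<phi> x)) ` A <#> K) A"
    and "fin_index K (twisted_fixed \<phi> K H)"
proof -
  interpret A: polycyclic_section G C n \<phi> A H by (rule A)
  interpret KA: polycyclic_section G C n \<phi> K A
    by unfold_locales (use normal_in_restrict[OF normal A.K_sub KA A.KH] A.K_inv K_inv in auto)
  let ?\<psi> = "\<lambda>x. x \<otimes> inv (\<phi> x)"
  let ?T = "twisted_fixed \<phi> A H"
  have hm: "hom_mod K A ?\<psi>" by (rule KA.hom_mod_difference[OF ab])
  obtain S where S: "finite S" "S \<subseteq> A" "\<forall>a\<in>A. \<exists>s\<in>S. \<exists>y\<in>H. \<exists>k\<in>K. a = y \<otimes> s \<otimes> inv (\<phi> y) \<otimes> k"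
    using representatives_in_subset[OF fin A.KH] by blast
  obtain F where F: "finite F" "F \<subseteq> ?T" "\<forall>h\<in>?T. \<exists>f\<in>F. \<exists>a\<in>A. h = f \<otimes> a"
    using fixA unfolding fin_index_def by blast
  let ?E = "(\<lambda>(f, s). inv f \<otimes> s \<otimes> \<phi> f) ` (F \<times> S) \<inter> A"
  have "\<exists>e\<in>?E. \<exists>y\<in>?\<psi> ` A <#> K. a = e \<otimes> y" if a: "a \<in> A" for a
  proof -
    obtain s y k where s: "s \<in> S" "y \<in> H" "k \<in> K" "a = y \<otimes> s \<otimes> inv (\<phi> y) \<otimes> k"
      using bspec[OF S(3) a] by blast
    have sA: "s \<in> A" and kA: "k \<in> A" using s S(2) KA by auto
    have ac: "a \<in> carrier G" "s \<in> carrier G" "y \<in> carrier G" "k \<in> carrier G" using a sA s by auto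
    have "y \<otimes> inv (\<phi> y) = (y \<otimes> inv s \<otimes> inv y) \<otimes> (a \<otimes> inv k)"
      unfolding s(4) using ac by (simp add: word_simps)
    moreover have "y \<otimes> inv s \<otimes> inv y \<in> A" using A.K_conj(1)[OF s(2) A.K_closed(2)[OF sA]] .
    moreover have "a \<otimes> inv k \<in> A" using a kA A.K_closed by blast
    ultimately have yT: "y \<in> ?T" unfolding twisted_fixed_def using s(2) A.K_closed(1) by simp
    then have "inv y \<in> ?T" using subgroup.m_inv_closed[OF A.twisted_fixed_subgroup] by blast
    then obtain f b where f: "f \<in> F" "b \<in> A" "inv y = f \<otimes> b" using F(3) by blast
    have fH: "f \<in> H" using f(1) F(2) unfolding twisted_fixed_def by blast
    have c: "f \<in> carrier G" "b \<in> carrier G" using fH f(2) by auto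
    have "y = inv (inv y)" using ac by simp
    also have "\<dots> = inv b \<otimes> inv f" unfolding f(3) using c by (simp add: inv_mult_group)
    finally have y: "y = inv b \<otimes> inv f" .
    let ?e = "inv f \<otimes> s \<otimes> \<phi> f" and ?b = "inv b"
    have bA: "?b \<in> A" "\<phi> b \<in> A" using f(2) A.K_closed A.K_inv by auto
    have a1: "a = ?b \<otimes> ?e \<otimes> inv (\<phi> ?b) \<otimes> k"
      unfolding s(4) y using c ac by (simp add: word_simps f.hom_inv)
    have "?e = b \<otimes> a \<otimes> inv k \<otimes> inv (\<phi> b)"
      unfolding a1 using c ac by (simp add: word_simps f.hom_inv)
    then have eA: "?e \<in> A" using f(2) a kA bA A.K_closed by simp
    \<comment> \<open>moving \<open>inv b\<close> past the representative costs a commutator, which lies in \<open>K\<close>\<close>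
    let ?c = "inv ?e \<otimes> ?b \<otimes> inv (inv ?e) \<otimes> inv ?b"
    have cK: "?c \<in> K" using ab eA bA(1) A.K_closed(2) unfolding abelian_mod_def by blast
    let ?p = "?\<psi> ?b"
    have pH: "?p \<in> H" using bA A.K_inv A.K_closed A.KH by blast
    have "a = ?e \<otimes> (?p \<otimes> ((inv ?p \<otimes> ?c \<otimes> ?p) \<otimes> k))"
      unfolding a1 using c ac by (simp add: word_simps f.hom_inv)
    moreover have "(inv ?p \<otimes> ?c \<otimes> ?p) \<otimes> k \<in> K" using K_conj(2)[OF pH cK] s(3) K_closed(1) by blast
    then have "?p \<otimes> ((inv ?p \<otimes> ?c \<otimes> ?p) \<otimes> k) \<in> ?\<psi> ` A <#> K" using bA(1) unfolding set_mult_iff by blast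
    moreover have "?e \<in> ?E" using eA f(1) s(1) by auto
    ultimately show ?thesis by blast
  qed
  moreover have "finite ?E" using F(1) S(1) by simp
  moreover have "?E \<subseteq> A" by blast
  ultimately show im: "fin_index (?\<psi> ` A <#> K) A" unfolding fin_index_def by meson
  have ker: "fin_index K {a\<in>A. ?\<psi> a \<in> K}" using finite_cokernel_imp_finite_kernel[OF KA.normal hm im] .
  let ?TK = "twisted_fixed \<phi> K H"
  have T: "?TK \<subseteq> ?T" unfolding twisted_fixed_def using KA by blast
  have TA: "A \<subseteq> ?T" unfolding twisted_fixed_def using A.KH A.K_closed A.K_inv by blast
  have "fin_index (?TK \<inter> A) ?TK"
    using fin_index_inter[OF fixA A.K_sub A.twisted_fixed_subgroup twisted_fixed_subgroup T] .
  moreover have "?TK \<inter> A = {a\<in>A. ?\<psi> a \<in> K}" unfolding twisted_fixed_def using A.KH by blast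
  ultimately have "fin_index {a\<in>A. ?\<psi> a \<in> K} ?TK" by simp
  then show "fin_index K ?TK"
  proof (rule fin_index_trans[OF ker _ twisted_fixed_subgroup])
    show "{a\<in>A. ?\<psi> a \<in> K} \<subseteq> ?TK" unfolding twisted_fixed_def using A.KH by blast
    show "K \<subseteq> {a\<in>A. ?\<psi> a \<in> K}" using KA K_closed K_inv by blast
  qed
qed

text \<open>Derived subgroups are invariant under all endomorphisms, so the last nontrivial term of the
  derived series of \<open>H/K\<close> is an abelian layer to which the preceding lemma applies.\<close>

lemma derived_layer:
  assumes d: "(derived G ^^ Suc d) H \<subseteq> K"
  defines "A \<equiv> (derived G ^^ d) H <#> K"
  shows "polycyclic_section G C n \<phi> A H" "K \<subseteq> A" "abelian_mod K A" "(derived G ^^ d) H \<subseteq> A"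
proof -
  let ?D = "(derived G ^^ d) H"
  have DN: "normal_in ?D H" by (rule commutator_subgroup_normal[OF H_sub])
  note D = normal_inD[OF DN]
  have "\<phi> ` H \<subseteq> H" using H_inv by blast
  then have "\<phi> ` ?D \<subseteq> ?D" using commutator_subgroup_images[OF hom subgroup.subset[OF H_sub]] by blast
  then have "\<phi> x \<in> A" if "x \<in> A" for x
    using that K_inv subgroup.mem_carrier[OF D(1)] unfolding A_def set_mult_iff by fastforce
  moreover have "normal_in A H" unfolding A_def by (rule normal_in_set_mult[OF normal DN])
  ultimately show "polycyclic_section G C n \<phi> A H"
    by unfold_locales (use H_inv hom in auto)
  show "K \<subseteq> A" "?D \<subseteq> A" using set_mult_normal[OF normal D(1,3)] unfolding A_def by auto
  have "abelian_mod K ?D" unfolding abelian_mod_def using commutator_in_derived d by auto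
  then show "abelian_mod K A" unfolding A_def by (rule abelian_mod_set_mult[OF normal D(3)])
qed

end

context polycyclic_series
begin

text \<open>Induction on the derived length: the fixed points modulo \<open>A\<close> are finite in number by induction
  hypothesis, and those in \<open>A/K\<close> by \<open>abelian_layer\<close>.\<close>

lemma finite_twisted_imp_finite_fixed:
  assumes "polycyclic_section G C n \<phi> K H" "(derived G ^^ d) H \<subseteq> K" "finite_twisted \<phi> K H"
  shows "fin_index K (twisted_fixed \<phi> K H)"
  using assms
proof (induction d arbitrary: K)
  case 0
  interpret polycyclic_section G C n \<phi> K H by (rule 0)
  have "K = H" using 0 KH by simp
  then have "twisted_fixed \<phi> K H = K"
    unfolding twisted_fixed_def using K_closed K_inv by auto
  then show ?case using fin_index_refl[OF K_sub] by simp
next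
  case (Suc d)
  interpret polycyclic_section G C n \<phi> K H by (rule Suc.prems)
  note A = derived_layer[OF Suc.prems(2)]
  show ?case
    using abelian_layer(2)[OF A(1-3) Suc.prems(3)] Suc.IH[OF A(1,4) finite_twisted_mono[OF Suc.prems(3) A(2)]]
    by blast
qed

text \<open>With \<open>A/K\<close> the last nontrivial derived subgroup of \<open>H/K\<close>, the subgroup \<open>\<psi>(A)K\<close> has finite index
  in \<open>A\<close>, so it contains the subgroup \<open>K'\<close> generated by \<open>K\<close> and all \<open>e\<close>-th powers of \<open>A\<close> for a
  suitable \<open>e\<close>.  Being residually finite, \<open>H/K'\<close> has a subgroup \<open>M/K'\<close> of finite index that meets the
  finite group \<open>A/K'\<close> trivially; it embeds into \<open>H/A\<close>, so it has smaller derived length and the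
  induction hypothesis gives \<open>N\<close> for it.  An element \<open>x \<phi>(x)\<^sup>-\<^sup>1 k'\<close> of \<open>N\<close>, with \<open>k'\<close> in \<open>K'\<close>, is of the
  same form for \<open>K\<close>, because a conjugate of \<open>k'\<close> can be written as \<open>b \<phi>(b)\<^sup>-\<^sup>1\<close> modulo \<open>K\<close> and \<open>b\<close> be
  absorbed into \<open>x\<close>.\<close>

lemma finite_twisted_imp_open_class:
  assumes "polycyclic_section G C n \<phi> K H" "(derived G ^^ d) H \<subseteq> K" "finite_twisted \<phi> K H"
  shows "\<exists>N. subgroup N G \<and> N \<subseteq> H \<and> fin_index N H \<and> (\<forall>y\<in>N. \<exists>x\<in>H. \<exists>k\<in>K. y = x \<otimes> inv (\<phi> x) \<otimes> k)"
  using assms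
proof (induction d arbitrary: K H)
  case 0
  interpret polycyclic_section G C n \<phi> K H by (rule 0)
  have "K = H" using 0 KH by simp
  then have "\<exists>x\<in>H. \<exists>k\<in>K. y = x \<otimes> inv (\<phi> x) \<otimes> k" if "y \<in> H" for y
    using that subgroup.one_closed[OF H_sub] by (intro bexI[of _ \<one>] bexI[of _ y]) auto
  then show ?case using H_sub fin_index_refl by blast
next
  case (Suc d)
  interpret polycyclic_section G C n \<phi> K H by (rule Suc.prems)
  define A where "A = (derived G ^^ d) H <#> K"
  note A = derived_layer[OF Suc.prems(2), folded A_def]
  interpret A: polycyclic_section G C n \<phi> A H by (rule A(1))
  let ?\<psi> = "\<lambda>x. x \<otimes> inv (\<phi> x)"
  have KA: "normal_in K A" by (rule normal_in_restrict[OF normal A.K_sub A(2) A.KH])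
  have AA: "normal_in A A" unfolding normal_in_def using A.K_sub A.K_closed by auto
  interpret KA: polycyclic_section G C n \<phi> K A
    by unfold_locales (use KA A.K_inv K_inv in auto)
  have "fin_index A (twisted_fixed \<phi> A H)"
    using finite_twisted_imp_finite_fixed[OF A(1,4) finite_twisted_mono[OF Suc.prems(3) A(2)]] .
  then have im: "fin_index (?\<psi> ` A <#> K) A" by (rule abelian_layer(1)[OF A(1-3) Suc.prems(3)])
  note I = hom_mod_image[OF KA KA.hom_mod_difference[OF A(3)]]
  obtain e :: nat where e: "e > 0" "\<And>x. x \<in> A \<Longrightarrow> x [^] e \<in> ?\<psi> ` A <#> K"
    using fin_index_imp_exponent[OF im I(1) A.K_sub I(2)] by blast
  define K' where "K' = power_subgroup K A e"
  note P = power_subgroup_props[OF K_sub A.K_sub, where m = e, folded K'_def]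
  have K'I: "K' \<subseteq> ?\<psi> ` A <#> K" by (rule P(4)[OF I(1,3) e(2)])
  have K'A: "K' \<subseteq> A" using K'I I(2) by blast
  have K'H: "normal_in K' H" unfolding K'_def by (rule power_subgroup_normal[OF normal A.normal])
  have K'inv: "\<phi> x \<in> K'" if "x \<in> K'" for x
    using power_subgroup_hom[OF hom K_sub A.K_sub, of e] that K_inv A.K_inv unfolding K'_def by blast
  have K'fin: "fin_index K' A"
    using finite_exponent_imp_fin_index[OF normal_in_restrict[OF K'H A.K_sub K'A A.KH] e(1) P(3)] .
  obtain m where m: "m > 0" "power_subgroup K' H m \<inter> A = K'"
    using separate_finite_extension[OF K'H A.K_sub K'A A.KH K'fin] by blast
  define M where "M = power_subgroup K' H m"
  have HH: "normal_in H H" unfolding normal_in_def using H_sub H_closed by auto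
  have MH: "normal_in M H" unfolding M_def by (rule power_subgroup_normal[OF K'H HH])
  note mm = normal_inD[OF MH]
  note Q = power_subgroup_props[OF P(1) H_sub, where m = m, folded M_def]
  have Minv: "\<phi> x \<in> M" if "x \<in> M" for x
    using power_subgroup_hom[OF hom P(1) H_sub, of m] that K'inv H_inv unfolding M_def by blast
  have Mfin: "fin_index M H" using finite_exponent_imp_fin_index[OF MH m(1) Q(3)] .
  have K'M: "normal_in K' M" by (rule normal_in_restrict[OF K'H mm(1) Q(2) mm(3)])
  have MK': "polycyclic_section G C n \<phi> K' M"
    by unfold_locales (use hom K'M K'inv Minv in auto)
  have "(derived G ^^ d) M \<subseteq> M" by (rule normal_inD(3)[OF commutator_subgroup_normal[OF mm(1)]])
  moreover have "(derived G ^^ d) M \<subseteq> A" using mono_exp_of_derived[OF mm(3), of d] A(4) by blast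
  ultimately have dM: "(derived G ^^ d) M \<subseteq> K'" using m(2) unfolding M_def by blast
  have KM: "K \<subseteq> M" using P(2) Q(2) by blast
  have "finite_twisted \<phi> K' M"
    using finite_twisted_mono[OF finite_twisted_subgroup[OF Suc.prems(3) mm(1) KM mm(3) Mfin Minv] P(2)] .
  then obtain N where N: "subgroup N G" "N \<subseteq> M" "fin_index N M"
    "\<forall>y\<in>N. \<exists>x\<in>M. \<exists>k\<in>K'. y = x \<otimes> inv (\<phi> x) \<otimes> k"
    using Suc.IH[OF MK' dM] by blast
  have "\<exists>x\<in>H. \<exists>k\<in>K. y = x \<otimes> inv (\<phi> x) \<otimes> k" if y: "y \<in> N" for y
  proof -
    obtain x k' where x: "x \<in> M" "k' \<in> K'" "y = x \<otimes> inv (\<phi> x) \<otimes> k'" using N(4) y by blast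
    have xH: "x \<in> H" "\<phi> x \<in> H" using x(1) mm(3) H_inv by auto
    have "inv (\<phi> x) \<otimes> k' \<otimes> \<phi> x \<in> K'" using normal_inD(5)[OF K'H xH(2) x(2)] .
    then obtain b k where b: "b \<in> A" "k \<in> K" "inv (\<phi> x) \<otimes> k' \<otimes> \<phi> x = b \<otimes> inv (\<phi> b) \<otimes> k"
      using subsetD[OF K'I] unfolding set_mult_iff by blast
    have bH: "b \<in> H" using b(1) A.KH by blast
    have k'c: "k' \<in> carrier G" using x(2) K'A by auto
    have "y = x \<otimes> (inv (\<phi> x) \<otimes> k' \<otimes> \<phi> x) \<otimes> inv (\<phi> x)"
      unfolding x(3) using xH k'c by (simp add: word_simps)
    also have "\<dots> = (x \<otimes> b) \<otimes> inv (\<phi> (x \<otimes> b)) \<otimes> (\<phi> x \<otimes> k \<otimes> inv (\<phi> x))"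
      unfolding b(3) using xH bH b(2) by (simp add: word_simps)
    finally show ?thesis using K_conj(1)[OF xH(2) b(2)] H_closed(1)[OF xH(1) bH] by blast
  qed
  moreover have "fin_index N H" by (rule fin_index_trans[OF N(3) Mfin H_sub mm(3) N(2)])
  ultimately show ?case using N(1,2) mm(3) by blast
qed

end

section \<open>Reidemeister classes of polycyclic groups\<close>

lemma (in group) polycyclic_imp_series:
  assumes "polycyclic G"
  obtains C n where "polycyclic_series G C n"
proof -
  obtain n H where H: "H 0 = {\<one>}" "H n = carrier G" "\<And>i. i \<le> n \<Longrightarrow> subgroup (H i) G"
    "\<And>i. i < n \<Longrightarrow> H i \<lhd> (G \<lparr>carrier := H (Suc i)\<rparr>)"
    "\<And>i. i < n \<Longrightarrow> cyclic_group ((G \<lparr>carrier := H (Suc i)\<rparr>) Mod H i)"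
    using assms unfolding polycyclic_def by blast
  have "polycyclic_series G H n"
  proof unfold_locales
    show "H 0 = {\<one>}" "H n = carrier G" by (rule H(1), rule H(2))
    fix i assume i: "i < n"
    let ?L = "G \<lparr>carrier := H (Suc i)\<rparr>"
    have S: "subgroup (H i) G" "subgroup (H (Suc i)) G" using H(3) i by auto
    interpret N: normal "H i" ?L by (rule H(4)[OF i])
    have sub: "H i \<subseteq> H (Suc i)" using N.subset by simp
    show nor: "normal_in (H i) (H (Suc i))"
      unfolding normal_in_def
    proof (intro conjI ballI)
      fix h k assume "h \<in> H (Suc i)" "k \<in> H i"
      then show "h \<otimes> k \<otimes> inv h \<in> H i"
        using N.inv_op_closed2[of h k] m_inv_consistent[OF S(2)] by simp
    qed (use S sub in auto)
    interpret Q: group "?L Mod H i" by (rule N.factorgroup_is_group)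
    obtain Y where Y: "Y \<in> carrier (?L Mod H i)"
      "carrier (?L Mod H i) = range (\<lambda>k::int. Y [^]\<^bsub>?L Mod H i\<^esub> k)"
      using H(5)[OF i] Q.cyclic_group by auto
    obtain t where t: "t \<in> H (Suc i)" "Y = H i #>\<^bsub>?L\<^esub> t"
      using Y(1) unfolding carrier_FactGroup by auto
    have "\<exists>k::int. \<exists>c\<in>H i. x = t [^] k \<otimes> c" if x: "x \<in> H (Suc i)" for x
    proof -
      have "H i #>\<^bsub>?L\<^esub> x \<in> carrier (?L Mod H i)" using x unfolding carrier_FactGroup by auto
      then obtain k :: int where "H i #>\<^bsub>?L\<^esub> x = Y [^]\<^bsub>?L Mod H i\<^esub> k" using Y(2) by auto
      also have "\<dots> = H i #>\<^bsub>?L\<^esub> (t [^]\<^bsub>?L\<^esub> k)"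
        unfolding t(2) by (rule N.FactGroup_int_pow) (use t(1) in simp)
      also have "t [^]\<^bsub>?L\<^esub> k = t [^] k" using int_pow_consistent[OF S(2) t(1)] by simp
      finally have e: "H i #>\<^bsub>?L\<^esub> x = H i #>\<^bsub>?L\<^esub> (t [^] k)" .
      have "x = \<one> \<otimes> x" using x subgroup.mem_carrier[OF S(2)] by simp
      then have "x \<in> H i #>\<^bsub>?L\<^esub> x" using subgroup.one_closed[OF S(1)] unfolding r_coset_def by force
      then have "x \<in> H i #>\<^bsub>?L\<^esub> (t [^] k)" using e by blast
      then obtain c where c: "c \<in> H i" "x = c \<otimes> t [^] k" unfolding r_coset_def by auto
      let ?s = "t [^] k"
      have s: "?s \<in> H (Suc i)" by (rule pow_mem(1)[OF S(2) t(1)])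
      have "x = ?s \<otimes> (inv ?s \<otimes> c \<otimes> ?s)"
        using c subgroup.mem_carrier[OF S(1)] subgroup.mem_carrier[OF S(2) s] by (simp add: word_simps)
      then show ?thesis using normal_inD(5)[OF nor s c(1)] by blast
    qed
    then show "\<exists>t\<in>H (Suc i). \<forall>x\<in>H (Suc i). \<exists>k::int. \<exists>c\<in>H i. x = t [^] k \<otimes> c" using t(1) by blast
  qed
  then show ?thesis using that by blast
qed

context polycyclic_series
begin

text \<open>Modulo \<open>C i\<close> two elements of \<open>C (Suc i)\<close> are powers of the same element and commute.\<close>

lemma derived_cyclic_step:
  assumes i: "i < n"
  shows "derived G (C (Suc i)) \<subseteq> C i"
proof -
  note N = C_normal[OF i] note nn = normal_inD[OF N]
  obtain t where t: "t \<in> C (Suc i)" "\<forall>x\<in>C (Suc i). \<exists>k::int. \<exists>c\<in>C i. x = t [^] k \<otimes> c"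
    using C_cyclic[OF i] by blast
  have tc: "t \<in> carrier G" using t(1) subgroup.mem_carrier[OF nn(2)] by auto
  have "a \<otimes> b \<otimes> inv a \<otimes> inv b \<in> C i" if a: "a \<in> C (Suc i)" and b: "b \<in> C (Suc i)" for a b
  proof -
    obtain k :: int and c where c: "c \<in> C i" "a = t [^] k \<otimes> c" using t(2) a by blast
    obtain l :: int and d where d: "d \<in> C i" "b = t [^] l \<otimes> d" using t(2) b by blast
    let ?p = "t [^] k" and ?q = "t [^] l"
    have p: "?p \<in> C (Suc i)" "?q \<in> C (Suc i)" using pow_mem(1)[OF nn(2) t(1)] by auto
    have cc: "c \<in> carrier G" "d \<in> carrier G" using c d subgroup.mem_carrier[OF nn(1)] by auto
    have pq: "?p \<otimes> ?q = ?q \<otimes> ?p" using tc by (simp add: int_pow_mult[symmetric] add.commute)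
    let ?u = "(inv ?q \<otimes> c \<otimes> ?q) \<otimes> d" and ?v = "(inv ?p \<otimes> d \<otimes> ?p) \<otimes> c"
    have "?u \<in> C i" "?v \<in> C i"
      using nn(5)[OF p(2) c(1)] nn(5)[OF p(1) d(1)] c(1) d(1) subgroup.m_closed[OF nn(1)] by blast+
    then have uv: "?u \<otimes> inv ?v \<in> C i"
      using subgroup.m_closed[OF nn(1)] subgroup.m_inv_closed[OF nn(1)] by blast
    have ab: "a \<otimes> b = (?p \<otimes> ?q) \<otimes> ?u" unfolding c(2) d(2) using cc tc by (simp add: word_simps)
    have ba: "b \<otimes> a = (?p \<otimes> ?q) \<otimes> ?v" unfolding pq unfolding c(2) d(2) using cc tc by (simp add: word_simps)
    have "a \<in> carrier G" "b \<in> carrier G" using a b subgroup.mem_carrier[OF nn(2)] by auto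
    then have "a \<otimes> b \<otimes> inv a \<otimes> inv b = (a \<otimes> b) \<otimes> inv (b \<otimes> a)" by (simp add: word_simps)
    also have "\<dots> = (?p \<otimes> ?q) \<otimes> (?u \<otimes> inv ?v) \<otimes> inv (?p \<otimes> ?q)"
      unfolding ab ba using cc tc by (simp add: word_simps)
    also have "\<dots> \<in> C i" using nn(4)[OF _ uv] p subgroup.m_closed[OF nn(2)] by blast
    finally show ?thesis .
  qed
  then show ?thesis unfolding derived_def by (intro generate_subgroup_incl[OF _ nn(1)]) auto
qed

lemma derived_series_trivial: "(derived G ^^ n) (carrier G) \<subseteq> {\<one>}"
proof -
  have "i \<le> n \<Longrightarrow> (derived G ^^ i) (carrier G) \<subseteq> C (n - i)" for i
  proof (induction i)
    case 0
    then show ?case using C_top by simp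
  next
    case (Suc i)
    then have "derived G ((derived G ^^ i) (carrier G)) \<subseteq> derived G (C (Suc (n - Suc i)))"
      using mono_derived by (simp add: Suc_diff_Suc)
    also have "\<dots> \<subseteq> C (n - Suc i)" by (rule derived_cyclic_step) (use Suc.prems in simp)
    finally show ?case by simp
  qed
  then show ?thesis using C_bot by force
qed

text \<open>The twisted class of \<open>g\<close> is the translate by \<open>g\<close> of the class of \<open>\<one>\<close> for the endomorphism
  \<open>x \<mapsto> g \<phi>(x) g\<^sup>-\<^sup>1\<close>, so that the result on the class of \<open>\<one>\<close> applies to all classes; as there are
  finitely many, the powers with one common exponent generate a subgroup that serves them all.\<close>

theorem finite_twisted_imp_open_classes:
  assumes \<phi>: "\<phi> \<in> hom G G" and fin: "finite_twisted \<phi> {\<one>} (carrier G)"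
  obtains V where "normal_in V (carrier G)" "fin_index V (carrier G)"
    "\<And>g v. g \<in> carrier G \<Longrightarrow> v \<in> V \<Longrightarrow> \<exists>x\<in>carrier G. g \<otimes> v = x \<otimes> g \<otimes> inv (\<phi> x)"
proof -
  interpret f: group_hom G G \<phi> using \<phi> by (simp add: group_hom_def group_hom_axioms_def is_group)
  have one: "normal_in {\<one>} (carrier G)" unfolding normal_in_def using triv_subgroup subgroup_self by auto
  have GG: "normal_in (carrier G) (carrier G)" unfolding normal_in_def using subgroup_self by auto
  obtain S where S: "finite S" "S \<subseteq> carrier G"
    "\<forall>h\<in>carrier G. \<exists>s\<in>S. \<exists>x\<in>carrier G. \<exists>k\<in>{\<one>}. h = x \<otimes> s \<otimes> inv (\<phi> x) \<otimes> k"
    using fin unfolding finite_twisted_def by blast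
  have S3: "\<exists>s\<in>S. \<exists>x\<in>carrier G. h = x \<otimes> s \<otimes> inv (\<phi> x)" if "h \<in> carrier G" for h
  proof -
    obtain s x where "s \<in> S" "x \<in> carrier G" "h = x \<otimes> s \<otimes> inv (\<phi> x) \<otimes> \<one>" using S(3) \<open>h \<in> carrier G\<close> by blast
    then show ?thesis using S(2) by (intro bexI[of _ s] bexI[of _ x]) auto
  qed
  have "\<exists>m::nat. m > 0 \<and> (\<exists>N. subgroup N G \<and> (\<forall>x\<in>carrier G. x [^] m \<in> N) \<and>
      (\<forall>y\<in>N. \<exists>x\<in>carrier G. y = x \<otimes> inv (s \<otimes> \<phi> x \<otimes> inv s)))" if s: "s \<in> S" for s
  proof -
    have sc: "s \<in> carrier G" using s S(2) by blast
    let ?\<phi> = "\<lambda>x. s \<otimes> \<phi> x \<otimes> inv s"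
    have h: "?\<phi> \<in> hom G G" using sc unfolding hom_def by (auto simp: word_simps)
    interpret s: polycyclic_section G C n ?\<phi> "{\<one>}" "carrier G"
      by unfold_locales (use h one sc in auto)
    have "\<exists>t\<in>(\<lambda>t. t \<otimes> inv s) ` S. \<exists>x\<in>carrier G. \<exists>k\<in>{\<one>}. h = x \<otimes> t \<otimes> inv (?\<phi> x) \<otimes> k"
      if h: "h \<in> carrier G" for h
    proof -
      obtain t x where t: "t \<in> S" "x \<in> carrier G" "h \<otimes> s = x \<otimes> t \<otimes> inv (\<phi> x)"
        using S3[of "h \<otimes> s"] h sc by auto
      have tc: "t \<in> carrier G" using t(1) S(2) by blast
      have "h = (h \<otimes> s) \<otimes> inv s" using h sc by (simp add: word_simps)
      also have "\<dots> = x \<otimes> (t \<otimes> inv s) \<otimes> inv (?\<phi> x) \<otimes> \<one>"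
        unfolding t(3) using t(2) tc sc by (simp add: word_simps)
      finally show ?thesis using t(1,2) by blast
    qed
    then have "finite_twisted ?\<phi> {\<one>} (carrier G)"
      unfolding finite_twisted_def
    proof (intro exI[of _ "(\<lambda>t. t \<otimes> inv s) ` S"] conjI ballI)
      show "finite ((\<lambda>t. t \<otimes> inv s) ` S)" using S(1) by simp
      show "(\<lambda>t. t \<otimes> inv s) ` S \<subseteq> carrier G" using S(2) sc by blast
    qed
    then obtain N where N: "subgroup N G" "N \<subseteq> carrier G" "fin_index N (carrier G)"
      "\<forall>y\<in>N. \<exists>x\<in>carrier G. \<exists>k\<in>{\<one>}. y = x \<otimes> inv (?\<phi> x) \<otimes> k"
      using finite_twisted_imp_open_class[OF s.polycyclic_section_axioms derived_series_trivial] by blast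
    have "\<exists>x\<in>carrier G. y = x \<otimes> inv (?\<phi> x)" if y: "y \<in> N" for y
    proof -
      obtain x where x: "x \<in> carrier G" "y = x \<otimes> inv (?\<phi> x) \<otimes> \<one>" using N(4) y by blast
      then show ?thesis using sc by (intro bexI[of _ x]) auto
    qed
    then show ?thesis using fin_index_imp_exponent[OF N(3,1) subgroup_self N(2)] N(1) by metis
  qed
  then obtain m N where mN: "\<And>s. s \<in> S \<Longrightarrow> (m s :: nat) > 0" "\<And>s. s \<in> S \<Longrightarrow> subgroup (N s) G"
    "\<And>s x. s \<in> S \<Longrightarrow> x \<in> carrier G \<Longrightarrow> x [^] m s \<in> N s"
    "\<And>s y. s \<in> S \<Longrightarrow> y \<in> N s \<Longrightarrow> \<exists>x\<in>carrier G. y = x \<otimes> inv (s \<otimes> \<phi> x \<otimes> inv s)"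
    by metis
  define e where "e = (\<Prod>s\<in>S. m s)"
  have e0: "e > 0" unfolding e_def by (rule prod_pos) (rule mN(1))
  define V where "V = power_subgroup {\<one>} (carrier G) e"
  note P = power_subgroup_props[OF triv_subgroup subgroup_self, where m = e, folded V_def]
  have V: "normal_in V (carrier G)" unfolding V_def by (rule power_subgroup_normal[OF one GG])
  note v = normal_inD[OF V]
  have Vfin: "fin_index V (carrier G)" by (rule finite_exponent_imp_fin_index[OF V e0 P(3)])
  have VN: "V \<subseteq> N s" if s: "s \<in> S" for s
  proof (rule P(4)[OF mN(2)[OF s]])
    show "{\<one>} \<subseteq> N s" using subgroup.one_closed[OF mN(2)[OF s]] by simp
    fix x assume x: "x \<in> carrier G"
    obtain q where q: "e = m s * q" unfolding e_def using s S(1) by (metis dvdE dvd_prodI)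
    show "x [^] e \<in> N s"
      using pow_mem(2)[OF mN(2)[OF s] mN(3)[OF s x], of q] x unfolding q by (simp add: nat_pow_pow)
  qed
  have "\<exists>x\<in>carrier G. g \<otimes> w = x \<otimes> g \<otimes> inv (\<phi> x)" if g: "g \<in> carrier G" and w: "w \<in> V" for g w
  proof -
    obtain s x where s: "s \<in> S" "x \<in> carrier G" "g = x \<otimes> s \<otimes> inv (\<phi> x)" using S3[OF g] by blast
    have sc: "s \<in> carrier G" using s(1) S(2) by blast
    have wc: "w \<in> carrier G" using w subgroup.mem_carrier[OF v(1)] by blast
    have "inv (\<phi> x) \<otimes> w \<otimes> \<phi> x \<in> V" using v(5)[OF _ w] s(2) by simp
    then have "s \<otimes> (inv (\<phi> x) \<otimes> w \<otimes> \<phi> x) \<otimes> inv s \<in> N s" using v(4)[OF sc] VN[OF s(1)] by blast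
    then obtain y where y: "y \<in> carrier G"
      "s \<otimes> (inv (\<phi> x) \<otimes> w \<otimes> \<phi> x) \<otimes> inv s = y \<otimes> inv (s \<otimes> \<phi> y \<otimes> inv s)" using mN(4)[OF s(1)] by blast
    let ?z = "x \<otimes> y \<otimes> inv x"
    have "g \<otimes> w = x \<otimes> (s \<otimes> (inv (\<phi> x) \<otimes> w \<otimes> \<phi> x) \<otimes> inv s) \<otimes> s \<otimes> inv (\<phi> x)"
      unfolding s(3) using s(2) sc wc by (simp add: word_simps)
    also have "\<dots> = ?z \<otimes> g \<otimes> inv (\<phi> ?z)"
      unfolding y(2) s(3) using s(2) sc y(1) by (simp add: word_simps f.hom_inv)
    finally show ?thesis using y(1) s(2) by (intro bexI[of _ ?z]) auto
  qed
  then show ?thesis using that V Vfin by blast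
qed

end

section \<open>Adjoints and traces\<close>

abbreviation adj :: "complex mat \<Rightarrow> complex mat" where "adj \<equiv> mat_adjoint"

lemma adj_dim [simp]: "dim_row (adj A) = dim_col A" "dim_col (adj A) = dim_row A"
  unfolding mat_adjoint_def by auto

lemma adj_index [simp]: "i < dim_col A \<Longrightarrow> j < dim_row A \<Longrightarrow> adj A $$ (i, j) = cnj (A $$ (j, i))"
  unfolding mat_adjoint_def by (simp add: mat_of_rows_def)

lemma adj_carrier [simp]: "A \<in> carrier_mat m n \<Longrightarrow> adj A \<in> carrier_mat n m"
  by auto

lemma adj_adj [simp]: "adj (adj A) = A"
  by (rule eq_matI) auto

lemma adj_smult: "adj (c \<cdot>\<^sub>m A) = cnj c \<cdot>\<^sub>m adj A"
  by (rule eq_matI) auto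

lemma mat_mult_index:
  "A \<in> carrier_mat m n \<Longrightarrow> B \<in> carrier_mat n p \<Longrightarrow> i < m \<Longrightarrow> j < p \<Longrightarrow>
    (A * B) $$ (i, j) = (\<Sum>k<n. A $$ (i, k) * B $$ (k, j))"
  by (auto simp: scalar_prod_def atLeast0LessThan intro!: sum.cong)

lemma adj_mult:
  assumes "A \<in> carrier_mat m n" "B \<in> carrier_mat n p"
  shows "adj (A * B) = adj B * adj A"
proof (rule eq_matI)
  fix i j assume "i < dim_row (adj B * adj A)" "j < dim_col (adj B * adj A)"
  then have ij: "i < p" "j < m" using assms by auto
  have "adj (A * B) $$ (i, j) = cnj ((A * B) $$ (j, i))" using assms ij by (intro adj_index) auto
  also have "\<dots> = (\<Sum>k<n. cnj (A $$ (j, k)) * cnj (B $$ (k, i)))"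
    using mat_mult_index[OF assms ij(2,1)] by (simp add: cnj_sum)
  also have "\<dots> = (adj B * adj A) $$ (i, j)"
    using mat_mult_index[of "adj B" p n "adj A" m i j] assms ij by (simp add: mult.commute)
  finally show "adj (A * B) $$ (i, j) = (adj B * adj A) $$ (i, j)" .
qed (use assms in auto)

definition trace :: "complex mat \<Rightarrow> complex" where
  "trace A = (\<Sum>i<dim_row A. A $$ (i, i))"

lemma trace_mult:
  assumes "A \<in> carrier_mat m n" "B \<in> carrier_mat n m"
  shows "trace (A * B) = (\<Sum>i<m. \<Sum>k<n. A $$ (i, k) * B $$ (k, i))"
proof -
  have "dim_row (A * B) = m" using assms by simp
  then show ?thesis unfolding trace_def using mat_mult_index[OF assms] by simp
qed

lemma trace_mult_commute:
  assumes "A \<in> carrier_mat m n" "B \<in> carrier_mat n m"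
  shows "trace (A * B) = trace (B * A)"
  unfolding trace_mult[OF assms] trace_mult[OF assms(2,1)]
  by (subst sum.swap) (simp add: mult.commute)

lemma trace_one [simp]: "trace (1\<^sub>m n) = of_nat n"
  unfolding trace_def by simp

lemma trace_smult: "A \<in> carrier_mat n n \<Longrightarrow> trace (c \<cdot>\<^sub>m A) = c * trace A"
  unfolding trace_def by (auto simp: sum_distrib_left)

lemma trace_add: "A \<in> carrier_mat n n \<Longrightarrow> B \<in> carrier_mat n n \<Longrightarrow> trace (A + B) = trace A + trace B"
  unfolding trace_def by (auto simp: sum.distrib)

lemma trace_minus: "A \<in> carrier_mat n n \<Longrightarrow> B \<in> carrier_mat n n \<Longrightarrow> trace (A - B) = trace A - trace B"
  unfolding trace_def by (auto simp: sum_subtractf)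

lemma trace_adj_mult:
  assumes "A \<in> carrier_mat m n"
  shows "trace (adj A * A) = of_real (\<Sum>i<n. \<Sum>k<m. (cmod (A $$ (k, i)))\<^sup>2)"
proof -
  have "trace (adj A * A) = (\<Sum>i<n. \<Sum>k<m. adj A $$ (i, k) * A $$ (k, i))"
    by (rule trace_mult) (use assms in auto)
  also have "\<dots> = (\<Sum>i<n. \<Sum>k<m. of_real ((cmod (A $$ (k, i)))\<^sup>2))"
    using assms by (intro sum.cong refl) (auto simp: complex_norm_square[symmetric] mult.commute)
  finally show ?thesis by simp
qed

lemma trace_adj_mult_nonzero:
  assumes "A \<in> carrier_mat m n" "A \<noteq> 0\<^sub>m m n"
  obtains r where "r > 0" "trace (adj A * A) = of_real r"
proof -
  let ?r = "\<Sum>i<n. \<Sum>k<m. (cmod (A $$ (k, i)))\<^sup>2"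
  have "\<exists>i<m. \<exists>j<n. A $$ (i, j) \<noteq> 0"
  proof (rule ccontr)
    assume "\<not> ?thesis"
    then have "A = 0\<^sub>m m n" using assms(1) by (intro eq_matI) auto
    then show False using assms(2) by simp
  qed
  then obtain i j where ij: "i < m" "j < n" "A $$ (i, j) \<noteq> 0" by blast
  have "0 < (cmod (A $$ (i, j)))\<^sup>2" using ij by simp
  also have "\<dots> \<le> (\<Sum>k<m. (cmod (A $$ (k, j)))\<^sup>2)" using ij by (intro member_le_sum) auto
  also have "\<dots> \<le> ?r"
    using ij by (intro member_le_sum[of j "{..<n}" "\<lambda>i. \<Sum>k<m. (cmod (A $$ (k, i)))\<^sup>2"]) (auto intro: sum_nonneg)
  finally show ?thesis using that[of ?r] trace_adj_mult[OF assms(1)] by blast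
qed

lemma mult_unit_vec:
  assumes "A \<in> carrier_mat m (n :: nat)" "j < n"
  shows "A *\<^sub>v unit_vec n j = col (A :: complex mat) j"
  using assms by (intro eq_vecI) auto

lemma mat_eq_via_vec:
  fixes A B :: "complex mat"
  assumes "A \<in> carrier_mat m n" "B \<in> carrier_mat m n"
    and "\<And>v. v \<in> carrier_vec n \<Longrightarrow> A *\<^sub>v v = B *\<^sub>v v"
  shows "A = B"
proof (rule mat_col_eqI)
  fix i assume "i < dim_col B"
  then have i: "i < n" using assms(2) by simp
  show "col A i = col B i"
    using assms(3)[of "unit_vec n i"] mult_unit_vec[OF assms(1) i] mult_unit_vec[OF assms(2) i] by simp
qed (use assms in auto)

section \<open>Schur's lemma for unitary representations\<close>

lemma unitary_repD:
  assumes "unitary_rep G n \<rho>"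
  shows "\<And>g. g \<in> carrier G \<Longrightarrow> \<rho> g \<in> carrier_mat n n"
    "\<And>g. g \<in> carrier G \<Longrightarrow> \<rho> g * adj (\<rho> g) = 1\<^sub>m n"
    "\<And>g. g \<in> carrier G \<Longrightarrow> adj (\<rho> g) * \<rho> g = 1\<^sub>m n"
    "\<And>g h. g \<in> carrier G \<Longrightarrow> h \<in> carrier G \<Longrightarrow> \<rho> (g \<otimes>\<^bsub>G\<^esub> h) = \<rho> g * \<rho> h"
  using assms unfolding unitary_rep_def hom_def unitary_group_def by (auto simp: Pi_iff)

lemma unitary_repI:
  assumes "\<And>g. g \<in> carrier G \<Longrightarrow> \<rho> g \<in> carrier_mat n n"
    "\<And>g. g \<in> carrier G \<Longrightarrow> \<rho> g * adj (\<rho> g) = 1\<^sub>m n"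
    "\<And>g. g \<in> carrier G \<Longrightarrow> adj (\<rho> g) * \<rho> g = 1\<^sub>m n"
    "\<And>g h. g \<in> carrier G \<Longrightarrow> h \<in> carrier G \<Longrightarrow> \<rho> (g \<otimes>\<^bsub>G\<^esub> h) = \<rho> g * \<rho> h"
  shows "unitary_rep G n \<rho>"
  using assms unfolding unitary_rep_def hom_def unitary_group_def by (auto simp: Pi_iff)

lemma (in group) unitary_rep_one:
  assumes "unitary_rep G n \<rho>" shows "\<rho> \<one> = 1\<^sub>m n"
proof -
  note r = unitary_repD[OF assms]
  have "\<rho> \<one> * \<rho> \<one> = \<rho> \<one>" using r(4)[of \<one> \<one>] by simp
  then have "adj (\<rho> \<one>) * (\<rho> \<one> * \<rho> \<one>) = adj (\<rho> \<one>) * \<rho> \<one>" by simp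
  then show ?thesis
    using r(1,3)[of \<one>] by (simp add: assoc_mult_mat[symmetric, of _ n n _ n _ n])
qed

lemma (in group) unitary_rep_inv:
  assumes "unitary_rep G n \<rho>" "g \<in> carrier G" shows "\<rho> (inv g) = adj (\<rho> g)"
proof -
  note r = unitary_repD[OF assms(1)]
  have "\<rho> g * \<rho> (inv g) = 1\<^sub>m n" using r(4)[of g "inv g"] unitary_rep_one[OF assms(1)] assms(2) by simp
  then have "adj (\<rho> g) * (\<rho> g * \<rho> (inv g)) = adj (\<rho> g)" using r(1)[OF assms(2)] by simp
  then show ?thesis
    using r(1)[of g] r(1)[of "inv g"] r(3)[of g] assms(2)
    by (simp add: assoc_mult_mat[symmetric, of _ n n _ n _ n])
qed

lemma subspace_vecI:
  assumes "W \<subseteq> carrier_vec n" "0\<^sub>v n \<in> W" "\<And>v w. v \<in> W \<Longrightarrow> w \<in> W \<Longrightarrow> v + w \<in> W"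
    "\<And>(c::complex) v. v \<in> W \<Longrightarrow> c \<cdot>\<^sub>v v \<in> W"
  shows "VectorSpace.subspace class_ring W (module_vec TYPE(complex) n)"
proof -
  interpret vec_space "TYPE(complex)" n .
  show ?thesis using assms module_axioms vectorspace_axioms
    unfolding subspace_def submodule_def by (auto simp: module_vec_simps)
qed

lemma subspace_vecD:
  assumes "VectorSpace.subspace class_ring W (module_vec TYPE(complex) n)"
  shows "W \<subseteq> carrier_vec n" "0\<^sub>v n \<in> W" "\<And>v w. v \<in> W \<Longrightarrow> w \<in> W \<Longrightarrow> v + w \<in> W"
    "\<And>(c::complex) v. v \<in> W \<Longrightarrow> c \<cdot>\<^sub>v v \<in> W"
  using assms unfolding subspace_def submodule_def
  by (auto simp: module_vec_simps class_ring_simps)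

text \<open>An eigenspace of \<open>Y\<close> is invariant under the representation, hence it is the whole space.\<close>

lemma commutant_scalar:
  assumes irr: "irreducible_rep G n \<rho>" and Y: "Y \<in> carrier_mat n n"
    and comm: "\<And>g. g \<in> carrier G \<Longrightarrow> Y * \<rho> g = \<rho> g * Y"
  obtains c where "Y = c \<cdot>\<^sub>m 1\<^sub>m n"
proof -
  have rep: "unitary_rep G n \<rho>" and n: "n > 0" using irr unfolding irreducible_rep_def by auto
  note r = unitary_repD[OF rep]
  have "degree (char_poly Y) > 0" using degree_monic_char_poly[OF Y] n by auto
  then have "\<not> constant (poly (char_poly Y))" by (simp add: constant_degree)
  then obtain c where "poly (char_poly Y) c = 0" using fundamental_theorem_of_algebra by blast
  then have "eigenvalue Y c" using eigenvalue_root_char_poly[OF Y] by simp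
  then obtain v where v: "v \<in> carrier_vec n" "v \<noteq> 0\<^sub>v n" "Y *\<^sub>v v = c \<cdot>\<^sub>v v"
    unfolding eigenvalue_def eigenvector_def using Y by auto
  define W where "W = {w \<in> carrier_vec n. Y *\<^sub>v w = c \<cdot>\<^sub>v w}"
  have "VectorSpace.subspace class_ring W (module_vec TYPE(complex) n)"
  proof (rule subspace_vecI)
    show "v + w \<in> W" if "v \<in> W" "w \<in> W" for v w
      using that Y unfolding W_def by (auto simp: mult_add_distrib_mat_vec smult_add_distrib_vec)
    show "d \<cdot>\<^sub>v w \<in> W" if "w \<in> W" for d w
      using that Y unfolding W_def by (auto simp: mult_mat_vec smult_smult_assoc mult.commute)
  qed (use Y in \<open>auto simp: W_def\<close>)
  moreover have "\<rho> g *\<^sub>v w \<in> W" if g: "g \<in> carrier G" and w: "w \<in> W" for g w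
  proof -
    have w': "w \<in> carrier_vec n" "Y *\<^sub>v w = c \<cdot>\<^sub>v w" using w unfolding W_def by auto
    have "Y *\<^sub>v (\<rho> g *\<^sub>v w) = (Y * \<rho> g) *\<^sub>v w" using Y r(1)[OF g] w' by simp
    also have "\<dots> = \<rho> g *\<^sub>v (Y *\<^sub>v w)" using comm[OF g] Y r(1)[OF g] w' by simp
    also have "\<dots> = c \<cdot>\<^sub>v (\<rho> g *\<^sub>v w)" using w' r(1)[OF g] by (simp add: mult_mat_vec)
    finally show ?thesis using r(1)[OF g] w' unfolding W_def by auto
  qed
  ultimately have "W = {0\<^sub>v n} \<or> W = carrier_vec n" using irr unfolding irreducible_rep_def by blast
  moreover have "v \<in> W" using v unfolding W_def by simp
  ultimately have "W = carrier_vec n" using v(2) by auto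
  then have W: "Y *\<^sub>v w = c \<cdot>\<^sub>v w" if "w \<in> carrier_vec n" for w using that unfolding W_def by blast
  have "Y = c \<cdot>\<^sub>m 1\<^sub>m n"
  proof (rule eq_matI)
    fix i j assume "i < dim_row (c \<cdot>\<^sub>m 1\<^sub>m n)" "j < dim_col (c \<cdot>\<^sub>m 1\<^sub>m n)"
    then have ij: "i < n" "j < n" by auto
    have "Y $$ (i, j) = (Y *\<^sub>v unit_vec n j) $ i" using mult_unit_vec[OF Y ij(2)] Y ij by simp
    also have "\<dots> = (c \<cdot>\<^sub>v unit_vec n j) $ i" using W[of "unit_vec n j"] by simp
    finally show "Y $$ (i, j) = (c \<cdot>\<^sub>m 1\<^sub>m n) $$ (i, j)" using ij by simp
  qed (use Y in auto)
  then show ?thesis using that by blast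
qed

text \<open>Apply the adjoint to the intertwining relation at \<open>g\<^sup>-\<^sup>1\<close>.\<close>

lemma (in group) adj_intertwines:
  assumes rho: "unitary_rep G n \<rho>" and sigma: "unitary_rep G m \<sigma>" and T: "T \<in> carrier_mat m n"
    and tw: "\<And>g. g \<in> carrier G \<Longrightarrow> T * \<rho> g = \<sigma> g * T" and g: "g \<in> carrier G"
  shows "adj T * \<sigma> g = \<rho> g * adj T"
proof -
  note r = unitary_repD[OF rho] and s = unitary_repD[OF sigma]
  have i: "inv g \<in> carrier G" using g by simp
  have "adj (T * \<rho> (inv g)) = adj (\<sigma> (inv g) * T)" using tw[OF i] by simp
  then have "adj (\<rho> (inv g)) * adj T = adj T * adj (\<sigma> (inv g))"
    using adj_mult[OF T r(1)[OF i]] adj_mult[OF s(1)[OF i] T] by simp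
  then show ?thesis using unitary_rep_inv[OF rho g] unitary_rep_inv[OF sigma g] by simp
qed

text \<open>\<open>T\<^sup>*T\<close> commutes with the irreducible representation \<open>\<rho>\<close>, so it is a scalar.\<close>

lemma (in group) intertwiner_scaled_isometry:
  assumes irr: "irreducible_rep G n \<rho>" and sigma: "unitary_rep G m \<sigma>" and T: "T \<in> carrier_mat m n"
    and tw: "\<And>g. g \<in> carrier G \<Longrightarrow> T * \<rho> g = \<sigma> g * T"
  obtains c where "adj T * T = c \<cdot>\<^sub>m 1\<^sub>m n"
proof -
  have rho: "unitary_rep G n \<rho>" using irr unfolding irreducible_rep_def by auto
  note r = unitary_repD[OF rho] and s = unitary_repD[OF sigma]
  have "(adj T * T) * \<rho> g = \<rho> g * (adj T * T)" if g: "g \<in> carrier G" for g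
  proof -
    have "(adj T * T) * \<rho> g = adj T * (\<sigma> g * T)"
      using tw[OF g] T r(1)[OF g] by (simp add: assoc_mult_mat[of _ n m _ n _ n])
    also have "\<dots> = (adj T * \<sigma> g) * T"
      using T s(1)[OF g] by (simp add: assoc_mult_mat[of _ n m _ m _ n])
    also have "adj T * \<sigma> g = \<rho> g * adj T" by (rule adj_intertwines[OF rho sigma T tw g])
    also have "\<dots> * T = \<rho> g * (adj T * T)"
      using T r(1)[OF g] by (simp add: assoc_mult_mat[of _ n n _ m _ n])
    finally show ?thesis .
  qed
  moreover have "adj T * T \<in> carrier_mat n n" by (rule mult_carrier_mat[OF adj_carrier[OF T] T])
  ultimately obtain c where "adj T * T = c \<cdot>\<^sub>m 1\<^sub>m n" using commutant_scalar[OF irr] by blast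
  then show ?thesis by (rule that)
qed

lemma unitary_groupI:
  assumes "U \<in> carrier_mat n n" "adj U * U = 1\<^sub>m n"
  shows "U \<in> carrier (unitary_group n)"
  unfolding unitary_group_def using assms mat_mult_left_right_inverse[of "adj U" n U] by auto

lemma unitary_groupD:
  assumes "U \<in> carrier (unitary_group n)"
  shows "U \<in> carrier_mat n n" "adj U * U = 1\<^sub>m n" "U * adj U = 1\<^sub>m n"
  using assms unfolding unitary_group_def by auto

text \<open>The scalar \<open>T\<^sup>*T\<close> is positive, since its trace is the sum of the squared absolute values of the
  entries of \<open>T\<close>; dividing \<open>T\<close> by its square root gives a unitary intertwiner.  It is
  applied to \<open>\<sigma> = \<rho> \<circ> \<phi>\<close>, which might a priori be reducible.\<close>

lemma (in group) intertwiner_unitary: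
  assumes irr: "irreducible_rep G n \<rho>" and sigma: "unitary_rep G n \<sigma>" and T: "T \<in> carrier_mat n n"
    and tw: "\<And>g. g \<in> carrier G \<Longrightarrow> T * \<rho> g = \<sigma> g * T" and nz: "T \<noteq> 0\<^sub>m n n"
  shows "rep_equiv G \<rho> \<sigma>"
proof -
  have rho: "unitary_rep G n \<rho>" and n: "n > 0" using irr unfolding irreducible_rep_def by auto
  obtain c where c: "adj T * T = c \<cdot>\<^sub>m 1\<^sub>m n" using intertwiner_scaled_isometry[OF irr sigma T tw] by blast
  obtain r where r: "r > 0" "trace (adj T * T) = of_real r" by (rule trace_adj_mult_nonzero[OF T nz])
  define s where "s = r / real n"
  have s: "s > 0" unfolding s_def using r n by simp
  have "c * of_nat n = of_real r" using r(2) unfolding c by (simp add: trace_smult[of _ n])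
  then have cs: "c = of_real s" unfolding s_def using n by (simp add: field_simps)
  define U where "U = of_real (1 / sqrt s) \<cdot>\<^sub>m T"
  have U: "U \<in> carrier_mat n n" unfolding U_def using T by simp
  have "adj U * U = (of_real (1 / sqrt s) * of_real (1 / sqrt s)) \<cdot>\<^sub>m (adj T * T)"
    unfolding U_def adj_smult using T by (intro eq_matI) (auto simp: scalar_prod_def sum_distrib_left algebra_simps)
  also have "\<dots> = (of_real (1 / sqrt s) * of_real (1 / sqrt s) * of_real s) \<cdot>\<^sub>m 1\<^sub>m n"
    unfolding c cs by (rule eq_matI) auto
  also have "of_real (1 / sqrt s) * of_real (1 / sqrt s) * of_real s = (of_real (1 / sqrt s * (1 / sqrt s) * s) :: complex)"
    by (simp only: of_real_mult)
  also have "1 / sqrt s * (1 / sqrt s) * s = 1" using s by (simp add: field_simps)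
  finally have "adj U * U = 1\<^sub>m n" by (intro eq_matI) auto
  then have "U \<in> carrier (unitary_group n)" using U by (rule unitary_groupI[rotated])
  moreover have "U * \<rho> g = \<sigma> g * U" if g: "g \<in> carrier G" for g
    unfolding U_def using tw[OF g] T unitary_repD(1)[OF rho g] unitary_repD(1)[OF sigma g]
    by (simp add: mult_smult_assoc_mat[of _ n n _ n] mult_smult_distrib[of _ n n _ n])
  ultimately show ?thesis unfolding rep_equiv_def using rho sigma by blast
qed

text \<open>A nonzero intertwiner \<open>T\<close> of irreducible representations satisfies \<open>T\<^sup>*T = c\<close> and \<open>TT\<^sup>* = d\<close>
  with \<open>cT = TT\<^sup>*T = dT\<close>; comparing traces, the dimensions agree.\<close>

lemma (in group) intertwiner_irreducible:
  assumes irr: "irreducible_rep G n \<rho>" and irr': "irreducible_rep G m \<sigma>" and T: "T \<in> carrier_mat m n"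
    and tw: "\<And>g. g \<in> carrier G \<Longrightarrow> T * \<rho> g = \<sigma> g * T" and nz: "T \<noteq> 0\<^sub>m m n"
  shows "rep_equiv G \<rho> \<sigma>"
proof -
  have rho: "unitary_rep G n \<rho>" and sigma: "unitary_rep G m \<sigma>"
    using irr irr' unfolding irreducible_rep_def by auto
  obtain c where c: "adj T * T = c \<cdot>\<^sub>m 1\<^sub>m n" using intertwiner_scaled_isometry[OF irr sigma T tw] by blast
  obtain d where "adj (adj T) * adj T = d \<cdot>\<^sub>m 1\<^sub>m m"
    using intertwiner_scaled_isometry[OF irr' rho adj_carrier[OF T]] adj_intertwines[OF rho sigma T tw] by blast
  then have d: "T * adj T = d \<cdot>\<^sub>m 1\<^sub>m m" by simp
  obtain r where r: "r > 0" "trace (adj T * T) = of_real r" by (rule trace_adj_mult_nonzero[OF T nz])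
  have tc: "c * of_nat n = of_real r" using r(2) unfolding c by (simp add: trace_smult[of _ n])
  have "trace (T * adj T) = of_real r"
    using r(2) trace_mult_commute[OF T adj_carrier[OF T]] by simp
  then have td: "d * of_nat m = of_real r" unfolding d by (simp add: trace_smult[of _ m])
  have "T * (adj T * T) = (T * adj T) * T" using T by (simp add: assoc_mult_mat[of _ m n _ m _ n])
  then have "c \<cdot>\<^sub>m T = d \<cdot>\<^sub>m T" unfolding c d
    using T by (simp add: mult_smult_assoc_mat[of _ m m _ n] mult_smult_distrib[of _ m n _ n])
  then have cd: "c * T $$ (i, j) = d * T $$ (i, j)" if "i < m" "j < n" for i j
    using T that by (metis carrier_matD index_smult_mat(1))
  have "\<exists>i<m. \<exists>j<n. T $$ (i, j) \<noteq> 0"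
  proof (rule ccontr)
    assume "\<not> ?thesis"
    then have "T = 0\<^sub>m m n" using T by (intro eq_matI) auto
    then show False using nz by simp
  qed
  then have "c = d" using cd by (metis mult_right_cancel)
  moreover have "c \<noteq> 0" using tc r(1) by auto
  ultimately have "n = m" using tc td by (metis mult_left_cancel of_nat_eq_iff)
  then show ?thesis using intertwiner_unitary[OF irr _ _ tw] sigma T nz by blast
qed

section \<open>Linear independence of matrix coefficients\<close>

text \<open>Averaging over a finite quotient of \<open>G\<close>, presented as a map \<open>\<kappa>\<close> with finite image whose fibres
  are permuted by left translations.  The set \<open>E\<close> picks one element from each fibre.\<close>

lemma (in group) invariant_average:
  fixes \<kappa> :: "'a \<Rightarrow> 'c"
  assumes fin: "finite (\<kappa> ` carrier G)"
    and left: "\<And>a b h. a \<in> carrier G \<Longrightarrow> b \<in> carrier G \<Longrightarrow> h \<in> carrier G \<Longrightarrow> \<kappa> a = \<kappa> b \<Longrightarrow> \<kappa> (h \<otimes> a) = \<kappa> (h \<otimes> b)"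
  shows "\<exists>E. finite E \<and> E \<subseteq> carrier G \<and> E \<noteq> {} \<and>
    (\<forall>(f :: 'a \<Rightarrow> complex) h. (\<forall>a\<in>carrier G. \<forall>b\<in>carrier G. \<kappa> a = \<kappa> b \<longrightarrow> f a = f b) \<longrightarrow>
        h \<in> carrier G \<longrightarrow> (\<Sum>e\<in>E. f (h \<otimes> e)) = (\<Sum>e\<in>E. f e))"
proof -
  define p where "p a = inv_into (carrier G) \<kappa> (\<kappa> a)" for a
  have p: "p a \<in> carrier G" "\<kappa> (p a) = \<kappa> a" if "a \<in> carrier G" for a
    unfolding p_def using that by (auto intro: inv_into_into f_inv_into_f)
  have peq: "p a = p b" if "\<kappa> a = \<kappa> b" for a b unfolding p_def using that by simp
  define E where "E = p ` carrier G"
  have "E = inv_into (carrier G) \<kappa> ` \<kappa> ` carrier G" unfolding E_def p_def by auto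
  then have Efin: "finite E" using fin by simp
  have pE: "p e = e" if e: "e \<in> E" for e
  proof -
    obtain a where "a \<in> carrier G" "e = p a" using e unfolding E_def by blast
    then show ?thesis using peq[of "p a" a] p(2)[of a] by simp
  qed
  have Ec: "E \<subseteq> carrier G" unfolding E_def using p by auto
  have sum_eq: "(\<Sum>e\<in>E. f (h \<otimes> e)) = (\<Sum>e\<in>E. f e)"
    if f: "\<forall>a\<in>carrier G. \<forall>b\<in>carrier G. \<kappa> a = \<kappa> b \<longrightarrow> f a = f b" and h: "h \<in> carrier G"
    for f :: "'a \<Rightarrow> complex" and h
  proof (rule sum.reindex_bij_witness[where i = "\<lambda>e. p (inv h \<otimes> e)" and j = "\<lambda>e. p (h \<otimes> e)"])
    fix e assume e: "e \<in> E"
    then have ec: "e \<in> carrier G" using Ec by blast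
    show "p (h \<otimes> e) \<in> E" "p (inv h \<otimes> e) \<in> E" unfolding E_def using ec h by auto
    have a: "\<kappa> (inv h \<otimes> p (h \<otimes> e)) = \<kappa> (inv h \<otimes> (h \<otimes> e))"
      by (rule left) (use p[of "h \<otimes> e"] ec h in auto)
    have "inv h \<otimes> (h \<otimes> e) = e" using ec h by (simp add: m_assoc[symmetric])
    then show "p (inv h \<otimes> p (h \<otimes> e)) = e" using peq[OF a] pE[OF e] by simp
    have b: "\<kappa> (h \<otimes> p (inv h \<otimes> e)) = \<kappa> (h \<otimes> (inv h \<otimes> e))"
      by (rule left) (use p[of "inv h \<otimes> e"] ec h in auto)
    have "h \<otimes> (inv h \<otimes> e) = e" using ec h by (simp add: m_assoc[symmetric])
    then show "p (h \<otimes> p (inv h \<otimes> e)) = e" using peq[OF b] pE[OF e] by simp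
    show "f (p (h \<otimes> e)) = f (h \<otimes> e)" by (rule f[rule_format]) (use p[of "h \<otimes> e"] ec h in auto)
  qed
  have "E \<noteq> {}" unfolding E_def using one_closed by blast
  then show ?thesis
    by (intro exI[of _ E] conjI allI impI) (rule Efin, rule Ec, assumption, rule sum_eq, assumption+)
qed

text \<open>\<open>T\<close> is the average of \<open>\<rho>(e) E\<^sub>j\<^sub>k \<sigma>(e)\<^sup>*\<close>, where \<open>E\<^sub>j\<^sub>k\<close> is a matrix unit.  Conjugating it by \<open>\<rho>(h)\<close> and
  \<open>\<sigma>(h)\<close> amounts to replacing \<open>e\<close> by \<open>he\<close>, which does not change the average.\<close>

lemma (in group) average_intertwines:
  assumes rho: "unitary_rep G n \<rho>" and sigma: "unitary_rep G m \<sigma>"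
    and E: "finite E" "E \<subseteq> carrier G"
    and inv: "\<And>h i j k l. h \<in> carrier G \<Longrightarrow>
        (\<Sum>e\<in>E. \<rho> (h \<otimes> e) $$ (i, j) * cnj (\<sigma> (h \<otimes> e) $$ (l, k))) = (\<Sum>e\<in>E. \<rho> e $$ (i, j) * cnj (\<sigma> e $$ (l, k)))"
    and jk: "j < n" "k < m"
  defines "T \<equiv> mat n m (\<lambda>(i, l). \<Sum>e\<in>E. \<rho> e $$ (i, j) * cnj (\<sigma> e $$ (l, k)))"
  assumes h: "h \<in> carrier G"
  shows "T * \<sigma> h = \<rho> h * T"
proof -
  note r = unitary_repD[OF rho] and s = unitary_repD[OF sigma]
  have T: "T \<in> carrier_mat n m" unfolding T_def by simp
  have rh: "\<rho> h \<in> carrier_mat n n" and sh: "\<sigma> h \<in> carrier_mat m m" using r(1) s(1) h by auto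
  have "\<rho> h * T * adj (\<sigma> h) = T"
  proof (rule eq_matI)
    fix i l assume "i < dim_row T" "l < dim_col T"
    then have il: "i < n" "l < m" using T by auto
    have "(\<rho> h * T * adj (\<sigma> h)) $$ (i, l) = (\<Sum>b<m. (\<rho> h * T) $$ (i, b) * adj (\<sigma> h) $$ (b, l))"
      by (rule mat_mult_index[of _ n m _ m]) (use rh sh T il in auto)
    also have "\<dots> = (\<Sum>b<m. (\<Sum>a<n. \<rho> h $$ (i, a) * T $$ (a, b)) * cnj (\<sigma> h $$ (l, b)))"
      using mat_mult_index[OF rh T il(1)] sh il by (intro sum.cong refl) auto
    also have "\<dots> = (\<Sum>b<m. \<Sum>a<n. \<Sum>e\<in>E. \<rho> h $$ (i, a) * (\<rho> e $$ (a, j) * cnj (\<sigma> e $$ (b, k))) * cnj (\<sigma> h $$ (l, b)))"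
      unfolding T_def by (simp add: sum_distrib_left sum_distrib_right)
    also have "\<dots> = (\<Sum>b<m. \<Sum>e\<in>E. \<Sum>a<n. \<rho> h $$ (i, a) * (\<rho> e $$ (a, j) * cnj (\<sigma> e $$ (b, k))) * cnj (\<sigma> h $$ (l, b)))"
      by (intro sum.cong refl sum.swap)
    also have "\<dots> = (\<Sum>e\<in>E. \<Sum>b<m. \<Sum>a<n. \<rho> h $$ (i, a) * (\<rho> e $$ (a, j) * cnj (\<sigma> e $$ (b, k))) * cnj (\<sigma> h $$ (l, b)))"
      by (rule sum.swap)
    also have "\<dots> = (\<Sum>e\<in>E. (\<Sum>a<n. \<rho> h $$ (i, a) * \<rho> e $$ (a, j)) * cnj (\<Sum>b<m. \<sigma> h $$ (l, b) * \<sigma> e $$ (b, k)))"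
      by (simp add: sum_distrib_left sum_distrib_right cnj_sum mult_ac)
    also have "\<dots> = (\<Sum>e\<in>E. \<rho> (h \<otimes> e) $$ (i, j) * cnj (\<sigma> (h \<otimes> e) $$ (l, k)))"
    proof (rule sum.cong[OF refl])
      fix e assume "e \<in> E"
      then have e: "e \<in> carrier G" using E(2) by blast
      show "(\<Sum>a<n. \<rho> h $$ (i, a) * \<rho> e $$ (a, j)) * cnj (\<Sum>b<m. \<sigma> h $$ (l, b) * \<sigma> e $$ (b, k)) =
          \<rho> (h \<otimes> e) $$ (i, j) * cnj (\<sigma> (h \<otimes> e) $$ (l, k))"
        using mat_mult_index[OF rh r(1)[OF e] il(1) jk(1)] mat_mult_index[OF sh s(1)[OF e] il(2) jk(2)]
          r(4)[OF h e] s(4)[OF h e] by simp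
    qed
    also have "\<dots> = T $$ (i, l)" unfolding inv[OF h] T_def using il by simp
    finally show "(\<rho> h * T * adj (\<sigma> h)) $$ (i, l) = T $$ (i, l)" .
  qed (use rh sh T in auto)
  then have "T * \<sigma> h = \<rho> h * T * adj (\<sigma> h) * \<sigma> h" by simp
  also have "\<dots> = \<rho> h * T"
    using rh sh T s(3)[OF h] by (simp add: assoc_mult_mat[of _ n m _ m _ m])
  finally show ?thesis .
qed

text \<open>Orthogonality of coefficients: the average of a coefficient of \<open>R x\<close> against a conjugated
  coefficient of \<open>R c\<close> is an entry of an intertwiner.  By Schur's lemma it vanishes for inequivalent
  representations and is a multiple of a Kronecker delta for \<open>x = c\<close>.  Averaging the given relation
  against coefficients of \<open>R c\<close> therefore isolates the entries of \<open>A c\<close>.\<close>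

theorem (in group) coefficients_independent:
  assumes I: "finite I" "\<And>c. c \<in> I \<Longrightarrow> irreducible_rep G (d c) (R c)"
    and fin: "\<And>c. c \<in> I \<Longrightarrow> finite (R c ` carrier G)"
    and inequiv: "\<And>c c'. c \<in> I \<Longrightarrow> c' \<in> I \<Longrightarrow> c \<noteq> c' \<Longrightarrow> \<not> rep_equiv G (R c) (R c')"
    and A: "\<And>c. c \<in> I \<Longrightarrow> A c \<in> carrier_mat (d c) (d c)"
    and zero: "\<And>g. g \<in> carrier G \<Longrightarrow> (\<Sum>c\<in>I. trace (A c * R c g)) = 0"
    and c: "c \<in> I"
  shows "A c = 0\<^sub>m (d c) (d c)"
proof -
  have rep: "unitary_rep G (d x) (R x)" if "x \<in> I" for x
    using I(2)[OF that] unfolding irreducible_rep_def by auto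
  \<comment> \<open>a finite quotient through which all representations of the family factor\<close>
  define \<kappa> where "\<kappa> g = (\<lambda>x\<in>I. R x g)" for g
  have k: "\<kappa> a = \<kappa> b \<longleftrightarrow> (\<forall>x\<in>I. R x a = R x b)" for a b
    unfolding \<kappa>_def by (auto simp: restrict_def fun_eq_iff)
  have "\<kappa> ` carrier G \<subseteq> PiE I (\<lambda>x. R x ` carrier G)" unfolding \<kappa>_def by auto
  then have kfin: "finite (\<kappa> ` carrier G)" by (rule finite_subset) (rule finite_PiE[OF I(1) fin])
  have left: "\<kappa> (h \<otimes> a) = \<kappa> (h \<otimes> b)" if "a \<in> carrier G" "b \<in> carrier G" "h \<in> carrier G" "\<kappa> a = \<kappa> b" for a b h
    using that unitary_repD(4)[OF rep] unfolding k by simp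
  obtain E where E: "finite E" "E \<subseteq> carrier G" "E \<noteq> {}" and
    avg: "\<forall>(f :: 'a \<Rightarrow> complex) h. (\<forall>a\<in>carrier G. \<forall>b\<in>carrier G. \<kappa> a = \<kappa> b \<longrightarrow> f a = f b) \<longrightarrow>
        h \<in> carrier G \<longrightarrow> (\<Sum>e\<in>E. f (h \<otimes> e)) = (\<Sum>e\<in>E. f e)"
    using invariant_average[OF kfin left] by blast
  have avg': "(\<Sum>e\<in>E. R x (h \<otimes> e) $$ (i, j) * cnj (R y (h \<otimes> e) $$ (l, q))) = (\<Sum>e\<in>E. R x e $$ (i, j) * cnj (R y e $$ (l, q)))"
    if x: "x \<in> I" "y \<in> I" and h: "h \<in> carrier G" for x y h i j q l
  proof (rule avg[rule_format, where f = "\<lambda>e. R x e $$ (i, j) * cnj (R y e $$ (l, q))", OF _ h])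
    fix a b assume "\<kappa> a = \<kappa> b"
    then have "R x a = R x b" "R y a = R y b" using x unfolding k by auto
    then show "R x a $$ (i, j) * cnj (R y a $$ (l, q)) = R x b $$ (i, j) * cnj (R y b $$ (l, q))" by simp
  qed
  let ?T = "\<lambda>x y j q. mat (d x) (d y) (\<lambda>(i, l). \<Sum>e\<in>E. R x e $$ (i, j) * cnj (R y e $$ (l, q)))"
  have tw: "?T x y j q * R y h = R x h * ?T x y j q"
    if "x \<in> I" "y \<in> I" "j < d x" "q < d y" "h \<in> carrier G" for x y j q h
    by (rule average_intertwines[OF rep rep E(1,2) avg']) (use that in auto)
  \<comment> \<open>the orthogonality relations\<close>
  have off: "(\<Sum>e\<in>E. R x e $$ (i, j) * cnj (R c e $$ (l, q))) = 0"
    if x: "x \<in> I" "x \<noteq> c" and ij: "i < d x" "j < d x" "l < d c" "q < d c" for x i j l q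
  proof -
    have "?T x c j q = 0\<^sub>m (d x) (d c)"
    proof (rule ccontr)
      assume nz: "?T x c j q \<noteq> 0\<^sub>m (d x) (d c)"
      have "rep_equiv G (R c) (R x)"
      proof (rule intertwiner_irreducible[OF I(2)[OF c] I(2)[OF x(1)] _ _ nz])
        show "?T x c j q * R c h = R x h * ?T x c j q" if "h \<in> carrier G" for h
          by (rule tw[OF x(1) c ij(2,4) that])
      qed simp
      then show False using inequiv[OF c x(1)] x(2) by simp
    qed
    then have "?T x c j q $$ (i, l) = 0" using ij by simp
    then show ?thesis using ij by simp
  qed
  have diag: "(\<Sum>e\<in>E. R c e $$ (i, j) * cnj (R c e $$ (l, q))) =
      (if i = l \<and> j = q then of_nat (card E) / of_nat (d c) else 0)"
    if ij: "i < d c" "j < d c" "l < d c" "q < d c" for i j l q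
  proof -
    have dc: "d c > 0" using I(2)[OF c] unfolding irreducible_rep_def by simp
    obtain z where z: "?T c c j q = z \<cdot>\<^sub>m 1\<^sub>m (d c)"
      using commutant_scalar[OF I(2)[OF c] mat_carrier, of "\<lambda>(i, l). \<Sum>e\<in>E. R c e $$ (i, j) * cnj (R c e $$ (l, q))"]
        tw[OF c c ij(2,4)] by blast
    have "z * of_nat (d c) = trace (?T c c j q)" unfolding z by (simp add: trace_smult[of _ "d c"])
    also have "\<dots> = (\<Sum>i<d c. \<Sum>e\<in>E. R c e $$ (i, j) * cnj (R c e $$ (i, q)))" unfolding trace_def by simp
    also have "\<dots> = (\<Sum>e\<in>E. \<Sum>i<d c. R c e $$ (i, j) * cnj (R c e $$ (i, q)))" by (rule sum.swap)
    also have "\<dots> = (\<Sum>e\<in>E. if j = q then 1 else 0)"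
    proof (rule sum.cong[OF refl])
      fix e assume "e \<in> E"
      then have e: "e \<in> carrier G" using E(2) by blast
      note re = unitary_repD(1)[OF rep[OF c] e]
      have "(adj (R c e) * R c e) $$ (q, j) = (\<Sum>i<d c. adj (R c e) $$ (q, i) * R c e $$ (i, j))"
        by (rule mat_mult_index[of _ "d c" "d c" _ "d c"]) (use re ij in auto)
      also have "\<dots> = (\<Sum>i<d c. R c e $$ (i, j) * cnj (R c e $$ (i, q)))"
        using re ij by (intro sum.cong refl) auto
      finally show "(\<Sum>i<d c. R c e $$ (i, j) * cnj (R c e $$ (i, q))) = (if j = q then 1 else 0)"
        using unitary_repD(3)[OF rep[OF c] e] ij by auto
    qed
    finally have zz: "z * of_nat (d c) = (if j = q then of_nat (card E) else 0)" by simp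
    have "(\<Sum>e\<in>E. R c e $$ (i, j) * cnj (R c e $$ (l, q))) = ?T c c j q $$ (i, l)" using ij by simp
    also have "\<dots> = (if i = l then z else 0)" unfolding z using ij by simp
    finally show ?thesis using zz dc by (auto simp: field_simps split: if_splits)
  qed
  have "A c $$ (q, l) = 0" if ql: "q < d c" "l < d c" for q l
  proof -
    have tr: "trace (A x * R x e) = (\<Sum>a<d x. \<Sum>b<d x. A x $$ (a, b) * R x e $$ (b, a))"
      if "x \<in> I" "e \<in> E" for x e
      using trace_mult[OF A[OF that(1)] unitary_repD(1)[OF rep[OF that(1)]]] that E(2) by auto
    have "0 = (\<Sum>e\<in>E. (\<Sum>x\<in>I. trace (A x * R x e)) * cnj (R c e $$ (l, q)))"
      using zero E(2) by (simp add: subset_iff)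
    also have "\<dots> = (\<Sum>e\<in>E. \<Sum>x\<in>I. trace (A x * R x e) * cnj (R c e $$ (l, q)))"
      by (simp add: sum_distrib_right)
    also have "\<dots> = (\<Sum>x\<in>I. \<Sum>e\<in>E. trace (A x * R x e) * cnj (R c e $$ (l, q)))" by (rule sum.swap)
    also have "\<dots> = (\<Sum>x\<in>I. if x = c then A c $$ (q, l) * (of_nat (card E) / of_nat (d c)) else 0)"
    proof (rule sum.cong[OF refl])
      fix x assume x: "x \<in> I"
      have "(\<Sum>e\<in>E. trace (A x * R x e) * cnj (R c e $$ (l, q))) =
          (\<Sum>e\<in>E. \<Sum>a<d x. \<Sum>b<d x. A x $$ (a, b) * (R x e $$ (b, a) * cnj (R c e $$ (l, q))))"
        by (intro sum.cong refl) (simp add: tr[OF x] sum_distrib_right mult.assoc)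
      also have "\<dots> = (\<Sum>a<d x. \<Sum>e\<in>E. \<Sum>b<d x. A x $$ (a, b) * (R x e $$ (b, a) * cnj (R c e $$ (l, q))))"
        by (rule sum.swap)
      also have "\<dots> = (\<Sum>a<d x. \<Sum>b<d x. \<Sum>e\<in>E. A x $$ (a, b) * (R x e $$ (b, a) * cnj (R c e $$ (l, q))))"
        by (intro sum.cong refl sum.swap)
      also have "\<dots> = (\<Sum>a<d x. \<Sum>b<d x. A x $$ (a, b) * (\<Sum>e\<in>E. R x e $$ (b, a) * cnj (R c e $$ (l, q))))"
        by (simp add: sum_distrib_left)
      also have "\<dots> = (if x = c then A c $$ (q, l) * (of_nat (card E) / of_nat (d c)) else 0)"
      proof (cases "x = c")
        case False
        then show ?thesis using off[OF x False] ql by simp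
      next
        case True
        have "(\<Sum>a<d c. \<Sum>b<d c. A c $$ (a, b) * (\<Sum>e\<in>E. R c e $$ (b, a) * cnj (R c e $$ (l, q)))) =
          (\<Sum>a<d c. \<Sum>b<d c. if b = l then (if a = q then A c $$ (a, b) * (of_nat (card E) / of_nat (d c)) else 0) else 0)"
          using diag ql by (intro sum.cong refl) auto
        also have "\<dots> = A c $$ (q, l) * (of_nat (card E) / of_nat (d c))" using ql by (simp add: sum.delta)
        finally show ?thesis using True by simp
      qed
      finally show "(\<Sum>e\<in>E. trace (A x * R x e) * cnj (R c e $$ (l, q))) =
        (if x = c then A c $$ (q, l) * (of_nat (card E) / of_nat (d c)) else 0)" .
    qed
    also have "\<dots> = A c $$ (q, l) * (of_nat (card E) / of_nat (d c))" using I(1) c by (simp add: sum.delta)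
    finally have "A c $$ (q, l) * (of_nat (card E) / of_nat (d c)) = 0" by simp
    moreover have "card E \<noteq> 0" "d c \<noteq> 0" using E(1,3) I(2)[OF c] unfolding irreducible_rep_def by auto
    ultimately show ?thesis by simp
  qed
  then show ?thesis using A[OF c] by (intro eq_matI) auto
qed

section \<open>Isometries and reducible representations\<close>

text \<open>The trace of the projection \<open>1 - JJ\<^sup>*\<close> is \<open>n - r\<close>, and as the trace of a matrix of the form \<open>Q\<^sup>*Q\<close> it
  is nonnegative.\<close>

lemma isometry_dim_le:
  assumes J: "J \<in> carrier_mat n r" "adj J * J = 1\<^sub>m r"
  shows "r \<le> n"
proof -
  let ?Q = "1\<^sub>m n - J * adj J"
  have Q: "J * adj J \<in> carrier_mat n n" using J(1) by (intro mult_carrier_mat[of _ n r]) auto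
  then have Qc: "?Q \<in> carrier_mat n n" by (rule minus_carrier_mat)
  have aQ: "adj ?Q = ?Q"
  proof -
    have "adj (J * adj J) = J * adj J" using adj_mult[OF J(1) adj_carrier[OF J(1)]] by simp
    then have h: "cnj ((J * adj J) $$ (j, i)) = (J * adj J) $$ (i, j)" if "i < n" "j < n" for i j
      using that adj_index[of i "J * adj J" j] J(1) by simp
    show ?thesis by (rule eq_matI) (use Q J(1) h in auto)
  qed
  have JQ: "adj J * ?Q = 0\<^sub>m r n"
  proof -
    have "adj J * ?Q = adj J * 1\<^sub>m n - adj J * (J * adj J)"
      using Q J(1) by (intro mult_minus_distrib_mat[of _ r n]) auto
    also have "adj J * (J * adj J) = adj J"
      using J by (simp add: assoc_mult_mat[symmetric, of _ r n _ r _ n])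
    finally show ?thesis using J(1) by auto
  qed
  have "?Q * ?Q = ?Q"
  proof -
    have "?Q * ?Q = 1\<^sub>m n * ?Q - J * adj J * ?Q" by (rule minus_mult_distrib_mat[OF one_carrier_mat Q Qc])
    also have "J * adj J * ?Q = J * (adj J * ?Q)" using J(1) Qc by (intro assoc_mult_mat[of _ n r _ n _ n]) auto
    also have "\<dots> = 0\<^sub>m n n" unfolding JQ using J(1) by simp
    finally show ?thesis unfolding left_mult_one_mat[OF Qc] using Qc by (intro eq_matI) auto
  qed
  then have "trace ?Q = trace (adj ?Q * ?Q)" using aQ by simp
  moreover have "trace ?Q = of_nat n - of_nat r"
    using trace_minus[of "1\<^sub>m n" n "J * adj J"] Q trace_mult_commute[OF J(1) adj_carrier[OF J(1)]] J(2) by simp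
  ultimately have "complex_of_real (real n - real r) = complex_of_real (\<Sum>i<n. \<Sum>k<n. (cmod (?Q $$ (k, i)))\<^sup>2)"
    using trace_adj_mult[OF Qc] by (simp only: of_real_diff of_real_of_nat_eq)
  then have "real n - real r = (\<Sum>i<n. \<Sum>k<n. (cmod (?Q $$ (k, i)))\<^sup>2)"
    by (simp only: of_real_eq_iff)
  moreover have "\<dots> \<ge> 0" by (intro sum_nonneg) auto
  ultimately show ?thesis by simp
qed

lemma mult_mat_zero_vec: "A \<in> carrier_mat m n \<Longrightarrow> A *\<^sub>v 0\<^sub>v n = (0\<^sub>v m :: complex vec)"
  by (intro eq_vecI) (auto simp: scalar_prod_def)

lemma zero_mult_mat_vec: "v \<in> carrier_vec n \<Longrightarrow> 0\<^sub>m m n *\<^sub>v v = (0\<^sub>v m :: complex vec)"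
  by (intro eq_vecI) (auto simp: scalar_prod_def)

definition append_column :: "complex mat \<Rightarrow> complex vec \<Rightarrow> complex mat" where
  "append_column J v = mat (dim_row J) (Suc (dim_col J)) (\<lambda>(i, j). if j < dim_col J then J $$ (i, j) else v $ i)"

lemma append_column_mult:
  assumes J: "J \<in> carrier_mat n r" and v: "v \<in> carrier_vec n" and y: "y \<in> carrier_vec (Suc r)"
  shows "append_column J v *\<^sub>v y = J *\<^sub>v vec r (\<lambda>i. y $ i) + (y $ r) \<cdot>\<^sub>v v"
proof (rule eq_vecI)
  fix i assume "i < dim_vec (J *\<^sub>v vec r (\<lambda>i. y $ i) + (y $ r) \<cdot>\<^sub>v v)"
  then have i: "i < n" using v by simp
  have "(append_column J v *\<^sub>v y) $ i = (\<Sum>j<Suc r. (if j < r then J $$ (i, j) else v $ i) * y $ j)"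
    using i J y unfolding append_column_def by (auto simp: scalar_prod_def atLeast0LessThan intro!: sum.cong)
  also have "\<dots> = (\<Sum>j<r. J $$ (i, j) * y $ j) + v $ i * y $ r" by simp
  also have "\<dots> = (J *\<^sub>v vec r (\<lambda>i. y $ i) + (y $ r) \<cdot>\<^sub>v v) $ i"
    using i J v by (auto simp: scalar_prod_def atLeast0LessThan intro!: sum.cong)
  finally show "(append_column J v *\<^sub>v y) $ i = (J *\<^sub>v vec r (\<lambda>i. y $ i) + (y $ r) \<cdot>\<^sub>v v) $ i" .
qed (use J v in \<open>auto simp: append_column_def\<close>)

text \<open>Take an isometry into the subspace whose rank is maximal.  A vector of the subspace outside its
  range could be projected, normalised and appended as a new column.\<close>

lemma subspace_isometry:
  assumes W: "VectorSpace.subspace class_ring W (module_vec TYPE(complex) n)"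
  obtains r J where "J \<in> carrier_mat n r" "adj J * J = 1\<^sub>m r"
    "\<And>y. y \<in> carrier_vec r \<Longrightarrow> J *\<^sub>v y \<in> W" "\<And>w. w \<in> W \<Longrightarrow> J * adj J *\<^sub>v w = w"
proof -
  note w = subspace_vecD[OF W]
  define P where "P r \<longleftrightarrow> (\<exists>J \<in> carrier_mat n r. adj J * J = 1\<^sub>m r \<and> (\<forall>y\<in>carrier_vec r. J *\<^sub>v y \<in> W))" for r
  have "P 0"
  proof -
    have "adj (0\<^sub>m n 0) * 0\<^sub>m n 0 = 1\<^sub>m 0" by (rule eq_matI) auto
    moreover have "0\<^sub>m n 0 *\<^sub>v y = 0\<^sub>v n" if "y \<in> carrier_vec 0" for y :: "complex vec"
      using that by (intro eq_vecI) (auto simp: scalar_prod_def)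
    ultimately show ?thesis unfolding P_def using w(2) by (intro bexI[of _ "0\<^sub>m n 0"]) auto
  qed
  moreover have bound: "r \<le> n" if "P r" for r using that isometry_dim_le unfolding P_def by blast
  ultimately obtain r where r: "P r" "\<And>s. P s \<Longrightarrow> s \<le> r" using Nat.ex_has_greatest_nat[of P 0 n] by auto
  then obtain J where J: "J \<in> carrier_mat n r" "adj J * J = 1\<^sub>m r" "\<And>y. y \<in> carrier_vec r \<Longrightarrow> J *\<^sub>v y \<in> W"
    unfolding P_def by blast
  have "J * adj J *\<^sub>v x = x" if x: "x \<in> W" for x
  proof (rule ccontr)
    assume ne: "J * adj J *\<^sub>v x \<noteq> x"
    have xc: "x \<in> carrier_vec n" using x w(1) by blast
    let ?p = "J *\<^sub>v (adj J *\<^sub>v x)"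
    have aJ: "adj J \<in> carrier_mat r n" using J(1) by simp
    have pe: "J * adj J *\<^sub>v x = ?p" using J(1) aJ xc by (rule assoc_mult_mat_vec)
    have pW: "?p \<in> W" by (rule J(3)) (use aJ xc in simp)
    have pc: "?p \<in> carrier_vec n" using pW w(1) by blast
    define u where "u = x + (-1) \<cdot>\<^sub>v ?p"
    have uW: "u \<in> W" unfolding u_def using x pW w(3,4) by blast
    have uc: "u \<in> carrier_vec n" using uW w(1) by blast
    have Ju: "adj J *\<^sub>v u = 0\<^sub>v r"
    proof -
      have "adj J *\<^sub>v u = adj J *\<^sub>v x + (-1) \<cdot>\<^sub>v (adj J *\<^sub>v ?p)"
        unfolding u_def using aJ xc pc by (simp add: mult_add_distrib_mat_vec mult_mat_vec)
      also have "adj J *\<^sub>v ?p = (adj J * J) *\<^sub>v (adj J *\<^sub>v x)"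
        by (rule assoc_mult_mat_vec[symmetric, OF aJ J(1) mult_mat_vec_carrier[OF aJ xc]])
      also have "\<dots> = adj J *\<^sub>v x" unfolding J(2) using aJ xc by (intro one_mult_mat_vec) auto
      also have "adj J *\<^sub>v x + (-1) \<cdot>\<^sub>v (adj J *\<^sub>v x) = 0\<^sub>v r" using aJ by (intro eq_vecI) auto
      finally show ?thesis .
    qed
    define N where "N = (\<Sum>i<n. (cmod (u $ i))\<^sup>2)"
    have "\<exists>i<n. u $ i \<noteq> 0"
    proof (rule ccontr)
      assume "\<not> ?thesis"
      then have z: "u $ i = 0" if "i < n" for i using that by blast
      have "?p = x"
      proof (rule eq_vecI)
        fix i assume "i < dim_vec x"
        then have i: "i < n" using xc by simp
        have "u $ i = x $ i - ?p $ i" unfolding u_def using i xc pc J(1) by simp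
        then show "?p $ i = x $ i" using z[OF i] by simp
      qed (use xc J(1) in simp)
      then show False using ne pe by simp
    qed
    then obtain i where i: "i < n" "u $ i \<noteq> 0" by blast
    have "0 < (cmod (u $ i))\<^sup>2" using i by simp
    also have "\<dots> \<le> N" unfolding N_def using i by (intro member_le_sum) auto
    finally have N: "N > 0" .
    define v where "v = complex_of_real (1 / sqrt N) \<cdot>\<^sub>v u"
    have vW: "v \<in> W" and vc: "v \<in> carrier_vec n" unfolding v_def using uW w(1,4) by blast+
    have vv: "(\<Sum>k<n. cnj (v $ k) * v $ k) = 1"
    proof -
      have "(\<Sum>k<n. cnj (v $ k) * v $ k) = (\<Sum>k<n. of_real (1 / N * (cmod (u $ k))\<^sup>2))"
      proof (rule sum.cong[OF refl])
        fix k assume "k \<in> {..<n}"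
        then have k: "v $ k = complex_of_real (1 / sqrt N) * u $ k" unfolding v_def using uc by simp
        have "cnj (v $ k) * v $ k = of_real ((cmod (v $ k))\<^sup>2)"
          by (subst complex_norm_square) (rule mult.commute)
        also have "(cmod (v $ k))\<^sup>2 = 1 / N * (cmod (u $ k))\<^sup>2"
          unfolding k using N by (simp add: norm_mult norm_divide power_mult_distrib power_divide)
        finally show "cnj (v $ k) * v $ k = of_real (1 / N * (cmod (u $ k))\<^sup>2)" .
      qed
      also have "\<dots> = of_real (1 / N * N)" unfolding N_def sum_distrib_left of_real_sum ..
      finally show ?thesis using N by simp
    qed
    have Jv: "(\<Sum>k<n. cnj (J $$ (k, j)) * v $ k) = 0" if j: "j < r" for j
    proof -
      have "adj J *\<^sub>v v = complex_of_real (1 / sqrt N) \<cdot>\<^sub>v (adj J *\<^sub>v u)"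
        unfolding v_def using aJ uc by (rule mult_mat_vec)
      also have "\<dots> = 0\<^sub>v r" unfolding Ju by (intro eq_vecI) auto
      finally have "adj J *\<^sub>v v = 0\<^sub>v r" .
      then have "(adj J *\<^sub>v v) $ j = 0" using j by simp
      moreover have "(adj J *\<^sub>v v) $ j = (\<Sum>k<n. cnj (J $$ (k, j)) * v $ k)"
        using j J(1) vc by (auto simp: scalar_prod_def atLeast0LessThan intro!: sum.cong)
      ultimately show ?thesis by simp
    qed
    let ?J = "append_column J v"
    have Jc: "?J \<in> carrier_mat n (Suc r)" unfolding append_column_def using J(1) by auto
    have JJ: "(\<Sum>k<n. cnj (J $$ (k, i)) * J $$ (k, j)) = (if i = j then 1 else 0)" if ij: "i < r" "j < r" for i j
    proof -
      have "(adj J * J) $$ (i, j) = (\<Sum>k<n. adj J $$ (i, k) * J $$ (k, j))" by (rule mat_mult_index[OF aJ J(1) ij])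
      also have "\<dots> = (\<Sum>k<n. cnj (J $$ (k, i)) * J $$ (k, j))" using J(1) ij by (intro sum.cong refl) auto
      finally show ?thesis using J(2) ij by simp
    qed
    have "adj ?J * ?J = 1\<^sub>m (Suc r)"
    proof (rule eq_matI)
      fix i j assume "i < dim_row (1\<^sub>m (Suc r))" "j < dim_col (1\<^sub>m (Suc r))"
      then have ij: "i < Suc r" "j < Suc r" by auto
      let ?c = "\<lambda>j k. if j < r then J $$ (k, j) else v $ k"
      have "(adj ?J * ?J) $$ (i, j) = (\<Sum>k<n. adj ?J $$ (i, k) * ?J $$ (k, j))"
        by (rule mat_mult_index[OF adj_carrier[OF Jc] Jc ij])
      also have "\<dots> = (\<Sum>k<n. cnj (?c i k) * ?c j k)"
        using Jc J(1) ij by (intro sum.cong refl) (auto simp: append_column_def)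
      also have "\<dots> = (if i = j then 1 else 0)"
      proof (cases "i < r"; cases "j < r")
        assume "i < r" "\<not> j < r"
        then show ?thesis using Jv[of i] ij by simp
      next
        assume a: "\<not> i < r" "j < r"
        have "(\<Sum>k<n. cnj (v $ k) * J $$ (k, j)) = cnj (\<Sum>k<n. cnj (J $$ (k, j)) * v $ k)"
          by (simp add: cnj_sum mult.commute)
        then show ?thesis using Jv[of j] a by auto
      qed (use JJ vv ij in auto)
      finally show "(adj ?J * ?J) $$ (i, j) = 1\<^sub>m (Suc r) $$ (i, j)" using ij by simp
    qed (use Jc in auto)
    moreover have "?J *\<^sub>v y \<in> W" if y: "y \<in> carrier_vec (Suc r)" for y
      unfolding append_column_mult[OF J(1) vc y] using J(3) vW w(3,4) by simp
    ultimately have "P (Suc r)" unfolding P_def using Jc by blast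
    then show False using r(2)[of "Suc r"] by simp
  qed
  then show ?thesis using that[OF J] by blast
qed

text \<open>If the range of \<open>J\<close> is invariant, \<open>JJ\<^sup>*\<close> can be inserted between two factors, so the compression
  is multiplicative; being compatible with adjoints, it is unitary.\<close>

lemma (in group) compress_rep:
  assumes rho: "unitary_rep G n \<rho>" and J: "J \<in> carrier_mat n r" "adj J * J = 1\<^sub>m r"
    and inv: "\<And>g. g \<in> carrier G \<Longrightarrow> \<rho> g * J = J * (adj J * \<rho> g * J)"
  shows "unitary_rep G r (\<lambda>g. adj J * \<rho> g * J)"
proof -
  note \<rho> = unitary_repD[OF rho]
  let ?s = "\<lambda>g. adj J * \<rho> g * J"
  have aJ: "adj J \<in> carrier_mat r n" using J(1) by simp
  have c: "?s g \<in> carrier_mat r r" if "g \<in> carrier G" for g using \<rho>(1)[OF that] aJ J(1) by auto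
  have m: "?s (g \<otimes> h) = ?s g * ?s h" if g: "g \<in> carrier G" and h: "h \<in> carrier G" for g h
  proof -
    have "?s (g \<otimes> h) = adj J * (\<rho> g * (\<rho> h * J))"
      unfolding \<rho>(4)[OF g h] using aJ J(1) \<rho>(1)[OF g] \<rho>(1)[OF h]
      by (simp add: assoc_mult_mat[of _ n n _ n _ n] assoc_mult_mat[of _ r n _ n _ r] assoc_mult_mat[of _ n n _ n _ r])
    also have "\<dots> = adj J * (\<rho> g * (J * ?s h))" unfolding inv[OF h] ..
    also have "\<dots> = adj J * (\<rho> g * J * ?s h)" using \<rho>(1)[OF g] J(1) c[OF h] by (simp add: assoc_mult_mat[of _ n n _ r _ r])
    also have "\<dots> = adj J * (\<rho> g * J) * ?s h" using \<rho>(1)[OF g] J(1) aJ c[OF h] by (intro assoc_mult_mat[symmetric, of _ r n _ r _ r]) auto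
    also have "adj J * (\<rho> g * J) = ?s g" using \<rho>(1)[OF g] J(1) aJ by (intro assoc_mult_mat[symmetric, of _ r n _ n _ r]) auto
    finally show ?thesis .
  qed
  have o: "?s \<one> = 1\<^sub>m r" unfolding unitary_rep_one[OF rho] using aJ J by simp
  have a: "adj (?s g) = ?s (inv g)" if g: "g \<in> carrier G" for g
  proof -
    have "adj (?s g) = adj J * adj (adj J * \<rho> g)"
      by (rule adj_mult[of _ r n _ r]) (use \<rho>(1)[OF g] aJ J(1) in auto)
    also have "adj (adj J * \<rho> g) = adj (\<rho> g) * J" using adj_mult[OF aJ \<rho>(1)[OF g]] by simp
    also have "adj (\<rho> g) = \<rho> (inv g)" using unitary_rep_inv[OF rho g] by simp
    also have "adj J * (\<rho> (inv g) * J) = ?s (inv g)"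
      using \<rho>(1)[of "inv g"] g J(1) aJ by (intro assoc_mult_mat[symmetric, of _ r n _ n _ r]) auto
    finally show ?thesis .
  qed
  show ?thesis
  proof (rule unitary_repI)
    fix g assume g: "g \<in> carrier G"
    show "?s g * adj (?s g) = 1\<^sub>m r" "adj (?s g) * ?s g = 1\<^sub>m r"
      unfolding a[OF g] using m[of g "inv g"] m[of "inv g" g] g o by auto
  qed (use c m in auto)
qed

text \<open>For a unitary representation the orthogonal complement \<open>V\<close> of an invariant subspace \<open>W\<close> is
  invariant.  Isometries \<open>J\<close> and \<open>L\<close> onto \<open>W\<close> and \<open>V\<close> split the space, and since neither subspace is
  zero, comparing traces shows that both have smaller dimension.\<close>

lemma (in group) reducible_decomposition:
  assumes rho: "unitary_rep G n \<rho>" and n: "n > 0" and red: "\<not> irreducible_rep G n \<rho>"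
  obtains r J s L where "r < n" "s < n" "J \<in> carrier_mat n r" "L \<in> carrier_mat n s"
    "adj J * J = 1\<^sub>m r" "adj L * L = 1\<^sub>m s" "J * adj J + L * adj L = 1\<^sub>m n"
    "\<And>g. g \<in> carrier G \<Longrightarrow> \<rho> g * J = J * (adj J * \<rho> g * J)"
    "\<And>g. g \<in> carrier G \<Longrightarrow> \<rho> g * L = L * (adj L * \<rho> g * L)"
proof -
  note \<rho> = unitary_repD[OF rho]
  obtain W where W: "VectorSpace.subspace class_ring W (module_vec TYPE(complex) n)"
    "\<forall>g\<in>carrier G. \<forall>w\<in>W. \<rho> g *\<^sub>v w \<in> W" "W \<noteq> {0\<^sub>v n}" "W \<noteq> carrier_vec n"
    using red rho n unfolding irreducible_rep_def by blast
  note w = subspace_vecD[OF W(1)]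
  obtain r J where J: "J \<in> carrier_mat n r" "adj J * J = 1\<^sub>m r"
    "\<And>y. y \<in> carrier_vec r \<Longrightarrow> J *\<^sub>v y \<in> W" "\<And>x. x \<in> W \<Longrightarrow> J * adj J *\<^sub>v x = x"
    using subspace_isometry[OF W(1)] by metis
  have aJ: "adj J \<in> carrier_mat r n" using J(1) by simp
  have invariant: "\<rho> g * K = K * (adj K * \<rho> g * K)"
    if K: "K \<in> carrier_mat n q" "\<And>y. y \<in> carrier_vec q \<Longrightarrow> K *\<^sub>v y \<in> U" "\<And>x. x \<in> U \<Longrightarrow> K * adj K *\<^sub>v x = x"
      and U: "\<And>x. x \<in> U \<Longrightarrow> \<rho> g *\<^sub>v x \<in> U" and g: "g \<in> carrier G" for K q U g
  proof -
    have aK: "adj K \<in> carrier_mat q n" using K(1) by simp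
    have KK: "K * adj K \<in> carrier_mat n n" using K(1) aK by auto
    have e: "K * (adj K * \<rho> g * K) = K * adj K * (\<rho> g * K)"
      using K(1) aK \<rho>(1)[OF g]
      by (simp add: assoc_mult_mat[of _ q n _ n _ q] assoc_mult_mat[of _ n q _ n _ q])
    show ?thesis unfolding e
    proof (rule mat_eq_via_vec[of _ n q])
      show "\<rho> g * K \<in> carrier_mat n q" "K * adj K * (\<rho> g * K) \<in> carrier_mat n q"
        using K(1) KK \<rho>(1)[OF g] by auto
      fix y :: "complex vec" assume y: "y \<in> carrier_vec q"
      have m: "(\<rho> g * K) *\<^sub>v y = \<rho> g *\<^sub>v (K *\<^sub>v y)" using \<rho>(1)[OF g] K(1) y by (rule assoc_mult_mat_vec)
      have "K * adj K * (\<rho> g * K) *\<^sub>v y = K * adj K *\<^sub>v ((\<rho> g * K) *\<^sub>v y)"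
        using KK \<rho>(1)[OF g] K(1) y by (intro assoc_mult_mat_vec[of _ n n _ q]) auto
      then show "(\<rho> g * K) *\<^sub>v y = K * adj K * (\<rho> g * K) *\<^sub>v y"
        unfolding m using K(3)[OF U[OF K(2)[OF y]]] by simp
    qed
  qed
  have Jinv: "\<rho> g * J = J * (adj J * \<rho> g * J)" if "g \<in> carrier G" for g
    by (rule invariant[OF J(1,3,4) _ that]) (use W(2) that in auto)
  define V where "V = {v \<in> carrier_vec n. adj J *\<^sub>v v = 0\<^sub>v r}"
  have V: "VectorSpace.subspace class_ring V (module_vec TYPE(complex) n)"
  proof (rule subspace_vecI)
    show "v + u \<in> V" if "v \<in> V" "u \<in> V" for v u
      using that aJ unfolding V_def by (auto simp: mult_add_distrib_mat_vec)
    show "d \<cdot>\<^sub>v v \<in> V" if "v \<in> V" for d v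
      using that aJ unfolding V_def by (auto simp: mult_mat_vec)
  qed (use mult_mat_zero_vec[OF aJ] in \<open>auto simp: V_def\<close>)
  obtain s L where L: "L \<in> carrier_mat n s" "adj L * L = 1\<^sub>m s"
    "\<And>y. y \<in> carrier_vec s \<Longrightarrow> L *\<^sub>v y \<in> V" "\<And>x. x \<in> V \<Longrightarrow> L * adj L *\<^sub>v x = x"
    using subspace_isometry[OF V] by metis
  have aL: "adj L \<in> carrier_mat s n" using L(1) by simp
  have Vinv: "\<rho> g *\<^sub>v v \<in> V" if g: "g \<in> carrier G" and v: "v \<in> V" for g v
  proof -
    have i: "inv g \<in> carrier G" using g by simp
    let ?t = "adj J * \<rho> (inv g) * J"
    have t: "?t \<in> carrier_mat r r" using \<rho>(1)[OF i] aJ J(1) by auto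
    have "adj (\<rho> (inv g) * J) = adj (J * ?t)" using Jinv[OF i] by simp
    then have "adj J * \<rho> g = adj ?t * adj J"
      using adj_mult[OF \<rho>(1)[OF i] J(1)] adj_mult[OF J(1) t] unitary_rep_inv[OF rho g] by simp
    then have "adj J *\<^sub>v (\<rho> g *\<^sub>v v) = adj ?t *\<^sub>v (adj J *\<^sub>v v)"
      using assoc_mult_mat_vec[OF aJ \<rho>(1)[OF g], of v] assoc_mult_mat_vec[OF adj_carrier[OF t] aJ, of v] v
      unfolding V_def by simp
    then show ?thesis using v \<rho>(1)[OF g] mult_mat_zero_vec[OF adj_carrier[OF t]] unfolding V_def by auto
  qed
  have Linv: "\<rho> g * L = L * (adj L * \<rho> g * L)" if "g \<in> carrier G" for g
    by (rule invariant[OF L(1,3,4) Vinv[OF that] that])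
  have JJ: "J * adj J \<in> carrier_mat n n" and LL: "L * adj L \<in> carrier_mat n n" using J(1) L(1) aJ aL by auto
  have JL: "adj J * L = 0\<^sub>m r s"
  proof (rule mat_eq_via_vec[of _ r s])
    fix y :: "complex vec" assume y: "y \<in> carrier_vec s"
    have "adj J * L *\<^sub>v y = adj J *\<^sub>v (L *\<^sub>v y)" using aJ L(1) y by (rule assoc_mult_mat_vec)
    then show "adj J * L *\<^sub>v y = 0\<^sub>m r s *\<^sub>v y" using L(3)[OF y] y unfolding V_def by auto
  qed (use aJ L(1) in auto)
  have LJ: "adj L * J = 0\<^sub>m s r"
  proof -
    have "adj (adj J * L) = adj (0\<^sub>m r s)" unfolding JL ..
    moreover have "adj (0\<^sub>m r s) = 0\<^sub>m s r" by (rule eq_matI) auto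
    ultimately show ?thesis using adj_mult[OF aJ L(1)] by simp
  qed
  have sum: "J * adj J + L * adj L = 1\<^sub>m n"
  proof (rule mat_eq_via_vec[of _ n n])
    fix v :: "complex vec" assume v: "v \<in> carrier_vec n"
    let ?p = "J *\<^sub>v (adj J *\<^sub>v v)"
    have aJv: "adj J *\<^sub>v v \<in> carrier_vec r" by (rule mult_mat_vec_carrier[OF aJ v])
    then have pc: "?p \<in> carrier_vec n" by (rule mult_mat_vec_carrier[OF J(1)])
    define u where "u = v + (-1) \<cdot>\<^sub>v ?p"
    have uc: "u \<in> carrier_vec n" unfolding u_def using v pc by simp
    have "adj J *\<^sub>v u = adj J *\<^sub>v v + (-1) \<cdot>\<^sub>v (adj J *\<^sub>v ?p)"
      unfolding u_def using aJ v pc by (simp add: mult_add_distrib_mat_vec mult_mat_vec)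
    also have "adj J *\<^sub>v ?p = (adj J * J) *\<^sub>v (adj J *\<^sub>v v)" using aJ J(1) aJv by (intro assoc_mult_mat_vec[symmetric]) auto
    also have "\<dots> = adj J *\<^sub>v v" unfolding J(2) using aJv by simp
    also have "adj J *\<^sub>v v + (-1) \<cdot>\<^sub>v (adj J *\<^sub>v v) = 0\<^sub>v r" using aJ by (intro eq_vecI) auto
    finally have "u \<in> V" unfolding V_def using uc by simp
    then have Lu: "L * adj L *\<^sub>v u = u" by (rule L(4))
    have LLp: "L * adj L *\<^sub>v ?p = 0\<^sub>v n"
    proof -
      have "L * adj L *\<^sub>v ?p = L *\<^sub>v (adj L *\<^sub>v ?p)" using L(1) aL pc by (rule assoc_mult_mat_vec)
      also have "adj L *\<^sub>v ?p = (adj L * J) *\<^sub>v (adj J *\<^sub>v v)" using aL J(1) aJv by (intro assoc_mult_mat_vec[symmetric]) auto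
      also have "\<dots> = 0\<^sub>v s" unfolding LJ using aJv by auto
      finally show ?thesis using L(1) by auto
    qed
    have "L * adj L *\<^sub>v u = L * adj L *\<^sub>v v + (-1) \<cdot>\<^sub>v (L * adj L *\<^sub>v ?p)"
      unfolding u_def using LL v pc by (simp add: mult_add_distrib_mat_vec mult_mat_vec)
    also have "\<dots> = L * adj L *\<^sub>v v" unfolding LLp using LL v by (intro eq_vecI) auto
    finally have "L * adj L *\<^sub>v v = u" unfolding Lu by simp
    moreover have "J * adj J *\<^sub>v v = ?p" using J(1) aJ v by (rule assoc_mult_mat_vec)
    ultimately have "(J * adj J + L * adj L) *\<^sub>v v = ?p + u"
      using JJ LL v by (simp add: add_mult_distrib_mat_vec[of _ n n])
    also have "\<dots> = v" unfolding u_def using v pc J(1) by (intro eq_vecI) auto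
    finally show "(J * adj J + L * adj L) *\<^sub>v v = 1\<^sub>m n *\<^sub>v v" using v by simp
  qed (use JJ LL in auto)
  have "trace (J * adj J) = of_nat r" "trace (L * adj L) = of_nat s"
    using trace_mult_commute[OF J(1) aJ] trace_mult_commute[OF L(1) aL] J(2) L(2) by auto
  then have "of_nat r + of_nat s = (of_nat n :: complex)"
    using trace_add[OF JJ LL] unfolding sum by simp
  then have rs: "r + s = n" by (metis of_nat_add of_nat_eq_iff)
  have "r \<noteq> 0"
  proof
    assume r: "r = 0"
    have "x = 0\<^sub>v n" if x: "x \<in> W" for x
    proof -
      have "J * adj J = 0\<^sub>m n n" using J(1) r by (intro eq_matI) (auto simp: scalar_prod_def)
      then have "0\<^sub>m n n *\<^sub>v x = x" using J(4)[OF x] by simp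
      then show ?thesis using zero_mult_mat_vec[of x n n] subsetD[OF w(1) x] by simp
    qed
    then show False using W(3) w(2) by blast
  qed
  moreover have "s \<noteq> 0"
  proof
    assume s: "s = 0"
    have "L * adj L = 0\<^sub>m n n" using L(1) s by (intro eq_matI) (auto simp: scalar_prod_def)
    then have J1: "J * adj J = 1\<^sub>m n" using sum JJ by simp
    have "x \<in> W" if x: "x \<in> carrier_vec n" for x
    proof -
      have "x = J *\<^sub>v (adj J *\<^sub>v x)" using assoc_mult_mat_vec[OF J(1) aJ x] J1 x by simp
      then show ?thesis using J(3)[of "adj J *\<^sub>v x"] aJ x by auto
    qed
    then show False using W(4) w(1) by blast
  qed
  ultimately have "r < n" "s < n" using rs by auto
  then show ?thesis using that J(1,2) L(1,2) sum Jinv Linv by blast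
qed

section \<open>Completeness of matrix coefficients\<close>

text \<open>The dimension, read off from the identity matrix \<open>\<rho>(\<one>)\<close>; it allows index sets that consist of
  representations.\<close>

definition rep_dim :: "('a, 'b) monoid_scheme \<Rightarrow> ('a \<Rightarrow> complex mat) \<Rightarrow> nat" where
  "rep_dim G \<rho> = dim_row (\<rho> \<one>\<^bsub>G\<^esub>)"

text \<open>The members of \<open>\<R>\<close> index the sum themselves, so each of them occurs with a single coefficient
  matrix.\<close>

definition coefficient_sum ::
    "('a, 'b) monoid_scheme \<Rightarrow> ('a \<Rightarrow> complex mat) set \<Rightarrow> ('a \<Rightarrow> complex) \<Rightarrow> bool" where
  "coefficient_sum G \<R> f \<longleftrightarrow> (\<exists>I B. finite I \<and> I \<subseteq> \<R> \<and>
     (\<forall>r\<in>I. B r \<in> carrier_mat (rep_dim G r) (rep_dim G r)) \<and>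
     (\<forall>g\<in>carrier G. f g = (\<Sum>r\<in>I. trace (B r * r g))))"

context group
begin

lemma rep_dim_eq: "unitary_rep G n \<rho> \<Longrightarrow> rep_dim G \<rho> = n"
  unfolding rep_dim_def by (simp add: unitary_rep_one)

lemma rep_equivD:
  assumes "rep_equiv G \<rho> \<sigma>" "unitary_rep G n \<rho>"
  obtains U where "unitary_rep G n \<sigma>" "U \<in> carrier (unitary_group n)"
    "\<And>g. g \<in> carrier G \<Longrightarrow> U * \<rho> g = \<sigma> g * U"
proof -
  obtain m U where m: "unitary_rep G m \<rho>" "unitary_rep G m \<sigma>" "U \<in> carrier (unitary_group m)"
    "\<forall>g\<in>carrier G. U * \<rho> g = \<sigma> g * U" using assms(1) unfolding rep_equiv_def by blast
  have "m = n" using rep_dim_eq[OF m(1)] rep_dim_eq[OF assms(2)] by simp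
  then show ?thesis using m that by blast
qed

lemma rep_equiv_refl: "unitary_rep G n \<rho> \<Longrightarrow> rep_equiv G \<rho> \<rho>"
  unfolding rep_equiv_def
proof (intro exI[of _ n] conjI bexI[of _ "1\<^sub>m n"] ballI)
  assume r: "unitary_rep G n \<rho>"
  show "1\<^sub>m n \<in> carrier (unitary_group n)" by (rule unitary_groupI) auto
  show "1\<^sub>m n * \<rho> g = \<rho> g * 1\<^sub>m n" if "g \<in> carrier G" for g using unitary_repD(1)[OF r that] by simp
qed

lemma conjugate_by_unitary:
  assumes U: "U \<in> carrier (unitary_group n)" and A: "A \<in> carrier_mat n n" and B: "B \<in> carrier_mat n n"
    and e: "U * A = B * U"
  shows "A = adj U * B * U" "adj U * B = A * adj U"
proof -
  note u = unitary_groupD[OF U]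
  have "A = adj U * U * A" using u A by simp
  also have "\<dots> = adj U * (U * A)" using u A by (intro assoc_mult_mat[of _ n n _ n _ n]) auto
  also have "\<dots> = adj U * B * U" unfolding e using u B by (intro assoc_mult_mat[symmetric, of _ n n _ n _ n]) auto
  finally show A': "A = adj U * B * U" .
  have "A * adj U = adj U * B * U * adj U" using A' by simp
  also have "\<dots> = adj U * B * (U * adj U)" using u B by (intro assoc_mult_mat[of _ n n _ n _ n]) auto
  also have "\<dots> = adj U * B" using u B right_mult_one_mat[of "adj U * B" n n] by simp
  finally show "adj U * B = A * adj U" by simp
qed

lemma rep_equiv_sym:
  assumes "rep_equiv G \<rho> \<sigma>" shows "rep_equiv G \<sigma> \<rho>"
proof -
  obtain n where "unitary_rep G n \<rho>" using assms unfolding rep_equiv_def by blast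
  then obtain U where r: "unitary_rep G n \<rho>" and U: "unitary_rep G n \<sigma>" "U \<in> carrier (unitary_group n)"
    "\<And>g. g \<in> carrier G \<Longrightarrow> U * \<rho> g = \<sigma> g * U" using rep_equivD[OF assms] by metis
  have "adj U * \<sigma> g = \<rho> g * adj U" if g: "g \<in> carrier G" for g
    by (rule conjugate_by_unitary(2)[OF U(2) unitary_repD(1)[OF r g] unitary_repD(1)[OF U(1) g] U(3)[OF g]])
  moreover have "adj U \<in> carrier (unitary_group n)"
    using unitary_groupD[OF U(2)] by (intro unitary_groupI) auto
  ultimately show ?thesis using r U(1) unfolding rep_equiv_def by blast
qed

lemma rep_equiv_trans:
  assumes "rep_equiv G \<rho> \<sigma>" "rep_equiv G \<sigma> \<tau>" shows "rep_equiv G \<rho> \<tau>"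
proof -
  obtain n where r: "unitary_rep G n \<rho>" using assms(1) unfolding rep_equiv_def by blast
  obtain U where U: "unitary_rep G n \<sigma>" "U \<in> carrier (unitary_group n)"
    "\<And>g. g \<in> carrier G \<Longrightarrow> U * \<rho> g = \<sigma> g * U" using rep_equivD[OF assms(1) r] by metis
  obtain W where W: "unitary_rep G n \<tau>" "W \<in> carrier (unitary_group n)"
    "\<And>g. g \<in> carrier G \<Longrightarrow> W * \<sigma> g = \<tau> g * W" using rep_equivD[OF assms(2) U(1)] by metis
  note u = unitary_groupD[OF U(2)] and w = unitary_groupD[OF W(2)]
  have "(W * U) * \<rho> g = \<tau> g * (W * U)" if g: "g \<in> carrier G" for g
  proof -
    note c = unitary_repD(1)[OF r g] unitary_repD(1)[OF U(1) g] unitary_repD(1)[OF W(1) g]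
    have "(W * U) * \<rho> g = W * (U * \<rho> g)" using u(1) w(1) c by (intro assoc_mult_mat[of _ n n _ n _ n]) auto
    also have "\<dots> = (W * \<sigma> g) * U"
      unfolding U(3)[OF g] using u(1) w(1) c by (intro assoc_mult_mat[symmetric, of _ n n _ n _ n]) auto
    also have "\<dots> = \<tau> g * (W * U)"
      unfolding W(3)[OF g] using u(1) w(1) c by (intro assoc_mult_mat[of _ n n _ n _ n]) auto
    finally show ?thesis .
  qed
  moreover have "W * U \<in> carrier (unitary_group n)"
  proof (rule unitary_groupI)
    show "W * U \<in> carrier_mat n n" by (rule mult_carrier_mat[OF w(1) u(1)])
    have "adj (W * U) * (W * U) = adj U * (adj W * (W * U))"
      unfolding adj_mult[OF w(1) u(1)] using u(1) w(1) by (intro assoc_mult_mat[of _ n n _ n _ n]) auto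
    also have "adj W * (W * U) = adj W * W * U" using u(1) w(1) by (intro assoc_mult_mat[symmetric, of _ n n _ n _ n]) auto
    also have "\<dots> = U" unfolding w(2) using u(1) by simp
    finally show "adj (W * U) * (W * U) = 1\<^sub>m n" using u(2) by simp
  qed
  ultimately show ?thesis using r W(1) unfolding rep_equiv_def by blast
qed

lemma rep_equiv_comp:
  assumes "\<phi> \<in> hom G G" "rep_equiv G \<rho> \<sigma>" shows "rep_equiv G (\<rho> \<circ> \<phi>) (\<sigma> \<circ> \<phi>)"
proof -
  have c: "\<phi> g \<in> carrier G" if "g \<in> carrier G" for g using assms(1) that unfolding hom_def by blast
  have "unitary_rep G n (\<tau> \<circ> \<phi>)" if \<tau>: "unitary_rep G n \<tau>" for n \<tau>
    by (rule unitary_repI) (use unitary_repD[OF \<tau>] c hom_mult[OF assms(1)] in auto)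
  note comp = this
  obtain n where r: "unitary_rep G n \<rho>" using assms(2) unfolding rep_equiv_def by blast
  obtain U where U: "unitary_rep G n \<sigma>" "U \<in> carrier (unitary_group n)"
    "\<And>g. g \<in> carrier G \<Longrightarrow> U * \<rho> g = \<sigma> g * U" using rep_equivD[OF assms(2) r] by metis
  have "\<forall>g\<in>carrier G. U * (\<rho> \<circ> \<phi>) g = (\<sigma> \<circ> \<phi>) g * U" using U(3)[OF c] by simp
  then show ?thesis unfolding rep_equiv_def using comp[OF r] comp[OF U(1)] U(2) by blast
qed

lemma rep_equiv_finite_image:
  assumes "rep_equiv G \<rho> \<sigma>" "finite (\<sigma> ` carrier G)" shows "finite (\<rho> ` carrier G)"
proof -
  obtain n where r: "unitary_rep G n \<rho>" using assms(1) unfolding rep_equiv_def by blast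
  obtain U where U: "unitary_rep G n \<sigma>" "U \<in> carrier (unitary_group n)"
    "\<And>g. g \<in> carrier G \<Longrightarrow> U * \<rho> g = \<sigma> g * U" using rep_equivD[OF assms(1) r] by metis
  have "\<rho> g = adj U * \<sigma> g * U" if g: "g \<in> carrier G" for g
    by (rule conjugate_by_unitary(1)[OF U(2) unitary_repD(1)[OF r g] unitary_repD(1)[OF U(1) g] U(3)[OF g]])
  then have "\<rho> ` carrier G \<subseteq> (\<lambda>M. adj U * M * U) ` \<sigma> ` carrier G" by auto
  then show ?thesis using assms(2) finite_subset by blast
qed

lemma coefficient_sum_add:
  assumes R: "\<And>r. r \<in> \<R> \<Longrightarrow> unitary_rep G (rep_dim G r) r"
    and f: "coefficient_sum G \<R> f" and h: "coefficient_sum G \<R> h"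
  shows "coefficient_sum G \<R> (\<lambda>g. f g + h g)"
proof -
  let ?d = "rep_dim G"
  obtain I B where I: "finite I" "I \<subseteq> \<R>" "\<forall>r\<in>I. B r \<in> carrier_mat (?d r) (?d r)"
    "\<forall>g\<in>carrier G. f g = (\<Sum>r\<in>I. trace (B r * r g))"
    using f unfolding coefficient_sum_def by blast
  obtain I' B' where I': "finite I'" "I' \<subseteq> \<R>" "\<forall>r\<in>I'. B' r \<in> carrier_mat (?d r) (?d r)"
    "\<forall>g\<in>carrier G. h g = (\<Sum>r\<in>I'. trace (B' r * r g))"
    using h unfolding coefficient_sum_def by blast
  define D where "D r = (if r \<in> I then B r else 0\<^sub>m (?d r) (?d r))" for r
  define D' where "D' r = (if r \<in> I' then B' r else 0\<^sub>m (?d r) (?d r))" for r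
  have Dc: "D r \<in> carrier_mat (?d r) (?d r)" "D' r \<in> carrier_mat (?d r) (?d r)" for r
    unfolding D_def D'_def using I(3) I'(3) by auto
  have "f g + h g = (\<Sum>r\<in>I \<union> I'. trace ((D r + D' r) * r g))" if g: "g \<in> carrier G" for g
  proof -
    have z: "trace (0\<^sub>m (?d r) (?d r) * r g) = 0" if "r \<in> I \<union> I'" for r
    proof -
      have "r g \<in> carrier_mat (?d r) (?d r)" using unitary_repD(1)[OF R g] that I(2) I'(2) by blast
      then show ?thesis by (simp add: trace_def)
    qed
    have "(\<Sum>r\<in>I \<union> I'. trace ((D r + D' r) * r g)) = (\<Sum>r\<in>I \<union> I'. trace (D r * r g) + trace (D' r * r g))"
    proof (rule sum.cong[OF refl])
      fix r assume "r \<in> I \<union> I'"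
      then have rg: "r g \<in> carrier_mat (?d r) (?d r)" using unitary_repD(1)[OF R g] I(2) I'(2) by blast
      have "(D r + D' r) * r g = D r * r g + D' r * r g" by (rule add_mult_distrib_mat[OF Dc rg])
      then show "trace ((D r + D' r) * r g) = trace (D r * r g) + trace (D' r * r g)"
        using trace_add[OF mult_carrier_mat[OF Dc(1) rg] mult_carrier_mat[OF Dc(2) rg]] by simp
    qed
    also have "\<dots> = (\<Sum>r\<in>I \<union> I'. trace (D r * r g)) + (\<Sum>r\<in>I \<union> I'. trace (D' r * r g))" by (rule sum.distrib)
    also have "(\<Sum>r\<in>I \<union> I'. trace (D r * r g)) = (\<Sum>r\<in>I. trace (B r * r g))"
      by (rule sum.mono_neutral_cong_right) (use I(1) I'(1) z in \<open>auto simp: D_def\<close>)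
    also have "(\<Sum>r\<in>I \<union> I'. trace (D' r * r g)) = (\<Sum>r\<in>I'. trace (B' r * r g))"
      by (rule sum.mono_neutral_cong_right) (use I(1) I'(1) z in \<open>auto simp: D'_def\<close>)
    finally show ?thesis using I(4) I'(4) g by simp
  qed
  moreover have "\<forall>r\<in>I \<union> I'. D r + D' r \<in> carrier_mat (?d r) (?d r)" using Dc by simp
  ultimately show ?thesis unfolding coefficient_sum_def using I(1,2) I'(1,2)
    by (intro exI[of _ "I \<union> I'"] exI[of _ "\<lambda>r. D r + D' r"]) blast
qed

lemma coefficient_sum_cong:
  assumes "coefficient_sum G \<R> f" "\<And>g. g \<in> carrier G \<Longrightarrow> h g = f g"
  shows "coefficient_sum G \<R> h"
  using assms unfolding coefficient_sum_def by simp

text \<open>Induction on the dimension: inserting \<open>1 = JJ\<^sup>* + LL\<^sup>*\<close> into a coefficient of a reducible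
  representation gives coefficients of its two compressions, and a coefficient of an irreducible one
  is turned into a coefficient of the equivalent member of \<open>\<R>\<close>.  The set \<open>V\<close> keeps track of the
  kernel: compressions of a representation are trivial wherever the representation is.\<close>

theorem coefficients_complete:
  assumes R: "\<And>r. r \<in> \<R> \<Longrightarrow> unitary_rep G (rep_dim G r) r"
    and cover: "\<And>m \<tau>. irreducible_rep G m \<tau> \<Longrightarrow> (\<And>v. v \<in> V \<Longrightarrow> \<tau> v = 1\<^sub>m m) \<Longrightarrow> \<exists>r\<in>\<R>. rep_equiv G r \<tau>"
    and V: "V \<subseteq> carrier G"
    and rho: "unitary_rep G n \<rho>" "\<And>v. v \<in> V \<Longrightarrow> \<rho> v = 1\<^sub>m n" and A: "A \<in> carrier_mat n n"
  shows "coefficient_sum G \<R> (\<lambda>g. trace (A * \<rho> g))"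
  using rho A
proof (induction n arbitrary: \<rho> A rule: less_induct)
  case (less n)
  note r = unitary_repD[OF less.prems(1)]
  consider "n = 0" | "irreducible_rep G n \<rho>" | "n > 0" "\<not> irreducible_rep G n \<rho>" by blast
  then show ?case
  proof cases
    case 1
    then have "trace (A * \<rho> g) = 0" if "g \<in> carrier G" for g
      using less.prems(3) by (simp add: trace_def)
    then show ?thesis unfolding coefficient_sum_def by (intro exI[of _ "{}"]) auto
  next
    case 2
    then obtain q where q: "q \<in> \<R>" "rep_equiv G q \<rho>" using cover less.prems(2) by blast
    obtain U where U: "unitary_rep G (rep_dim G q) \<rho>" "U \<in> carrier (unitary_group (rep_dim G q))"
      "\<And>g. g \<in> carrier G \<Longrightarrow> U * q g = \<rho> g * U" using rep_equivD[OF q(2) R[OF q(1)]] by metis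
    have d: "rep_dim G q = n" using rep_dim_eq[OF U(1)] rep_dim_eq[OF less.prems(1)] by simp
    note u = unitary_groupD[OF U(2)[unfolded d]]
    have aU: "adj U \<in> carrier_mat n n" using u(1) by simp
    note AA = less.prems(3)
    have tr: "trace (A * \<rho> g) = trace (adj U * A * U * q g)" if g: "g \<in> carrier G" for g
    proof -
      have qg: "q g \<in> carrier_mat n n" using unitary_repD(1)[OF R[OF q(1)] g] d by simp
      note as = assoc_mult_mat[of _ n n _ n _ n]
      have "A * \<rho> g = A * \<rho> g * (U * adj U)" using u AA r(1)[OF g] right_mult_one_mat[of "A * \<rho> g" n n] by simp
      also have "\<dots> = A * (\<rho> g * U) * adj U" using u AA r(1)[OF g] aU by (simp add: as)
      also have "\<dots> = A * (U * q g) * adj U" using U(3)[OF g] by simp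
      finally have "trace (A * \<rho> g) = trace (A * (U * q g) * adj U)" by simp
      also have "\<dots> = trace (adj U * (A * (U * q g)))"
        by (rule trace_mult_commute[of _ n n]) (use u AA qg aU in auto)
      also have "adj U * (A * (U * q g)) = adj U * A * U * q g" using u AA qg aU by (simp add: as)
      finally show ?thesis .
    qed
    have "adj U * A * U \<in> carrier_mat n n" by (rule mult_carrier_mat[OF mult_carrier_mat[OF aU AA] u(1)])
    then show ?thesis unfolding coefficient_sum_def using q(1) d tr
      by (intro exI[of _ "{q}"] exI[of _ "\<lambda>_. adj U * A * U"]) simp
  next
    case 3
    obtain k J l L where J: "k < n" "l < n" "J \<in> carrier_mat n k" "L \<in> carrier_mat n l"
      "adj J * J = 1\<^sub>m k" "adj L * L = 1\<^sub>m l" "J * adj J + L * adj L = 1\<^sub>m n"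
      "\<And>g. g \<in> carrier G \<Longrightarrow> \<rho> g * J = J * (adj J * \<rho> g * J)"
      "\<And>g. g \<in> carrier G \<Longrightarrow> \<rho> g * L = L * (adj L * \<rho> g * L)"
      using reducible_decomposition[OF less.prems(1) 3] by metis
    note AA = less.prems(3)
    have part: "coefficient_sum G \<R> (\<lambda>g. trace (A * \<rho> g * (K * adj K)))"
      if K: "p < n" "K \<in> carrier_mat n p" "adj K * K = 1\<^sub>m p"
        "\<And>g. g \<in> carrier G \<Longrightarrow> \<rho> g * K = K * (adj K * \<rho> g * K)" for p K
    proof -
      have aK: "adj K \<in> carrier_mat p n" using K(2) by simp
      let ?s = "\<lambda>g. adj K * \<rho> g * K"
      have s: "unitary_rep G p ?s" by (rule compress_rep[OF less.prems(1) K(2-4)])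
      have "?s v = 1\<^sub>m p" if "v \<in> V" for v using less.prems(2)[OF that] right_mult_one_mat[OF aK] K(3) by simp
      moreover have B: "adj K * A * K \<in> carrier_mat p p" using aK K(2) AA by auto
      ultimately have "coefficient_sum G \<R> (\<lambda>g. trace (adj K * A * K * ?s g))"
        using less.IH[OF K(1) s] by blast
      moreover have "trace (A * \<rho> g * (K * adj K)) = trace (adj K * A * K * ?s g)" if g: "g \<in> carrier G" for g
      proof -
        have sg: "?s g \<in> carrier_mat p p" by (rule unitary_repD(1)[OF s g])
        have "A * \<rho> g * (K * adj K) = A * \<rho> g * K * adj K"
          using AA r(1)[OF g] K(2) aK by (intro assoc_mult_mat[symmetric, of _ n n _ p _ n]) auto
        also have "A * \<rho> g * K = A * (\<rho> g * K)"
          using AA r(1)[OF g] K(2) by (intro assoc_mult_mat[of _ n n _ n _ p]) auto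
        also have "\<dots> = A * (K * ?s g)" using K(4)[OF g] by simp
        finally have "trace (A * \<rho> g * (K * adj K)) = trace (A * (K * ?s g) * adj K)" by simp
        also have "\<dots> = trace (adj K * (A * (K * ?s g)))"
          by (rule trace_mult_commute[of _ n p]) (use mult_carrier_mat[OF AA mult_carrier_mat[OF K(2) sg]] aK in auto)
        also have "A * (K * ?s g) = A * K * ?s g"
          by (rule assoc_mult_mat[symmetric, OF AA K(2) sg])
        also have "adj K * (A * K * ?s g) = adj K * (A * K) * ?s g"
          by (rule assoc_mult_mat[symmetric, OF aK mult_carrier_mat[OF AA K(2)] sg])
        also have "adj K * (A * K) = adj K * A * K" by (rule assoc_mult_mat[symmetric, OF aK AA K(2)])
        finally show ?thesis .
      qed
      ultimately show ?thesis by (rule coefficient_sum_cong)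
    qed
    have split: "trace (A * \<rho> g) = trace (A * \<rho> g * (J * adj J)) + trace (A * \<rho> g * (L * adj L))"
      if g: "g \<in> carrier G" for g
    proof -
      have M: "A * \<rho> g \<in> carrier_mat n n" by (rule mult_carrier_mat[OF AA r(1)[OF g]])
      have JJ: "J * adj J \<in> carrier_mat n n" and LL: "L * adj L \<in> carrier_mat n n"
        by (rule mult_carrier_mat[OF J(3) adj_carrier[OF J(3)]], rule mult_carrier_mat[OF J(4) adj_carrier[OF J(4)]])
      have "A * \<rho> g = A * \<rho> g * (J * adj J + L * adj L)" unfolding J(7) by (rule right_mult_one_mat[symmetric, OF M])
      also have "\<dots> = A * \<rho> g * (J * adj J) + A * \<rho> g * (L * adj L)" by (rule mult_add_distrib_mat[OF M JJ LL])
      finally have "trace (A * \<rho> g) = trace (A * \<rho> g * (J * adj J) + A * \<rho> g * (L * adj L))" by simp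
      then show ?thesis using trace_add[OF mult_carrier_mat[OF M JJ] mult_carrier_mat[OF M LL]] by simp
    qed
    show ?thesis
      by (rule coefficient_sum_cong[OF coefficient_sum_add[OF R part[OF J(1,3,5,8)] part[OF J(2,4,6,9)]] split])
  qed
qed

text \<open>The permutation representation on a finite quotient of \<open>G\<close>, which is presented as a map \<open>idx\<close>.
  The column of \<open>\<rho>(g)\<close> that belongs to \<open>\<one>\<close> has its only nonzero entry in the row of \<open>g\<close>, so pairing this
  column with the values of \<open>f\<close> gives \<open>f(g)\<close>.\<close>

lemma permutation_rep:
  fixes idx :: "'a \<Rightarrow> nat" and f :: "'a \<Rightarrow> complex"
  assumes idx: "idx ` carrier G = {..<N}"
    and left: "\<And>a b h. a \<in> carrier G \<Longrightarrow> b \<in> carrier G \<Longrightarrow> h \<in> carrier G \<Longrightarrow> idx a = idx b \<Longrightarrow> idx (h \<otimes> a) = idx (h \<otimes> b)"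
    and f: "\<And>a b. a \<in> carrier G \<Longrightarrow> b \<in> carrier G \<Longrightarrow> idx a = idx b \<Longrightarrow> f a = f b"
  obtains \<rho> A where "unitary_rep G N \<rho>" "A \<in> carrier_mat N N"
    "\<And>g. g \<in> carrier G \<Longrightarrow> trace (A * \<rho> g) = f g"
    "\<And>v. v \<in> carrier G \<Longrightarrow> (\<And>a. a \<in> carrier G \<Longrightarrow> idx (v \<otimes> a) = idx a) \<Longrightarrow> \<rho> v = 1\<^sub>m N"
proof -
  define e where "e i = inv_into (carrier G) idx i" for i
  have e: "e i \<in> carrier G" "idx (e i) = i" if "i < N" for i
    unfolding e_def using that idx by (auto intro: inv_into_into f_inv_into_f)
  have iN: "idx g < N" if "g \<in> carrier G" for g using idx that by blast
  define p where "p g i = idx (g \<otimes> e i)" for g i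
  have p: "p g (idx a) = idx (g \<otimes> a)" if "g \<in> carrier G" "a \<in> carrier G" for g a
    unfolding p_def using left[of "e (idx a)" a g] e[OF iN[OF that(2)]] that by simp
  have pN: "p g i < N" if "g \<in> carrier G" "i < N" for g i
    unfolding p_def using iN e(1) that by simp
  have pm: "p (g \<otimes> h) i = p g (p h i)" if "g \<in> carrier G" "h \<in> carrier G" "i < N" for g h i
    using p[of g "h \<otimes> e i"] e(1) that unfolding p_def by (simp add: m_assoc)
  have p1: "p \<one> i = i" if "i < N" for i unfolding p_def using e that by simp
  define \<rho> :: "'a \<Rightarrow> complex mat" where "\<rho> g = mat N N (\<lambda>(i, j). if i = p g j then 1 else 0)" for g
  have c: "\<rho> g \<in> carrier_mat N N" for g unfolding \<rho>_def by simp
  have m: "\<rho> (g \<otimes> h) = \<rho> g * \<rho> h" if g: "g \<in> carrier G" and h: "h \<in> carrier G" for g h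
  proof (rule eq_matI)
    fix i j assume "i < dim_row (\<rho> g * \<rho> h)" "j < dim_col (\<rho> g * \<rho> h)"
    then have ij: "i < N" "j < N" using c[of g] c[of h] by auto
    have "(\<rho> g * \<rho> h) $$ (i, j) = (\<Sum>k<N. \<rho> g $$ (i, k) * \<rho> h $$ (k, j))"
      by (rule mat_mult_index[OF c c ij])
    also have "\<dots> = (\<Sum>k<N. if k = p h j then (if i = p g k then 1 else 0) else 0)"
      using ij by (intro sum.cong refl) (auto simp: \<rho>_def)
    also have "\<dots> = (if i = p g (p h j) then 1 else 0)" using pN[OF h ij(2)] by (simp add: sum.delta)
    finally show "\<rho> (g \<otimes> h) $$ (i, j) = (\<rho> g * \<rho> h) $$ (i, j)"
      using pm[OF g h ij(2)] ij unfolding \<rho>_def by simp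
  qed (use c[of g] c[of h] c[of "g \<otimes> h"] in auto)
  have o: "\<rho> v = 1\<^sub>m N" if "\<And>i. i < N \<Longrightarrow> p v i = i" for v
    unfolding \<rho>_def using that by (intro eq_matI) auto
  have a: "adj (\<rho> g) = \<rho> (inv g)" if g: "g \<in> carrier G" for g
  proof (rule eq_matI)
    fix i j assume "i < dim_row (\<rho> (inv g))" "j < dim_col (\<rho> (inv g))"
    then have ij: "i < N" "j < N" using c[of "inv g"] by auto
    have "j = p g i \<longleftrightarrow> i = p (inv g) j"
      using pm[of g "inv g" j] pm[of "inv g" g i] p1 g ij by auto
    then show "adj (\<rho> g) $$ (i, j) = \<rho> (inv g) $$ (i, j)" using ij unfolding \<rho>_def by simp
  qed (use c[of g] c[of "inv g"] in auto)
  have rep: "unitary_rep G N \<rho>"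
  proof (rule unitary_repI)
    fix g assume g: "g \<in> carrier G"
    show "\<rho> g * adj (\<rho> g) = 1\<^sub>m N" "adj (\<rho> g) * \<rho> g = 1\<^sub>m N"
      unfolding a[OF g] using m[of g "inv g"] m[of "inv g" g] g o[OF p1] by auto
  qed (use c m in auto)
  define A where "A = mat N N (\<lambda>(j, i). if j = idx \<one> then f (e i) else 0)"
  have "trace (A * \<rho> g) = f g" if g: "g \<in> carrier G" for g
  proof -
    have "trace (A * \<rho> g) = (\<Sum>j<N. \<Sum>i<N. A $$ (j, i) * \<rho> g $$ (i, j))"
      by (rule trace_mult[OF _ c]) (simp add: A_def)
    also have "\<dots> = (\<Sum>j<N. \<Sum>i<N. if i = p g j then (if j = idx \<one> then f (e i) else 0) else 0)"
      unfolding A_def \<rho>_def by (intro sum.cong refl) auto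
    also have "\<dots> = (\<Sum>j<N. if j = idx \<one> then f (e (p g j)) else 0)"
      using pN[OF g] by (intro sum.cong refl) (simp add: sum.delta)
    also have "\<dots> = f (e (p g (idx \<one>)))" using iN[OF one_closed] by (simp add: sum.delta)
    also have "p g (idx \<one>) = idx g" using p[OF g one_closed] g by simp
    also have "f (e (idx g)) = f g" by (rule f) (use e[OF iN[OF g]] g in auto)
    finally show ?thesis .
  qed
  moreover have "\<rho> v = 1\<^sub>m N" if "v \<in> carrier G" "\<And>a. a \<in> carrier G \<Longrightarrow> idx (v \<otimes> a) = idx a" for v
    by (rule o) (use that e in \<open>simp add: p_def\<close>)
  moreover have "A \<in> carrier_mat N N" unfolding A_def by simp
  ultimately show ?thesis using that[OF rep, of A] by blast
qed

end

section \<open>Finite representations and functions on finite quotients\<close>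

lemma finite_rep_imp_finite_image: "finite_rep G \<rho> \<Longrightarrow> finite (\<rho> ` carrier G)"
proof -
  assume "finite_rep G \<rho>"
  then obtain F :: "nat monoid" and p n \<sigma> where F: "finite (carrier F)" "p \<in> hom G F"
    "\<forall>g\<in>carrier G. \<rho> g = \<sigma> (p g)" unfolding finite_rep_def by blast
  have "p g \<in> carrier F" if "g \<in> carrier G" for g using F(2) that unfolding hom_def by blast
  then have "\<rho> ` carrier G \<subseteq> \<sigma> ` carrier F" using F(3) by auto
  then show ?thesis using F(1) finite_subset by blast
qed

text \<open>The image of the representation is itself the finite group through which it factors; it is
  transported to the natural numbers along an arbitrary injection.\<close>

lemma (in group) finite_image_imp_finite_rep:
  assumes rho: "unitary_rep G n \<rho>" and fin: "finite (\<rho> ` carrier G)"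
  shows "finite_rep G \<rho>"
proof -
  note r = unitary_repD[OF rho]
  obtain f :: "complex mat \<Rightarrow> nat" where f: "inj_on f (\<rho> ` carrier G)"
    using finite_imp_inj_to_nat_seg[OF fin] by blast
  define h where "h = inv_into (\<rho> ` carrier G) f"
  define p where "p = f \<circ> \<rho>"
  have hp: "h (p g) = \<rho> g" if "g \<in> carrier G" for g
    unfolding h_def p_def using inv_into_f_f[OF f] that by simp
  define F :: "nat monoid" where
    "F = \<lparr>carrier = p ` carrier G, monoid.mult = \<lambda>x y. f (h x * h y), one = p \<one>\<rparr>"
  have Fc: "carrier F = p ` carrier G" and F1: "\<one>\<^bsub>F\<^esub> = p \<one>" unfolding F_def by simp_all
  have Fm: "p a \<otimes>\<^bsub>F\<^esub> p b = p (a \<otimes> b)" if "a \<in> carrier G" "b \<in> carrier G" for a b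
    unfolding F_def using hp that r(4) by (simp add: p_def)
  have "group F"
  proof (rule groupI)
    show "x \<otimes>\<^bsub>F\<^esub> y \<in> carrier F" if "x \<in> carrier F" "y \<in> carrier F" for x y
      using that Fm unfolding Fc by auto
    show "\<one>\<^bsub>F\<^esub> \<in> carrier F" unfolding Fc F1 by simp
    show "x \<otimes>\<^bsub>F\<^esub> y \<otimes>\<^bsub>F\<^esub> z = x \<otimes>\<^bsub>F\<^esub> (y \<otimes>\<^bsub>F\<^esub> z)"
      if "x \<in> carrier F" "y \<in> carrier F" "z \<in> carrier F" for x y z
      using that Fm unfolding Fc by (auto simp: m_assoc)
    show "\<one>\<^bsub>F\<^esub> \<otimes>\<^bsub>F\<^esub> x = x" if "x \<in> carrier F" for x
      using that Fm unfolding Fc F1 by auto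
    show "\<exists>y\<in>carrier F. y \<otimes>\<^bsub>F\<^esub> x = \<one>\<^bsub>F\<^esub>" if x: "x \<in> carrier F" for x
    proof -
      obtain a where a: "a \<in> carrier G" "x = p a" using x unfolding Fc by blast
      then have "p (inv a) \<otimes>\<^bsub>F\<^esub> x = \<one>\<^bsub>F\<^esub>" unfolding F1 using Fm[of "inv a" a] by simp
      then show ?thesis using a(1) unfolding Fc by blast
    qed
  qed
  moreover have "finite (carrier F)" unfolding Fc p_def image_comp[symmetric] using fin by simp
  moreover have "p \<in> hom G F" unfolding hom_def using Fm Fc by auto
  moreover have "unitary_rep F n h"
  proof (rule unitary_repI)
    fix x y assume "x \<in> carrier F" "y \<in> carrier F"
    then obtain a b where ab: "a \<in> carrier G" "x = p a" "b \<in> carrier G" "y = p b" unfolding Fc by blast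
    show "h (x \<otimes>\<^bsub>F\<^esub> y) = h x * h y" using Fm hp ab r(4) by simp
    show "h x \<in> carrier_mat n n" "h x * adj (h x) = 1\<^sub>m n" "adj (h x) * h x = 1\<^sub>m n"
      using r(1-3)[OF ab(1)] hp[OF ab(1)] ab(2) by simp_all
  qed
  ultimately show ?thesis unfolding finite_rep_def using hp by (metis (no_types, lifting))
qed

lemma (in group) reidemeister_equiv:
  assumes \<phi>: "\<phi> \<in> hom G G"
  shows "equiv (carrier G) (reidemeister_rel G \<phi>)"
proof -
  interpret f: group_hom G G \<phi> using \<phi> by (simp add: group_hom_def group_hom_axioms_def is_group)
  show ?thesis
  proof (rule equivI)
    show "reidemeister_rel G \<phi> \<subseteq> carrier G \<times> carrier G" unfolding reidemeister_rel_def by auto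
    show "refl_on (carrier G) (reidemeister_rel G \<phi>)"
    proof (rule refl_onI)
      fix g assume g: "g \<in> carrier G"
      then have "g = \<one> \<otimes> g \<otimes> \<phi> (inv \<one>)" by simp
      then show "(g, g) \<in> reidemeister_rel G \<phi>" unfolding reidemeister_rel_def using g by blast
    qed
    show "sym (reidemeister_rel G \<phi>)"
    proof (rule symI)
      fix g h assume "(g, h) \<in> reidemeister_rel G \<phi>"
      then obtain x where x: "g \<in> carrier G" "h \<in> carrier G" "x \<in> carrier G" "h = x \<otimes> g \<otimes> \<phi> (inv x)"
        unfolding reidemeister_rel_def by blast
      have "g = inv x \<otimes> h \<otimes> \<phi> (inv (inv x))"
        unfolding x(4) using x(1,3) by (simp add: word_simps f.hom_inv)
      then show "(h, g) \<in> reidemeister_rel G \<phi>" unfolding reidemeister_rel_def using x(1-3) inv_closed by blast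
    qed
    show "trans (reidemeister_rel G \<phi>)"
    proof (rule transI)
      fix g h k assume "(g, h) \<in> reidemeister_rel G \<phi>" "(h, k) \<in> reidemeister_rel G \<phi>"
      then obtain x y where x: "g \<in> carrier G" "x \<in> carrier G" "h = x \<otimes> g \<otimes> \<phi> (inv x)"
        and y: "k \<in> carrier G" "y \<in> carrier G" "k = y \<otimes> h \<otimes> \<phi> (inv y)"
        unfolding reidemeister_rel_def by blast
      have "k = (y \<otimes> x) \<otimes> g \<otimes> \<phi> (inv (y \<otimes> x))"
        unfolding y(3) x(3) using x(1,2) y(2) by (simp add: word_simps f.hom_inv)
      then show "(g, k) \<in> reidemeister_rel G \<phi>"
        unfolding reidemeister_rel_def using x(1,2) y(1,2) m_closed by blast
    qed
  qed
qed

text \<open>A function that is constant on the cosets of \<open>V\<close> is a coefficient of the permutation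
  representation on these cosets, and \<open>V\<close> acts trivially there because it is normal.\<close>

lemma (in group) coset_function_coefficients:
  fixes f :: "'a \<Rightarrow> complex"
  assumes V: "normal_in V (carrier G)" and Vfin: "fin_index V (carrier G)"
    and f: "\<And>g v. g \<in> carrier G \<Longrightarrow> v \<in> V \<Longrightarrow> f (g \<otimes> v) = f g"
    and R: "\<And>r. r \<in> \<R> \<Longrightarrow> unitary_rep G (rep_dim G r) r"
    and cover: "\<And>m \<tau>. irreducible_rep G m \<tau> \<Longrightarrow> (\<And>v. v \<in> V \<Longrightarrow> \<tau> v = 1\<^sub>m m) \<Longrightarrow> \<exists>r\<in>\<R>. rep_equiv G r \<tau>"
  shows "coefficient_sum G \<R> f"
proof -
  note v = normal_inD[OF V]
  have Vc: "x \<in> carrier G" if "x \<in> V" for x using v(3) that by blast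
  define c where "c a = {b \<in> carrier G. inv a \<otimes> b \<in> V}" for a
  have ceq: "c a = c b \<longleftrightarrow> inv a \<otimes> b \<in> V" if a: "a \<in> carrier G" and b: "b \<in> carrier G" for a b
  proof
    assume "c a = c b"
    moreover have "b \<in> c b" unfolding c_def using b subgroup.one_closed[OF v(1)] by simp
    ultimately show "inv a \<otimes> b \<in> V" unfolding c_def by blast
  next
    assume ab: "inv a \<otimes> b \<in> V"
    have "inv a \<otimes> x \<in> V \<longleftrightarrow> inv b \<otimes> x \<in> V" if x: "x \<in> carrier G" for x
    proof -
      have "inv a \<otimes> x = (inv a \<otimes> b) \<otimes> (inv b \<otimes> x)" "inv b \<otimes> x = inv (inv a \<otimes> b) \<otimes> (inv a \<otimes> x)"
        using a b x by (simp_all add: word_simps)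
      then show ?thesis
        using ab subgroup.m_closed[OF v(1)] subgroup.m_inv_closed[OF v(1)] by metis
    qed
    then show "c a = c b" unfolding c_def by blast
  qed
  obtain F where F: "finite F" "F \<subseteq> carrier G" "\<forall>h\<in>carrier G. \<exists>f\<in>F. \<exists>k\<in>V. h = f \<otimes> k"
    using Vfin unfolding fin_index_def by blast
  have "c h \<in> c ` F" if h: "h \<in> carrier G" for h
  proof -
    obtain x k where x: "x \<in> F" "k \<in> V" "h = x \<otimes> k" using F(3) h by blast
    have "x \<in> carrier G" using x(1) F(2) by blast
    then have "c x = c h" using ceq[of x h] x(2,3) h Vc[OF x(2)] by simp
    then show ?thesis using x(1) by blast
  qed
  then have "finite (c ` carrier G)" using F(1) finite_subset[of "c ` carrier G" "c ` F"] by blast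
  then obtain N and num :: "'a set \<Rightarrow> nat" where num: "num ` c ` carrier G = {i. i < N}" "inj_on num (c ` carrier G)"
    using finite_imp_inj_to_nat_seg by metis
  define idx where "idx = num \<circ> c"
  have ieq: "idx a = idx b \<longleftrightarrow> inv a \<otimes> b \<in> V" if a: "a \<in> carrier G" and b: "b \<in> carrier G" for a b
    unfolding idx_def using inj_on_eq_iff[OF num(2), of "c a" "c b"] ceq[OF a b] a b by simp
  have i1: "idx ` carrier G = {..<N}" unfolding idx_def image_comp[symmetric] num(1) by auto
  have i2: "idx (h \<otimes> a) = idx (h \<otimes> b)"
    if "a \<in> carrier G" "b \<in> carrier G" "h \<in> carrier G" "idx a = idx b" for a b h
    using that ieq[of a b] ieq[of "h \<otimes> a" "h \<otimes> b"] by (simp add: word_simps)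
  have i3: "f a = f b" if a: "a \<in> carrier G" and b: "b \<in> carrier G" and e: "idx a = idx b" for a b
    using f[OF a, of "inv a \<otimes> b"] ieq[OF a b] a b e by simp
  show ?thesis
  proof (rule permutation_rep[OF i1 i2 i3])
    fix \<rho> A assume r: "unitary_rep G N \<rho>" "A \<in> carrier_mat N N"
      "\<And>g. g \<in> carrier G \<Longrightarrow> trace (A * \<rho> g) = f g"
      "\<And>v. v \<in> carrier G \<Longrightarrow> (\<And>a. a \<in> carrier G \<Longrightarrow> idx (v \<otimes> a) = idx a) \<Longrightarrow> \<rho> v = 1\<^sub>m N"
    have "\<rho> u = 1\<^sub>m N" if u: "u \<in> V" for u
    proof (rule r(4)[OF Vc[OF u]])
      fix a assume a: "a \<in> carrier G"
      have "inv (u \<otimes> a) \<otimes> a = inv a \<otimes> inv u \<otimes> a" using a Vc[OF u] by (simp add: word_simps)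
      also have "\<dots> \<in> V" using v(5)[OF a subgroup.m_inv_closed[OF v(1) u]] .
      finally show "idx (u \<otimes> a) = idx a" using ieq[of "u \<otimes> a" a] a Vc[OF u] by simp
    qed
    then have "coefficient_sum G \<R> (\<lambda>g. trace (A * \<rho> g))"
      by (intro coefficients_complete[OF R cover v(3) r(1) _ r(2)]) auto
    then show ?thesis by (rule coefficient_sum_cong) (simp add: r(3))
  qed
qed

interpretation fun_space: vector_space "\<lambda>(c::complex) (f :: 'a \<Rightarrow> complex) x. c * f x"
  by unfold_locales (auto simp: fun_eq_iff algebra_simps)

lemma sum_fun_apply: "(\<Sum>i\<in>I. f i) x = (\<Sum>i\<in>I. f i x)" for f :: "'i \<Rightarrow> 'a \<Rightarrow> complex"
  by (induction I rule: infinite_finite_induct) auto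

text \<open>The comparison of dimensions, for families instead of sets; independence makes the family \<open>F\<close>
  injective.\<close>

lemma independent_family_card_le:
  fixes F :: "'i \<Rightarrow> 'a \<Rightarrow> complex" and E :: "'j \<Rightarrow> 'a \<Rightarrow> complex"
  assumes J: "finite J" and span: "\<And>i. i \<in> I \<Longrightarrow> F i \<in> fun_space.span (E ` J)"
    and indep: "\<And>K a. finite K \<Longrightarrow> K \<subseteq> I \<Longrightarrow> (\<And>x. (\<Sum>i\<in>K. a i * F i x) = 0) \<Longrightarrow> \<forall>i\<in>K. a i = 0"
  shows "finite I \<and> card I \<le> card J"
proof -
  have inj: "inj_on F I"
  proof (rule inj_onI, rule ccontr)
    fix i j assume ij: "i \<in> I" "j \<in> I" "F i = F j" "i \<noteq> j"
    \<comment> \<open>otherwise \<open>F i - F j = 0\<close> would be a nontrivial relation\<close>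
    have "\<forall>k\<in>{i, j}. (if k = i then 1 else - 1 :: complex) = 0"
      by (rule indep) (use ij in auto)
    then show False by simp
  qed
  have "\<not> fun_space.dependent (F ` I)"
    unfolding fun_space.dependent_explicit
  proof (clarify)
    fix t u v assume t: "finite t" "t \<subseteq> F ` I" "(\<Sum>v\<in>t. (\<lambda>x. u v * v x)) = 0" "v \<in> t" "u v \<noteq> 0"
    obtain K where K: "K \<subseteq> I" "finite K" "t = F ` K" using finite_subset_image[OF t(1,2)] by blast
    have injK: "inj_on F K" using inj K(1) inj_on_subset by blast
    have "(\<Sum>i\<in>K. u (F i) * F i x) = 0" for x
    proof -
      have "(\<Sum>i\<in>K. u (F i) * F i x) = (\<Sum>v\<in>t. u v * v x)"
        unfolding K(3) by (simp add: sum.reindex[OF injK])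
      also have "\<dots> = (\<Sum>v\<in>t. (\<lambda>x. u v * v x)) x" by (simp add: sum_fun_apply)
      finally show ?thesis using t(3) by simp
    qed
    then have "\<forall>i\<in>K. u (F i) = 0" by (rule indep[OF K(2,1)])
    then show False using t(4,5) K(3) by blast
  qed
  moreover have "F ` I \<subseteq> fun_space.span (E ` J)" using span by blast
  ultimately have b: "finite (F ` I) \<and> card (F ` I) \<le> card (E ` J)"
    using fun_space.independent_span_bound[of "E ` J" "F ` I"] J by blast
  then have "finite I" using inj finite_image_iff by blast
  moreover have "card I = card (F ` I)" using card_image[OF inj] by simp
  moreover have "card (E ` J) \<le> card J" by (rule card_image_le[OF J])
  ultimately show ?thesis using b by linarith
qed

section \<open>Class functions and f-points\<close>

text \<open>The intertwiner turns \<open>\<rho>(x)\<close> into \<open>\<rho>(\<phi>(x))\<close>, which moves to the other end under the trace and cancels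
  \<open>\<rho>(\<phi>(x\<^sup>-\<^sup>1))\<close>.\<close>

lemma (in group) twisted_trace_class_function:
  assumes \<phi>: "\<phi> \<in> hom G G" and rho: "unitary_rep G n \<rho>" and U: "U \<in> carrier_mat n n"
    and tw: "\<And>g. g \<in> carrier G \<Longrightarrow> U * \<rho> g = \<rho> (\<phi> g) * U"
    and x: "x \<in> carrier G" and g: "g \<in> carrier G"
  shows "trace (U * \<rho> (x \<otimes> g \<otimes> \<phi> (inv x))) = trace (U * \<rho> g)"
proof -
  interpret f: group_hom G G \<phi> using \<phi> by (simp add: group_hom_def group_hom_axioms_def is_group)
  note r = unitary_repD[OF rho]
  note as = assoc_mult_mat[of _ n n _ n _ n]
  let ?a = "\<rho> (\<phi> x)" and ?b = "\<rho> (\<phi> (inv x))"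
  have c: "\<rho> x \<in> carrier_mat n n" "\<rho> g \<in> carrier_mat n n" "?a \<in> carrier_mat n n" "?b \<in> carrier_mat n n"
    using r(1) x g by auto
  have ba: "?b * ?a = 1\<^sub>m n"
    using r(4)[of "\<phi> (inv x)" "\<phi> x"] x unitary_rep_one[OF rho] by (simp add: f.hom_inv)
  have "U * \<rho> (x \<otimes> g \<otimes> \<phi> (inv x)) = U * (\<rho> x * \<rho> g * ?b)" using r(4) x g by simp
  also have "\<dots> = (U * \<rho> x) * (\<rho> g * ?b)" using c U by (simp add: as)
  also have "\<dots> = ?a * (U * \<rho> g * ?b)" unfolding tw[OF x] using c U by (simp add: as)
  finally have "trace (U * \<rho> (x \<otimes> g \<otimes> \<phi> (inv x))) = trace (?a * (U * \<rho> g * ?b))" by simp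
  also have "\<dots> = trace (U * \<rho> g * ?b * ?a)"
    by (rule trace_mult_commute[of _ n n]) (use c U in auto)
  also have "U * \<rho> g * ?b * ?a = U * \<rho> g * (?b * ?a)"
    using c U by (intro assoc_mult_mat[of _ n n _ n _ n]) auto
  also have "\<dots> = U * \<rho> g" unfolding ba by (rule right_mult_one_mat[OF mult_carrier_mat[OF U c(2)]])
  finally show ?thesis .
qed

text \<open>Translating the argument by the twisted action of \<open>x\<close> replaces the coefficient matrix \<open>B r\<close> by
  \<open>r(\<phi>(x))\<^sup>-\<^sup>1 (B r) r(x)\<close>.  Coefficient matrices are determined by the function, so they do not change
  if the function is constant on Reidemeister classes.\<close>

lemma (in group) class_function_coefficients_intertwine:
  assumes \<phi>: "\<phi> \<in> hom G G" and I: "finite I" "\<And>r. r \<in> I \<Longrightarrow> irreducible_rep G (rep_dim G r) r"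
    and fin: "\<And>r. r \<in> I \<Longrightarrow> finite (r ` carrier G)"
    and inequiv: "\<And>r s. r \<in> I \<Longrightarrow> s \<in> I \<Longrightarrow> r \<noteq> s \<Longrightarrow> \<not> rep_equiv G r s"
    and B: "\<And>r. r \<in> I \<Longrightarrow> B r \<in> carrier_mat (rep_dim G r) (rep_dim G r)"
    and const: "\<And>x g. x \<in> carrier G \<Longrightarrow> g \<in> carrier G \<Longrightarrow>
        (\<Sum>r\<in>I. trace (B r * r (x \<otimes> g \<otimes> \<phi> (inv x)))) = (\<Sum>r\<in>I. trace (B r * r g))"
    and r: "r \<in> I" and x: "x \<in> carrier G"
  shows "B r * r x = r (\<phi> x) * B r"
proof -
  interpret f: group_hom G G \<phi> using \<phi> by (simp add: group_hom_def group_hom_axioms_def is_group)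
  let ?d = "rep_dim G"
  have rep: "unitary_rep G (?d s) s" if "s \<in> I" for s using I(2)[OF that] unfolding irreducible_rep_def by simp
  let ?A = "\<lambda>s. s (\<phi> (inv x)) * (B s * s x) - B s"
  have c: "B s \<in> carrier_mat (?d s) (?d s)" "s x \<in> carrier_mat (?d s) (?d s)"
    "s (\<phi> (inv x)) \<in> carrier_mat (?d s) (?d s)" "s (\<phi> x) \<in> carrier_mat (?d s) (?d s)" if "s \<in> I" for s
    using B[OF that] unitary_repD(1)[OF rep[OF that]] x by auto
  have tr: "trace (?A s * s g) = trace (B s * s (x \<otimes> g \<otimes> \<phi> (inv x))) - trace (B s * s g)"
    if s: "s \<in> I" and g: "g \<in> carrier G" for s g
  proof -
    let ?n = "?d s"
    note cs = c[OF s] and as = assoc_mult_mat[of _ ?n ?n _ ?n _ ?n]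
    have gc: "s g \<in> carrier_mat ?n ?n" by (rule unitary_repD(1)[OF rep[OF s] g])
    have M: "s (\<phi> (inv x)) * (B s * s x) \<in> carrier_mat ?n ?n" using cs by auto
    have "?A s * s g = s (\<phi> (inv x)) * (B s * s x) * s g - B s * s g"
      by (rule minus_mult_distrib_mat[OF M cs(1) gc])
    then have t: "trace (?A s * s g) = trace (s (\<phi> (inv x)) * (B s * s x) * s g) - trace (B s * s g)"
      using trace_minus[OF mult_carrier_mat[OF M gc] mult_carrier_mat[OF cs(1) gc]] by simp
    have "s (\<phi> (inv x)) * (B s * s x) * s g = s (\<phi> (inv x)) * (B s * s x * s g)"
      using cs gc by (intro assoc_mult_mat[of _ ?n ?n _ ?n _ ?n]) auto
    then have "trace (s (\<phi> (inv x)) * (B s * s x) * s g) = trace (B s * s x * s g * s (\<phi> (inv x)))"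
      using trace_mult_commute[of "s (\<phi> (inv x))" ?n ?n "B s * s x * s g"] cs gc by auto
    also have "B s * s x * s g * s (\<phi> (inv x)) = B s * (s x * s g * s (\<phi> (inv x)))"
      using cs gc by (simp add: as)
    also have "s x * s g * s (\<phi> (inv x)) = s (x \<otimes> g \<otimes> \<phi> (inv x))"
      using unitary_repD(4)[OF rep[OF s]] x g by simp
    finally show ?thesis unfolding t by simp
  qed
  have A0: "?A r = 0\<^sub>m (?d r) (?d r)"
  proof (rule coefficients_independent[where R = "\<lambda>s. s" and A = ?A and d = ?d, OF I fin inequiv _ _ r])
    show "?A s \<in> carrier_mat (?d s) (?d s)" if "s \<in> I" for s using c(1)[OF that] by (rule minus_carrier_mat)
    show "(\<Sum>s\<in>I. trace (?A s * s g)) = 0" if g: "g \<in> carrier G" for g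
      using const[OF x g] tr[OF _ g] by (simp add: sum_subtractf)
  qed auto
  let ?n = "?d r"
  note cr = c[OF r]
  have M: "r (\<phi> (inv x)) * (B r * r x) \<in> carrier_mat ?n ?n" using cr by auto
  have "r (\<phi> (inv x)) * (B r * r x) = B r"
  proof (rule eq_matI)
    fix i j assume ij: "i < dim_row (B r)" "j < dim_col (B r)"
    then have "?A r $$ (i, j) = 0" unfolding A0 using cr(1) by simp
    then show "(r (\<phi> (inv x)) * (B r * r x)) $$ (i, j) = B r $$ (i, j)" using ij by simp
  qed (use M cr(1) in auto)
  then have "r (\<phi> x) * B r = r (\<phi> x) * (r (\<phi> (inv x)) * (B r * r x))" by simp
  also have "\<dots> = r (\<phi> x) * r (\<phi> (inv x)) * (B r * r x)"
    using cr by (intro assoc_mult_mat[symmetric, of _ ?n ?n _ ?n _ ?n]) auto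
  also have "r (\<phi> x) * r (\<phi> (inv x)) = 1\<^sub>m ?n"
    using unitary_repD(4)[OF rep[OF r], of "\<phi> x" "\<phi> (inv x)"] x unitary_rep_one[OF rep[OF r]] by (simp add: f.hom_inv)
  also have "1\<^sub>m ?n * (B r * r x) = B r * r x" by (rule left_mult_one_mat[OF mult_carrier_mat[OF cr(1,2)]])
  finally show ?thesis by simp
qed

lemma (in group) rep_equiv_irreps_equiv:
  "equiv (irreps_f G) {(\<rho>, \<sigma>). \<rho> \<in> irreps_f G \<and> \<sigma> \<in> irreps_f G \<and> rep_equiv G \<rho> \<sigma>}"
proof (rule equivI)
  show "refl_on (irreps_f G) {(\<rho>, \<sigma>). \<rho> \<in> irreps_f G \<and> \<sigma> \<in> irreps_f G \<and> rep_equiv G \<rho> \<sigma>}"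
    by (rule refl_onI) (auto simp: irreps_f_def irreducible_rep_def intro: rep_equiv_refl)
  show "sym {(\<rho>, \<sigma>). \<rho> \<in> irreps_f G \<and> \<sigma> \<in> irreps_f G \<and> rep_equiv G \<rho> \<sigma>}"
    by (rule symI) (auto intro: rep_equiv_sym)
  show "trans {(\<rho>, \<sigma>). \<rho> \<in> irreps_f G \<and> \<sigma> \<in> irreps_f G \<and> rep_equiv G \<rho> \<sigma>}"
    by (rule transI) (auto intro: rep_equiv_trans)
qed auto

text \<open>Indicator functions \<open>ind C\<close> of classes and twisted traces \<open>F c\<close> of f-points are linearly independent
  families, and each lies in the span of the other.\<close>

theorem (in group) polycyclic_TBFT_ff:
  assumes "polycyclic G" and \<phi>: "\<phi> \<in> hom G G" and "reidemeister_number G \<phi> < \<infinity>"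
  shows "TBFT_ff G \<phi>"
proof -
  interpret f: group_hom G G \<phi> using \<phi> by (simp add: group_hom_def group_hom_axioms_def is_group)
  let ?d = "rep_dim G"
  define rel where "rel = reidemeister_rel G \<phi>"
  define CL where "CL = reidemeister_classes G \<phi>"
  have CLq: "CL = carrier G // rel" unfolding CL_def rel_def reidemeister_classes_def ..
  have eqv: "equiv (carrier G) rel" unfolding rel_def by (rule reidemeister_equiv[OF \<phi>])
  have CLfin: "finite CL"
    using assms(3) unfolding reidemeister_number_def ecard_def CL_def by (auto split: if_splits)
  have CLsub: "C \<subseteq> carrier G" if "C \<in> CL" for C
    using that in_quotient_imp_subset[OF eqv] unfolding CLq by blast
  have tw_rel: "(g, x \<otimes> g \<otimes> \<phi> (inv x)) \<in> rel" if "g \<in> carrier G" "x \<in> carrier G" for g x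
    using that unfolding rel_def reidemeister_rel_def by auto
  have CLclosed: "h \<in> C \<longleftrightarrow> g \<in> C" if C: "C \<in> CL" and gh: "(g, h) \<in> rel" for C g h
    using quotient_eq_iff[OF eqv C[unfolded CLq] C[unfolded CLq]] gh
      in_quotient_imp_closed[OF eqv C[unfolded CLq]] equivE[OF eqv] by (meson symD)
  define pick where "pick C = (SOME g. g \<in> C)" for C :: "'a set"
  have pick: "pick C \<in> C" if "C \<in> CL" for C
    using in_quotient_imp_non_empty[OF eqv] that unfolding CLq pick_def by (metis some_in_eq)

  \<comment> \<open>one normal subgroup of finite index whose cosets refine all Reidemeister classes\<close>
  have "finite_twisted \<phi> {\<one>} (carrier G)"
    unfolding finite_twisted_def
  proof (intro exI[of _ "pick ` CL"] conjI ballI)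
    show "finite (pick ` CL)" using CLfin by simp
    show "pick ` CL \<subseteq> carrier G" using pick CLsub by blast
    fix h assume h: "h \<in> carrier G"
    let ?C = "rel `` {h}"
    have C: "?C \<in> CL" unfolding CLq using h by (rule quotientI)
    then have "(h, pick ?C) \<in> rel" using pick by blast
    then have "(pick ?C, h) \<in> rel" using equivE[OF eqv] by (meson symD)
    then obtain x where x: "x \<in> carrier G" "h = x \<otimes> pick ?C \<otimes> \<phi> (inv x)" "pick ?C \<in> carrier G"
      unfolding rel_def reidemeister_rel_def by blast
    have "x \<otimes> pick ?C \<otimes> inv (\<phi> x) = h"
      unfolding f.hom_inv[OF x(1), symmetric] by (rule x(2)[symmetric])
    then have "h = x \<otimes> pick ?C \<otimes> inv (\<phi> x) \<otimes> \<one>" using r_one[OF h] by (simp only:)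
    then show "\<exists>s\<in>pick ` CL. \<exists>x\<in>carrier G. \<exists>k\<in>{\<one>}. h = x \<otimes> s \<otimes> inv (\<phi> x) \<otimes> k" using C x(1) by blast
  qed
  moreover obtain S n where "polycyclic_series G S n" using polycyclic_imp_series[OF assms(1)] by blast
  ultimately obtain V where V: "normal_in V (carrier G)" "fin_index V (carrier G)"
    and Vrel: "\<And>g v. g \<in> carrier G \<Longrightarrow> v \<in> V \<Longrightarrow> \<exists>x\<in>carrier G. g \<otimes> v = x \<otimes> g \<otimes> inv (\<phi> x)"
    using polycyclic_series.finite_twisted_imp_open_classes[OF _ \<phi>] by metis
  have Vsat: "g \<otimes> v \<in> C \<longleftrightarrow> g \<in> C" if C: "C \<in> CL" and g: "g \<in> carrier G" and v: "v \<in> V" for C g v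
  proof -
    obtain x where x: "x \<in> carrier G" "g \<otimes> v = x \<otimes> g \<otimes> inv (\<phi> x)" using Vrel[OF g v] by blast
    then show ?thesis using CLclosed[OF C tw_rel[OF g x(1)]] by (simp add: f.hom_inv)
  qed

  \<comment> \<open>a representative of each class in the dual; as f-points are defined by an arbitrary member of the
    class, the intertwiner has to be transported to the chosen one\<close>
  define R where "R = {(\<rho>, \<sigma>). \<rho> \<in> irreps_f G \<and> \<sigma> \<in> irreps_f G \<and> rep_equiv G \<rho> \<sigma>}"
  have Req: "equiv (irreps_f G) R" unfolding R_def by (rule rep_equiv_irreps_equiv)
  have dual: "unitary_dual_f G = irreps_f G // R" unfolding unitary_dual_f_def R_def ..
  define rep where "rep c = (SOME \<rho>. \<rho> \<in> c)" for c :: "('a \<Rightarrow> complex mat) set"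
  have rep: "rep c \<in> c" if "c \<in> unitary_dual_f G" for c
    using in_quotient_imp_non_empty[OF Req] that unfolding dual rep_def by (metis some_in_eq)
  have in_class: "rep_equiv G \<rho> \<sigma>" if "c \<in> unitary_dual_f G" "\<rho> \<in> c" "\<sigma> \<in> c" for c \<rho> \<sigma>
    using in_quotient_imp_in_rel[OF Req that(1)[unfolded dual]] that(2,3) unfolding R_def by blast
  have irr: "irreducible_rep G (?d (rep c)) (rep c)" if c: "c \<in> unitary_dual_f G" for c
  proof -
    have "rep c \<in> irreps_f G" using in_quotient_imp_subset[OF Req c[unfolded dual]] rep[OF c] by blast
    then obtain m where m: "irreducible_rep G m (rep c)" unfolding irreps_f_def by blast
    then show ?thesis using rep_dim_eq[of m "rep c"] unfolding irreducible_rep_def by simp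
  qed
  have urep: "unitary_rep G (?d (rep c)) (rep c)" if "c \<in> unitary_dual_f G" for c
    using irr[OF that] unfolding irreducible_rep_def by simp
  have distinct: "c = c'" if "c \<in> unitary_dual_f G" "c' \<in> unitary_dual_f G" "rep_equiv G (rep c) (rep c')" for c c'
  proof -
    have "rep c \<in> irreps_f G" "rep c' \<in> irreps_f G" using irr that(1,2) unfolding irreps_f_def by blast+
    then have "(rep c, rep c') \<in> R" using that(3) unfolding R_def by blast
    then show ?thesis using quotient_eqI[OF Req] that(1,2) rep unfolding dual by blast
  qed

  define D where "D = {c \<in> unitary_dual_ff G. f_point G \<phi> c}"
  have Ddual: "c \<in> unitary_dual_f G" if "c \<in> D" for c using that unfolding D_def unitary_dual_ff_def by blast
  have Dfin: "finite (rep c ` carrier G)" if c: "c \<in> D" for c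
  proof -
    obtain \<rho> where \<rho>: "\<rho> \<in> c" "finite_rep G \<rho>" using c unfolding D_def unitary_dual_ff_def by blast
    show ?thesis
      using rep_equiv_finite_image[OF in_class[OF Ddual[OF c] rep[OF Ddual[OF c]] \<rho>(1)]]
        finite_rep_imp_finite_image[OF \<rho>(2)] .
  qed
  have "\<exists>U. U \<in> carrier (unitary_group (?d (rep c))) \<and> (\<forall>g\<in>carrier G. U * rep c g = rep c (\<phi> g) * U)"
    if c: "c \<in> D" for c
  proof -
    obtain \<rho> where \<rho>: "\<rho> \<in> c" "rep_equiv G \<rho> (\<rho> \<circ> \<phi>)" using c unfolding D_def f_point_def by blast
    have e: "rep_equiv G (rep c) \<rho>" by (rule in_class[OF Ddual[OF c] rep[OF Ddual[OF c]] \<rho>(1)])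
    have "rep_equiv G (rep c) (rep c \<circ> \<phi>)"
      by (rule rep_equiv_trans[OF rep_equiv_trans[OF e \<rho>(2)] rep_equiv_sym[OF rep_equiv_comp[OF \<phi> e]]])
    then obtain U where "U \<in> carrier (unitary_group (?d (rep c)))"
      "\<And>g. g \<in> carrier G \<Longrightarrow> U * rep c g = (rep c \<circ> \<phi>) g * U"
      using rep_equivD[OF _ urep[OF Ddual[OF c]]] by metis
    then show ?thesis by auto
  qed
  then obtain U where U: "\<And>c. c \<in> D \<Longrightarrow> U c \<in> carrier (unitary_group (?d (rep c)))"
    "\<And>c g. c \<in> D \<Longrightarrow> g \<in> carrier G \<Longrightarrow> U c * rep c g = rep c (\<phi> g) * U c"
    by metis
  define F where "F c g = (if g \<in> carrier G then trace (U c * rep c g) else 0)" for c g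
  define ind where "ind C g = (if g \<in> C then 1 else 0 :: complex)" for C :: "'a set" and g

  \<comment> \<open>twisted traces are linearly independent, as the matrices \<open>U c\<close> do not vanish\<close>
  have Findep: "\<forall>c\<in>K. a c = 0"
    if K: "finite K" "K \<subseteq> D" and z: "\<And>x. (\<Sum>c\<in>K. a c * F c x) = 0" for K a
  proof
    fix c assume c: "c \<in> K"
    let ?n = "?d (rep c)"
    have KD: "x \<in> unitary_dual_f G" if "x \<in> K" for x using Ddual that K(2) by blast
    have Uc: "U x \<in> carrier_mat (?d (rep x)) (?d (rep x))" if "x \<in> K" for x
      using unitary_groupD(1)[OF U(1)] that K(2) by blast
    have "a c \<cdot>\<^sub>m U c = 0\<^sub>m ?n ?n"
    proof (rule coefficients_independent[where R = rep and A = "\<lambda>x. a x \<cdot>\<^sub>m U x" and d = "\<lambda>c. ?d (rep c)" and I = K])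
      show "finite K" "c \<in> K" by fact+
      show "irreducible_rep G (?d (rep x)) (rep x)" if "x \<in> K" for x by (rule irr[OF KD[OF that]])
      show "finite (rep x ` carrier G)" if "x \<in> K" for x using Dfin that K(2) by blast
      show "\<not> rep_equiv G (rep x) (rep y)" if "x \<in> K" "y \<in> K" "x \<noteq> y" for x y
        using distinct[OF KD KD] that by blast
      show "a x \<cdot>\<^sub>m U x \<in> carrier_mat (?d (rep x)) (?d (rep x))" if "x \<in> K" for x using Uc[OF that] by simp
      fix g assume g: "g \<in> carrier G"
      have "(\<Sum>x\<in>K. trace (a x \<cdot>\<^sub>m U x * rep x g)) = (\<Sum>x\<in>K. a x * F x g)"
      proof (rule sum.cong[OF refl])
        fix x assume x: "x \<in> K"
        have rg: "rep x g \<in> carrier_mat (?d (rep x)) (?d (rep x))" by (rule unitary_repD(1)[OF urep[OF KD[OF x]] g])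
        have "a x \<cdot>\<^sub>m U x * rep x g = a x \<cdot>\<^sub>m (U x * rep x g)" by (rule mult_smult_assoc_mat[OF Uc[OF x] rg])
        then show "trace (a x \<cdot>\<^sub>m U x * rep x g) = a x * F x g"
          using trace_smult[OF mult_carrier_mat[OF Uc[OF x] rg]] g unfolding F_def by simp
      qed
      then show "(\<Sum>x\<in>K. trace (a x \<cdot>\<^sub>m U x * rep x g)) = 0" using z[of g] by simp
    qed
    then have "adj (U c) * (a c \<cdot>\<^sub>m U c) = adj (U c) * 0\<^sub>m ?n ?n" by simp
    moreover have "adj (U c) * (a c \<cdot>\<^sub>m U c) = a c \<cdot>\<^sub>m 1\<^sub>m ?n"
      using mult_smult_distrib[OF adj_carrier[OF Uc[OF c]] Uc[OF c], of "a c"] unitary_groupD(2)[OF U(1)] c K(2) by auto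
    moreover have "adj (U c) * 0\<^sub>m ?n ?n = 0\<^sub>m ?n ?n" by (rule right_mult_zero_mat[OF adj_carrier[OF Uc[OF c]]])
    ultimately have "(a c \<cdot>\<^sub>m 1\<^sub>m ?n) $$ (0, 0) = (0\<^sub>m ?n ?n :: complex mat) $$ (0, 0)" by simp
    moreover have "?n > 0" using irr[OF KD[OF c]] unfolding irreducible_rep_def by simp
    ultimately show "a c = 0" by simp
  qed

  have indep: "\<forall>C\<in>K. a C = 0"
    if K: "finite K" "K \<subseteq> CL" and z: "\<And>x. (\<Sum>C\<in>K. a C * ind C x) = 0" for K a
  proof
    fix C assume C: "C \<in> K"
    then have CC: "C \<in> CL" using K(2) by blast
    have "ind B (pick C) = (if B = C then 1 else 0)" if B: "B \<in> K" for B
    proof -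
      have "B \<in> CL" using B K(2) by blast
      then have "pick C \<in> B \<longleftrightarrow> B = C"
        using quotient_disj[OF eqv, of B C] pick[OF CC] CC unfolding CLq by blast
      then show ?thesis unfolding ind_def by simp
    qed
    then have "(\<Sum>B\<in>K. a B * ind B (pick C)) = (\<Sum>B\<in>K. if B = C then a C else 0)"
      by (intro sum.cong refl) auto
    also have "\<dots> = a C" using K(1) C by (simp add: sum.delta)
    finally show "a C = 0" using z by simp
  qed

  \<comment> \<open>twisted traces are class functions\<close>
  have Fspan: "F c \<in> fun_space.span (ind ` CL)" if c: "c \<in> D" for c
  proof -
    have Fconst: "F c g = F c (pick C)" if C: "C \<in> CL" and g: "g \<in> C" for C g
    proof -
      have "(pick C, g) \<in> rel" using in_quotient_imp_in_rel[OF eqv C[unfolded CLq]] pick[OF C] g by blast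
      then obtain x where x: "pick C \<in> carrier G" "g \<in> carrier G" "x \<in> carrier G" "g = x \<otimes> pick C \<otimes> \<phi> (inv x)"
        unfolding rel_def reidemeister_rel_def by blast
      have "trace (U c * rep c g) = trace (U c * rep c (pick C))"
        unfolding x(4)
        by (rule twisted_trace_class_function[OF \<phi> urep[OF Ddual[OF c]] unitary_groupD(1)[OF U(1)[OF c]] U(2)[OF c] x(3,1)])
      then show ?thesis unfolding F_def using x(1,2) by simp
    qed
    have "F c = (\<Sum>C\<in>CL. (\<lambda>g. F c (pick C) * ind C g))"
    proof
      fix g
      have "(\<Sum>C\<in>CL. (\<lambda>g. F c (pick C) * ind C g)) g = (\<Sum>C\<in>CL. F c (pick C) * ind C g)" by (rule sum_fun_apply)
      also have "\<dots> = F c g"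
      proof (cases "g \<in> carrier G")
        case True
        let ?C = "rel `` {g}"
        have C: "?C \<in> CL" unfolding CLq using True by (rule quotientI)
        have gC: "g \<in> ?C" using True equiv_class_self[OF eqv] by blast
        have "F c (pick B) * ind B g = (if B = ?C then F c g else 0)" if B: "B \<in> CL" for B
        proof (cases "B = ?C")
          case True
          then show ?thesis using Fconst[OF C gC] gC unfolding ind_def by simp
        next
          case False
          then have "g \<notin> B" using quotient_disj[OF eqv, of B ?C] B C gC unfolding CLq by blast
          then show ?thesis using False unfolding ind_def by simp
        qed
        then show ?thesis using CLfin C by (simp add: sum.delta)
      next
        case False
        then have "g \<notin> C" if "C \<in> CL" for C using CLsub[OF that] by blast
        then show ?thesis using False unfolding F_def ind_def by simp
      qed
      finally show "F c g = (\<Sum>C\<in>CL. (\<lambda>g. F c (pick C) * ind C g)) g" by simp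
    qed
    moreover have "(\<Sum>C\<in>CL. (\<lambda>g. F c (pick C) * ind C g)) \<in> fun_space.span (ind ` CL)"
      by (intro fun_space.span_sum fun_space.span_scale fun_space.span_base) blast
    ultimately show ?thesis by simp
  qed

  \<comment> \<open>indicator functions of classes are combinations of twisted traces\<close>
  have indspan: "ind C \<in> fun_space.span (F ` D)" if C: "C \<in> CL" for C
  proof -
    \<comment> \<open>expand over the irreducible representations that are trivial on \<open>V\<close>\<close>
    define \<R> where "\<R> = rep ` {c \<in> unitary_dual_f G. \<forall>v\<in>V. rep c v = 1\<^sub>m (?d (rep c))}"
    have "coefficient_sum G \<R> (ind C)"
    proof (rule coset_function_coefficients[OF V])
      show "ind C (g \<otimes> v) = ind C g" if "g \<in> carrier G" "v \<in> V" for g v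
        using Vsat[OF C that] unfolding ind_def by simp
      show "unitary_rep G (?d r) r" if "r \<in> \<R>" for r using that urep unfolding \<R>_def by blast
      fix m \<tau> assume \<tau>: "irreducible_rep G m \<tau>" and tV: "\<And>v. v \<in> V \<Longrightarrow> \<tau> v = 1\<^sub>m m"
      have ti: "\<tau> \<in> irreps_f G" using \<tau> unfolding irreps_f_def by blast
      let ?c = "R `` {\<tau>}"
      have c: "?c \<in> unitary_dual_f G" unfolding dual using ti by (rule quotientI)
      have tc: "\<tau> \<in> ?c" using equiv_class_self[OF Req ti] .
      have e: "rep_equiv G (rep ?c) \<tau>" by (rule in_class[OF c rep[OF c] tc])
      obtain W where W: "unitary_rep G (?d (rep ?c)) \<tau>" "W \<in> carrier (unitary_group (?d (rep ?c)))"
        "\<And>g. g \<in> carrier G \<Longrightarrow> W * rep ?c g = \<tau> g * W" using rep_equivD[OF e urep[OF c]] by metis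
      have m: "?d (rep ?c) = m"
        using rep_dim_eq[OF W(1)] \<tau> rep_dim_eq[of m \<tau>] unfolding irreducible_rep_def by simp
      note w = unitary_groupD[OF W(2)]
      have "rep ?c v = 1\<^sub>m (?d (rep ?c))" if v: "v \<in> V" for v
      proof -
        have vG: "v \<in> carrier G" using v normal_inD(3)[OF V(1)] by blast
        have "rep ?c v = adj W * \<tau> v * W"
          by (rule conjugate_by_unitary(1)[OF W(2) unitary_repD(1)[OF urep[OF c] vG] unitary_repD(1)[OF W(1) vG] W(3)[OF vG]])
        also have "adj W * \<tau> v = adj W" unfolding tV[OF v] m[symmetric] by (rule right_mult_one_mat[OF adj_carrier[OF w(1)]])
        finally show ?thesis using w(2) by simp
      qed
      then have "rep ?c \<in> \<R>" unfolding \<R>_def using c by blast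
      then show "\<exists>r\<in>\<R>. rep_equiv G r \<tau>" using e by blast
    qed
    then obtain I B where I: "finite I" "I \<subseteq> \<R>" "\<forall>r\<in>I. B r \<in> carrier_mat (?d r) (?d r)"
      "\<forall>g\<in>carrier G. ind C g = (\<Sum>r\<in>I. trace (B r * r g))" unfolding coefficient_sum_def by blast
    have IR: "\<exists>c. c \<in> unitary_dual_f G \<and> r = rep c \<and> (\<forall>v\<in>V. r v = 1\<^sub>m (?d r))" if "r \<in> I" for r
      using that I(2) unfolding \<R>_def by blast
    have Iirr: "irreducible_rep G (?d r) r" if "r \<in> I" for r using IR[OF that] irr by blast
    have Iu: "unitary_rep G (?d r) r" if "r \<in> I" for r using IR[OF that] urep by blast
    have Ifin: "finite (r ` carrier G)" if r: "r \<in> I" for r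
    proof -
      obtain E where E: "finite E" "E \<subseteq> carrier G" "\<forall>h\<in>carrier G. \<exists>f\<in>E. \<exists>k\<in>V. h = f \<otimes> k"
        using V(2) unfolding fin_index_def by blast
      have "r h \<in> r ` E" if h: "h \<in> carrier G" for h
      proof -
        obtain e k where e: "e \<in> E" "k \<in> V" "h = e \<otimes> k" using E(3) h by blast
        have ec: "e \<in> carrier G" "k \<in> carrier G" using e E(2) normal_inD(3)[OF V(1)] by auto
        have "r k = 1\<^sub>m (?d r)" using IR[OF r] e(2) by blast
        then have "r h = r e" unfolding e(3) unitary_repD(4)[OF Iu[OF r] ec]
          using unitary_repD(1)[OF Iu[OF r] ec(1)] by simp
        then show ?thesis using e(1) by blast
      qed
      then have "r ` carrier G \<subseteq> r ` E" by blast
      then show ?thesis using E(1) finite_subset by blast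
    qed
    \<comment> \<open>each nonzero coefficient matrix exhibits an f-point and is a multiple of its intertwiner\<close>
    have tw: "B r * r x = r (\<phi> x) * B r" if r: "r \<in> I" and x: "x \<in> carrier G" for r x
    proof (rule class_function_coefficients_intertwine[OF \<phi> I(1) Iirr Ifin _ _ _ r x])
      show "\<not> rep_equiv G r s" if "r \<in> I" "s \<in> I" "r \<noteq> s" for r s
        using IR[OF that(1)] IR[OF that(2)] that(3) distinct by blast
      show "B r \<in> carrier_mat (?d r) (?d r)" if "r \<in> I" for r using I(3) that by blast
      fix x g assume x: "x \<in> carrier G" and g: "g \<in> carrier G"
      have "ind C (x \<otimes> g \<otimes> \<phi> (inv x)) = ind C g"
        using CLclosed[OF C tw_rel[OF g x]] unfolding ind_def by simp
      then show "(\<Sum>r\<in>I. trace (B r * r (x \<otimes> g \<otimes> \<phi> (inv x)))) = (\<Sum>r\<in>I. trace (B r * r g))"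
        using I(4) x g by simp
    qed
    have "\<exists>h\<in>fun_space.span (F ` D). \<forall>g. h g = (if g \<in> carrier G then trace (B r * r g) else 0)"
      if r: "r \<in> I" for r
    proof (cases "B r = 0\<^sub>m (?d r) (?d r)")
      case True
      have "trace (B r * r g) = 0" if "g \<in> carrier G" for g
        unfolding True using unitary_repD(1)[OF Iu[OF r] that] by (simp add: trace_def)
      then show ?thesis by (intro bexI[of _ 0] fun_space.span_zero) auto
    next
      case False
      let ?n = "?d r"
      obtain c where c: "c \<in> unitary_dual_f G" "r = rep c" using IR[OF r] by blast
      have Br: "B r \<in> carrier_mat ?n ?n" using I(3) r by blast
      have comp: "unitary_rep G ?n (r \<circ> \<phi>)"
        by (rule unitary_repI) (use unitary_repD[OF Iu[OF r]] in auto)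
      have "rep_equiv G r (r \<circ> \<phi>)"
        by (rule intertwiner_unitary[OF Iirr[OF r] comp Br _ False]) (use tw[OF r] in simp)
      moreover have "finite_rep G r" by (rule finite_image_imp_finite_rep[OF Iu[OF r] Ifin[OF r]])
      ultimately have cD: "c \<in> D"
        unfolding D_def unitary_dual_ff_def f_point_def using c rep[OF c(1)] by blast
      note u = unitary_groupD[OF U(1)[OF cD, folded c(2)]]
      have aU: "adj (U c) \<in> carrier_mat ?n ?n" using u(1) by simp
      have "(adj (U c) * B r) * r g = r g * (adj (U c) * B r)" if g: "g \<in> carrier G" for g
      proof -
        have rg: "r g \<in> carrier_mat ?n ?n" "r (\<phi> g) \<in> carrier_mat ?n ?n" using unitary_repD(1)[OF Iu[OF r]] g by auto
        have "(adj (U c) * B r) * r g = adj (U c) * (B r * r g)" by (rule assoc_mult_mat[OF aU Br rg(1)])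
        also have "\<dots> = adj (U c) * (r (\<phi> g) * B r)" unfolding tw[OF r g] ..
        also have "\<dots> = adj (U c) * r (\<phi> g) * B r" by (rule assoc_mult_mat[symmetric, OF aU rg(2) Br])
        also have "adj (U c) * r (\<phi> g) = r g * adj (U c)"
          by (rule conjugate_by_unitary(2)[OF U(1)[OF cD, folded c(2)] rg]) (use U(2)[OF cD g] c(2) in simp)
        also have "\<dots> * B r = r g * (adj (U c) * B r)" by (rule assoc_mult_mat[OF rg(1) aU Br])
        finally show ?thesis .
      qed
      then obtain z where z: "adj (U c) * B r = z \<cdot>\<^sub>m 1\<^sub>m ?n"
        using commutant_scalar[OF Iirr[OF r] mult_carrier_mat[OF aU Br]] by blast
      have "B r = U c * adj (U c) * B r" unfolding u(3) using Br by simp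
      also have "\<dots> = U c * (z \<cdot>\<^sub>m 1\<^sub>m ?n)" unfolding z[symmetric] by (rule assoc_mult_mat[OF u(1) aU Br])
      also have "\<dots> = z \<cdot>\<^sub>m (U c * 1\<^sub>m ?n)" by (rule mult_smult_distrib[OF u(1) one_carrier_mat])
      also have "U c * 1\<^sub>m ?n = U c" by (rule right_mult_one_mat[OF u(1)])
      finally have Bz: "B r = z \<cdot>\<^sub>m U c" .
      have "z * F c g = (if g \<in> carrier G then trace (B r * r g) else 0)" for g
      proof (cases "g \<in> carrier G")
        case True
        have rg: "r g \<in> carrier_mat ?n ?n" by (rule unitary_repD(1)[OF Iu[OF r] True])
        have "B r * r g = z \<cdot>\<^sub>m (U c * r g)" unfolding Bz by (rule mult_smult_assoc_mat[OF u(1) rg])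
        then show ?thesis
          using trace_smult[OF mult_carrier_mat[OF u(1) rg]] True c(2) unfolding F_def by simp
      qed (simp add: F_def)
      moreover have "(\<lambda>g. z * F c g) \<in> fun_space.span (F ` D)"
        by (intro fun_space.span_scale fun_space.span_base) (use cD in blast)
      ultimately show ?thesis by (intro bexI[of _ "\<lambda>g. z * F c g"] allI)
    qed
    then obtain H where H: "\<And>r. r \<in> I \<Longrightarrow> H r \<in> fun_space.span (F ` D)"
      "\<And>r g. r \<in> I \<Longrightarrow> H r g = (if g \<in> carrier G then trace (B r * r g) else 0)" by metis
    have "ind C = (\<Sum>r\<in>I. H r)"
    proof
      fix g
      show "ind C g = (\<Sum>r\<in>I. H r) g"
      proof (cases "g \<in> carrier G")
        case True
        then show ?thesis using I(4) H(2) by (simp add: sum_fun_apply)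
      next
        case False
        then have "g \<notin> C" using CLsub[OF C] by blast
        then show ?thesis using False H(2) by (simp add: sum_fun_apply ind_def)
      qed
    qed
    then show ?thesis using fun_space.span_sum[of I H] H(1) by simp
  qed

  have "finite D \<and> card D \<le> card CL" by (rule independent_family_card_le[OF CLfin Fspan Findep])
  moreover from this have "finite CL \<and> card CL \<le> card D"
    by (intro independent_family_card_le[OF _ indspan indep]) auto
  ultimately have "ecard CL = ecard D" unfolding ecard_def by simp
  then show ?thesis
    using assms(3) unfolding TBFT_ff_def reidemeister_number_def CL_def D_def by simp
qed

theorem theorem6p1:
  fixes G :: "('a, 'b) monoid_scheme" and \<phi> :: "'a \<Rightarrow> 'a"
  assumes "group G" and "polycyclic G"
    and "\<phi> \<in> hom G G"
    and "reidemeister_number G \<phi> < \<infinity>"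
  shows "TBFT_ff G \<phi>"
  using group.polycyclic_TBFT_ff assms by blast

end
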